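(* Assume the drift, initial-measure, minorization, majorization, potential and lower-mass conditions listed in the context. Then for any $\xi\in(0,1/4)$ there exist $\rho<1$ and $C<+\infty$, depending on the constants in these conditions, such that for any bounded measurable $\varphi:\mathsf{X}\to\mathbb{R}$, $n\geq 1$, $s\in\{I,M,C,W\}$, $$\sigma_n^{2,s}(\varphi)\le\check\eta_n^s\Big(\{\varphi\otimes1-1\otimes\varphi-[\eta_n^f-\eta_n^c](\varphi)\}^2\Big)+C\Big\{B(n,f,c,\varphi,\xi)+\|\varphi\|^2\sum_{p=0}^{n-1}\rho^{n-p}\Big(\check\eta_p^s(\mathbb{I}_A(v\otimes v)^{2\xi})(\rho^{n-p}+1)\Big)\Big\}.$$ Additionally assume the Lipschitz condition listed in the context (for the given metric $\mathsf{d}$ on $\mathsf{X}$). If $\mathsf{d}^2\in\mathcal{L}_{(v\otimes v)^{\tilde\xi}}(\mathsf{X}\times\mathsf{X})$ with $\tilde\xi\in(0,1/2)$, then for any $\xi\in(0,(1-2\tilde\xi)/12)$ there exist $\rho<1$ and $C<+\infty$, depending on the constants in all these conditions, such that for any $\varphi\in\mathcal{B}_b(\mathsf{X})\cap\mathrm{Lip}_{\mathsf{d}}(\mathsf{X})$, $n\geq1$, $s\in\{I,M,C,W\}$, $$\sigma_n^{2,s}(\varphi)\le\check\eta_n^s\Big(\{\varphi\otimes1-1\otimes\varphi-[\eta_n^f-\eta_n^c](\varphi)\}^2\Big)+C\Big\{B(n,f,c,\varphi,\xi)+\|\varphi\|^2\sum_{p=0}^{n-1}\rho^{n-p}\Big(\check\eta_p^s(\mathsf{d}^2(v^{4\xi}\otimes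 v^{8\xi}))(\rho^{n-p}+1)\Big)\Big\}.$$
   Context: **Model.** $(\mathsf{X},\mathcal{X})$ is a measurable space; for $n\ge0$, $G_n:\mathsf{X}\to\mathbb{R}_+$ is bounded measurable. For $s\in\{f,c\}$, $\eta_0^s$ is a probability measure and $M_n^s$ ($n\ge1$) are Markov kernels on $\mathsf{X}$. $\mu(\varphi)=\int\varphi\,d\mu$, $K(\varphi)(x)=\int\varphi(y)K(x,dy)$, $(\varphi\otimes\psi)(x,y)=\varphi(x)\psi(y)$, $\|\varphi\|=\sup|\varphi|$. For $w\ge1$: $\|\varphi\|_w=\sup_x|\varphi(x)|/w(x)$, $\mathcal{L}_w=\{\varphi:\|\varphi\|_w<\infty\}$; $\mathrm{Lip}_{w,\mathsf{d}}(\mathsf{X})$ is the set of $\varphi\in\mathcal{L}_w(\mathsf{X})$ for which some $C<\infty$ satisfies $|\varphi(x)-\varphi(y)|\le C\mathsf{d}(x,y)w(x)w(y)$ for all $x,y$; $\mathrm{Lip}_{\mathsf{d}}=\mathrm{Lip}_{1,\mathsf{d}}$; $\mathcal{B}_b$ denotes bounded measurable functions. Define $\gamma_n^s(\varphi)=\int\varphi(x_n)\prod_{p=0}^{n-1}G_p(x_p)\,\eta_0^s(dx_0)\prod_{p=1}^nM_p^s(x_{p-1},dx_p)$, $\eta_n^s=\gamma_n^s/\gamma_n^s(1)$; $Q_n^s(x,dy)=G_{n-1}(x)M_n^s(x,dy)$, $Q_{p,n}^s=Q_{p+1}^s\cdots Q_n^s$ ($p<n$), $Q_{n,n}^s=\mathrm{Id}$;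 $D_{p,n}^s(\varphi)=Q_{p,n}^s(\varphi-\eta_n^s(\varphi))/\eta_p^s(Q_{p,n}^s(1))$; $h_{p,n}^s=Q_{p,n}^s(1)/\eta_p^s(Q_{p,n}^s(1))$; $S_{p,n}^{f,c}(\varphi)=\frac{Q_{p,n}^f(\varphi)}{Q_{p,n}^f(1)}-\frac{Q_{p,n}^c(\varphi)}{Q_{p,n}^c(1)}$. With $\rho$ the constant in the claim, $$B(n,f,c,\varphi,\xi)=\|\varphi\|\sum_{p=0}^{n-1}\rho^{n-p}\Big\{\|h_{p,n}^fS_{p,n}^{f,c}(\varphi)\|_{v^\xi}+|[\eta_n^f-\eta_n^c](\varphi)|+\|\varphi\|\,\|h_{p,n}^f-h_{p,n}^c\|_{v^\xi}\rho^{n-p}\Big\}.$$ $A=\{(x,y)\in\mathsf{X}\times\mathsf{X}:x\ne y\}$. **Couplings.** $\check\eta_0$ is a coupling of $(\eta_0^f,\eta_0^c)$ and $\check M_n((x,x'),\cdot)$ a Markov kernel coupling $M_n^f(x,\cdot)$ and $M_n^c(x',\cdot)$. For $s\in\{I,M,C,W\}$ (each considered in the setting in which it is defined), $\check\eta_n^s$ is the following coupling of $(\eta_n^f,\eta_n^c)$, and $$\sigma_n^{2,s}(\varphi)=\sum_{p=0}^n\check\eta_p^s(\{D_{p,n}^f(\varphi)\otimes1-1\otimes D_{p,n}^c(\varphi)\}^2).$$ - $I$: $\check\eta_0^I=\check\eta_0$, $\check\eta_n^I(B)=\frac{(\eta_{n-1}^f\otimes\eta_{n-1}^c)([G_{n-1}\otimes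 G_{n-1}]\check M_n(B))}{(\eta_{n-1}^f\otimes\eta_{n-1}^c)(G_{n-1}\otimes G_{n-1})}$. - $M$: $\check\eta_0^M=\check\eta_0$ and, with $\mu=\check\eta_{n-1}^M$, $F_f(x,y)=G_{n-1}(x)/\mu(G_{n-1}\otimes1)$, $F_c(x,y)=G_{n-1}(y)/\mu(1\otimes G_{n-1})$, $\overline F_s=(F_s-F_f\wedge F_c)/\mu(F_s-F_f\wedge F_c)$, $\bar M_n(B)((x,y),(u,w))=\check M_n(B)(x,w)$: $\check\eta_n^M(B)=\mu(\{F_f\wedge F_c\}\check M_n(B))+(1-\mu(F_f\wedge F_c))(\mu\otimes\mu)(\{\overline F_f\otimes\overline F_c\}\bar M_n(B))$ (last term $0$ if $\mu(F_f\wedge F_c)=1$). - $C$ (when $\eta_0^s$, $M_n^s$ have densities w.r.t. a $\sigma$-finite measure $dx$): $\check\eta_n^C$ is the maximal coupling of $(\eta_n^f,\eta_n^c)$: with densities $\eta_n^f(x),\eta_n^c(x)$ and $m=\eta_n^f\wedge\eta_n^c$, $\check\eta_n^C(B)=\int\mathbb{I}_B(u,u)m(u)du+\frac{1}{1-\int m}\int\mathbb{I}_B(x,y)(\eta_n^f(x)-m(x))(\eta_n^c(y)-m(y))dxdy$ (last term $0$ if $\int m=1$). - $W$ (when $\mathsf{X}=\mathbb{R}$ and the CDF $F_{\overline\eta_n^s}$ and its inverse exist and are continuous, where $\overline\eta_n^s(\varphi)=\eta_n^s(G_n\varphi)/\eta_n^s(G_n)$, $s\in\{f,c\}$): $\check\eta_0^W=\check\eta_0$,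 $\check\eta_n^W(B)=\int_0^1\check M_n(B)\big(F_{\overline\eta_{n-1}^f}^{-1}(w),F_{\overline\eta_{n-1}^c}^{-1}(w)\big)dw$. **Conditions.** - *Drift*: there exist an unbounded $\tilde V:\mathsf{X}\to[1,\infty)$ and constants $\delta\in(0,1)$, $\underline d\ge1$ such that for each $d\in(\underline d,\infty)$ there is $b_d<\infty$ with $\sup_{n\ge1}Q_n^s(e^{\tilde V})(x)\le e^{(1-\delta)\tilde V(x)+b_d\mathbb{I}_{C_d}(x)}$ for all $x\in\mathsf{X}$, $s\in\{f,c\}$, where $C_d=\{x:\tilde V(x)\le d\}$. Set $v=e^{\tilde V}$. - *Initial measure*: there is $C<\infty$ with $\eta_0^s(v)\le C$, $s\in\{f,c\}$; and for any $r>1$ there is $C<\infty$ with $\eta_0^s(C_r)^{-1}\le C$, $s\in\{f,c\}$. - *Minorization*: for each $d\in[\underline d,\infty)$, $s\in\{f,c\}$: $\int_{C_d}G_{n-1}(x)M_n^s(x,dy)>0$ for all $x\in\mathsf{X}$, $n\ge1$; and there exist $\tilde\epsilon_d^->0$ and a probability $\nu_d$ with $\nu_d(v)<\infty$ such that $\inf_{n\ge1}\int_{C_d\cap E}Q_n^s(x,dy)\ge\tilde\epsilon_d^-\nu_d(C_d\cap E)$ for all $x\in C_d$, $E\in\mathcal{X}$, $s\in\{f,c\}$. - *Majorization*: with the same $\nu_d$, for each $d\in[\underline d,\infty)$ there is $\tilde\epsilon_d^+\in[\tilde\epsilon_d^-,\infty)$ such that $\sup_{n\ge1}\int_{C_d\cap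 E}Q_n^s(x,dy)\le\tilde\epsilon_d^+\nu_d(C_d\cap E)$ for all $x\in C_d$, $E\in\mathcal{X}$, $s\in\{f,c\}$. - *Potential*: $\sup_{n\ge0}\sup_xG_n(x)<\infty$; and for any $r>1$ there is $C>0$ with $\inf_{x\in C_r}G_0(x)\ge C$. - *Lower mass*: for each $d\in[\underline d,\infty)$, $1/(G_nM_{n+1}^s(\mathbb{I}_{C_d}))\in\mathcal{L}_v(\mathsf{X})$ for all $n\ge0$, $s\in\{f,c\}$, and $\sup_{n\ge0}\max_{s\in\{f,c\}}\|1/(G_nM_{n+1}^s(\mathbb{I}_{C_d}))\|_v<\infty$. - *Lipschitz*: $\mathsf{d}$ is a given metric on $\mathsf{X}$; for any $\xi\in(0,1]$ there is $C<\infty$ such that for all $\varphi\in\mathcal{L}_{v^\xi}(\mathsf{X})\cap\mathrm{Lip}_{v^\xi,\mathsf{d}}(\mathsf{X})$, $x,y\in\mathsf{X}$, $s\in\{f,c\}$: $\sup_{n\ge1}|Q_n^s(\varphi)(x)-Q_n^s(\varphi)(y)|\le C\|\varphi\|_{v^\xi}\mathsf{d}(x,y)[v(x)v(y)]^\xi$. *)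

theory Defs
  imports "HOL-Probability.Probability"
begin

datatype level = Fine | Coarse

text \<open>\<open>G\<close>, \<open>eta0\<close> and \<open>M\<close> are the potentials, initial laws and Markov kernels;
  \<open>ceta0\<close> and \<open>cM\<close> are the given couplings of the initial laws and of the kernels.
  Only the \<open>\<sigma>\<close>-algebra of \<open>state\<close> is used, not its measure.\<close>

record 'a model =
  state :: "'a measure"
  G :: "nat \<Rightarrow> 'a \<Rightarrow> real"
  eta0 :: "level \<Rightarrow> 'a measure"
  M :: "level \<Rightarrow> nat \<Rightarrow> 'a \<Rightarrow> 'a measure"
  ceta0 :: "('a \<times> 'a) measure"
  cM :: "nat \<Rightarrow> 'a \<times> 'a \<Rightarrow> ('a \<times> 'a) measure"

abbreviation state2 :: "'a model \<Rightarrow> ('a \<times> 'a) measure" where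
  "state2 m \<equiv> state m \<Otimes>\<^sub>M state m"

definition is_coupling :: "'a measure \<Rightarrow> ('a \<times> 'a) measure \<Rightarrow> 'a measure \<Rightarrow> 'a measure \<Rightarrow> bool" where
  "is_coupling X P \<mu> \<nu> \<longleftrightarrow>
     P \<in> space (prob_algebra (X \<Otimes>\<^sub>M X)) \<and> distr P X fst = \<mu> \<and> distr P X snd = \<nu>"

definition bounded_measurable :: "'a measure \<Rightarrow> ('a \<Rightarrow> real) set" where
  "bounded_measurable X = {\<phi> \<in> borel_measurable X. bounded (\<phi> ` space X)}"

definition valid_model :: "'a model \<Rightarrow> bool" where
  "valid_model m \<longleftrightarrow>
     (\<forall>n. G m n \<in> bounded_measurable (state m) \<and> (\<forall>x \<in> space (state m). 0 \<le> G m n x)) \<and>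
     (\<forall>s. eta0 m s \<in> space (prob_algebra (state m))) \<and>
     (\<forall>s. \<forall>n\<ge>1. M m s n \<in> state m \<rightarrow>\<^sub>M prob_algebra (state m)) \<and>
     is_coupling (state m) (ceta0 m) (eta0 m Fine) (eta0 m Coarse) \<and>
     (\<forall>n\<ge>1. cM m n \<in> state2 m \<rightarrow>\<^sub>M prob_algebra (state2 m) \<and>
        (\<forall>x \<in> space (state m). \<forall>x' \<in> space (state m).
           is_coupling (state m) (cM m n (x, x')) (M m Fine n x) (M m Coarse n x')))"

subsection \<open>Weighted norms and function classes\<close>

text \<open>The supremum is taken in the reals, so it is meaningful only for functions with finite
  norm; \<open>weighted_L\<close> is the set of these (among the measurable ones).\<close>

definition wnorm :: "'a measure \<Rightarrow> ('a \<Rightarrow> real) \<Rightarrow> ('a \<Rightarrow> real) \<Rightarrow> real" where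
  "wnorm X w \<phi> = (SUP x \<in> space X. \<bar>\<phi> x\<bar> / w x)"

abbreviation supnorm :: "'a measure \<Rightarrow> ('a \<Rightarrow> real) \<Rightarrow> real" where
  "supnorm X \<phi> \<equiv> wnorm X (\<lambda>_. 1) \<phi>"

definition weighted_L :: "'a measure \<Rightarrow> ('a \<Rightarrow> real) \<Rightarrow> ('a \<Rightarrow> real) set" where
  "weighted_L X w = {\<phi> \<in> borel_measurable X. bdd_above ((\<lambda>x. \<bar>\<phi> x\<bar> / w x) ` space X)}"

definition weighted_Lip ::
  "'a measure \<Rightarrow> ('a \<Rightarrow> real) \<Rightarrow> ('a \<Rightarrow> 'a \<Rightarrow> real) \<Rightarrow> ('a \<Rightarrow> real) set" where
  "weighted_Lip X w d = {\<phi> \<in> weighted_L X w.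
     \<exists>C. \<forall>x \<in> space X. \<forall>y \<in> space X. \<bar>\<phi> x - \<phi> y\<bar> \<le> C * d x y * w x * w y}"

subsection \<open>Feynman--Kac flows and semigroups\<close>

text \<open>Law of the Markov chain path \<open>(x\<^sub>0, \<dots>, x\<^sub>n)\<close>.\<close>

primrec path_law :: "'a model \<Rightarrow> level \<Rightarrow> nat \<Rightarrow> (nat \<Rightarrow> 'a) measure" where
  "path_law m s 0 = distr (eta0 m s) (Pi\<^sub>M {..0} (\<lambda>_. state m)) (\<lambda>x. \<lambda>i\<in>{..0}. x)"
| "path_law m s (Suc n) =
     path_law m s n \<bind> (\<lambda>\<omega>. distr (M m s (Suc n) (\<omega> n))
       (Pi\<^sub>M {..Suc n} (\<lambda>_. state m)) (\<lambda>y. fun_upd \<omega> (Suc n) y))"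

definition gamma :: "'a model \<Rightarrow> level \<Rightarrow> nat \<Rightarrow> 'a measure" where
  "gamma m s n =
     distr (density (path_law m s n) (\<lambda>\<omega>. ennreal (\<Prod>p<n. G m p (\<omega> p)))) (state m) (\<lambda>\<omega>. \<omega> n)"

definition eta :: "'a model \<Rightarrow> level \<Rightarrow> nat \<Rightarrow> 'a measure" where
  "eta m s n = scale_measure (inverse (emeasure (gamma m s n) (space (state m)))) (gamma m s n)"

definition eta_bar :: "'a model \<Rightarrow> level \<Rightarrow> nat \<Rightarrow> 'a measure" where
  "eta_bar m s n =
     density (eta m s n) (\<lambda>x. ennreal (G m n x / (\<integral>y. G m n y \<partial>eta m s n)))"

definition Q :: "'a model \<Rightarrow> level \<Rightarrow> nat \<Rightarrow> ('a \<Rightarrow> real) \<Rightarrow> 'a \<Rightarrow> real" where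
  "Q m s n \<phi> x = G m (n - 1) x * (\<integral>y. \<phi> y \<partial>M m s n x)"

text \<open>\<open>Q_semi m s p n = Q m s (p+1) \<circ> \<dots> \<circ> Q m s n\<close> for \<open>p \<le> n\<close>.\<close>

definition Q_semi :: "'a model \<Rightarrow> level \<Rightarrow> nat \<Rightarrow> nat \<Rightarrow> ('a \<Rightarrow> real) \<Rightarrow> 'a \<Rightarrow> real" where
  "Q_semi m s p n \<phi> = foldr (Q m s) [Suc p..<Suc n] \<phi>"

definition D :: "'a model \<Rightarrow> level \<Rightarrow> nat \<Rightarrow> nat \<Rightarrow> ('a \<Rightarrow> real) \<Rightarrow> 'a \<Rightarrow> real" where
  "D m s p n \<phi> x =
     Q_semi m s p n (\<lambda>y. \<phi> y - (\<integral>z. \<phi> z \<partial>eta m s n)) x /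
     (\<integral>z. Q_semi m s p n (\<lambda>_. 1) z \<partial>eta m s p)"

definition h :: "'a model \<Rightarrow> level \<Rightarrow> nat \<Rightarrow> nat \<Rightarrow> 'a \<Rightarrow> real" where
  "h m s p n x =
     Q_semi m s p n (\<lambda>_. 1) x / (\<integral>z. Q_semi m s p n (\<lambda>_. 1) z \<partial>eta m s p)"

definition S :: "'a model \<Rightarrow> nat \<Rightarrow> nat \<Rightarrow> ('a \<Rightarrow> real) \<Rightarrow> 'a \<Rightarrow> real" where
  "S m p n \<phi> x =
     Q_semi m Fine p n \<phi> x / Q_semi m Fine p n (\<lambda>_. 1) x -
     Q_semi m Coarse p n \<phi> x / Q_semi m Coarse p n (\<lambda>_. 1) x"

definition eta_diff :: "'a model \<Rightarrow> nat \<Rightarrow> ('a \<Rightarrow> real) \<Rightarrow> real" where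
  "eta_diff m n \<phi> = (\<integral>x. \<phi> x \<partial>eta m Fine n) - (\<integral>x. \<phi> x \<partial>eta m Coarse n)"

definition B_term ::
  "'a model \<Rightarrow> ('a \<Rightarrow> real) \<Rightarrow> real \<Rightarrow> nat \<Rightarrow> ('a \<Rightarrow> real) \<Rightarrow> real \<Rightarrow> real" where
  "B_term m v \<rho> n \<phi> \<xi> = (let X = state m; w = (\<lambda>x. v x powr \<xi>) in
     supnorm X \<phi> * (\<Sum>p<n. \<rho> ^ (n - p) *
       (wnorm X w (\<lambda>x. h m Fine p n x * S m p n \<phi> x)
        + \<bar>eta_diff m n \<phi>\<bar>
        + supnorm X \<phi> * wnorm X w (\<lambda>x. h m Fine p n x - h m Coarse p n x) * \<rho> ^ (n - p))))"

subsection \<open>The coupled flows\<close>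

text \<open>In each definition the measure of a set \<open>B\<close> is given explicitly.\<close>

abbreviation meas2 :: "'a model \<Rightarrow> (('a \<times> 'a) set \<Rightarrow> ennreal) \<Rightarrow> ('a \<times> 'a) measure" where
  "meas2 m \<mu> \<equiv> measure_of (space (state2 m)) (sets (state2 m)) \<mu>"

primrec coupling_I :: "'a model \<Rightarrow> nat \<Rightarrow> ('a \<times> 'a) measure" where
  "coupling_I m 0 = ceta0 m"
| "coupling_I m (Suc n) = (let P = eta m Fine n \<Otimes>\<^sub>M eta m Coarse n;
       GG = (\<lambda>z. ennreal (G m n (fst z) * G m n (snd z)))
     in meas2 m (\<lambda>B. (\<integral>\<^sup>+z. GG z * emeasure (cM m (Suc n) z) B \<partial>P) / (\<integral>\<^sup>+z. GG z \<partial>P)))"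

primrec coupling_M :: "'a model \<Rightarrow> nat \<Rightarrow> ('a \<times> 'a) measure" where
  "coupling_M m 0 = ceta0 m"
| "coupling_M m (Suc n) = (let \<mu> = coupling_M m n;
       Ff = (\<lambda>z. G m n (fst z) / (\<integral>z'. G m n (fst z') \<partial>\<mu>));
       Fc = (\<lambda>z. G m n (snd z) / (\<integral>z'. G m n (snd z') \<partial>\<mu>));
       Fm = (\<lambda>z. min (Ff z) (Fc z));
       Rf = (\<lambda>z. (Ff z - Fm z) / (\<integral>z'. Ff z' - Fm z' \<partial>\<mu>));
       Rc = (\<lambda>z. (Fc z - Fm z) / (\<integral>z'. Fc z' - Fm z' \<partial>\<mu>));
       a = (\<integral>z. Fm z \<partial>\<mu>)
     in meas2 m (\<lambda>B.
       (\<integral>\<^sup>+z. ennreal (Fm z) * emeasure (cM m (Suc n) z) B \<partial>\<mu>) +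
       (if a = 1 then 0
        else ennreal (1 - a) *
          (\<integral>\<^sup>+((x, y), (u, w)). ennreal (Rf (x, y) * Rc (u, w)) * emeasure (cM m (Suc n) (x, w)) B
             \<partial>(\<mu> \<Otimes>\<^sub>M \<mu>)))))"

text \<open>Maximal coupling of \<open>eta m Fine n\<close> and \<open>eta m Coarse n\<close>, with densities
  taken with respect to \<open>lam\<close>.\<close>

definition coupling_C :: "'a model \<Rightarrow> 'a measure \<Rightarrow> nat \<Rightarrow> ('a \<times> 'a) measure" where
  "coupling_C m lam n = (let
       f = RN_deriv lam (eta m Fine n);
       g = RN_deriv lam (eta m Coarse n);
       mn = (\<lambda>u. min (f u) (g u));
       a = (\<integral>\<^sup>+u. mn u \<partial>lam)
     in meas2 m (\<lambda>B.
       (\<integral>\<^sup>+u. indicator B (u, u) * mn u \<partial>lam) +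
       (if a = 1 then 0
        else (\<integral>\<^sup>+x. (\<integral>\<^sup>+y. indicator B (x, y) * (f x - mn x) * (g y - mn y) \<partial>lam) \<partial>lam) /
             (1 - a))))"

text \<open>The setting \<open>\<X> = \<real>\<close> of the Wasserstein coupling is expressed by a bimeasurable bijection
  \<open>e\<close> between the state space and the real line; for the real line itself take
  \<open>e = id\<close>. The inverse CDF is only used on the open unit interval.\<close>

definition real_cdf :: "'a model \<Rightarrow> ('a \<Rightarrow> real) \<Rightarrow> level \<Rightarrow> nat \<Rightarrow> real \<Rightarrow> real" where
  "real_cdf m e s n = cdf (distr (eta_bar m s n) borel e)"

definition real_cdf_inv :: "'a model \<Rightarrow> ('a \<Rightarrow> real) \<Rightarrow> level \<Rightarrow> nat \<Rightarrow> real \<Rightarrow> real" where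
  "real_cdf_inv m e s n w = (THE t. real_cdf m e s n t = w)"

primrec coupling_W :: "'a model \<Rightarrow> ('a \<Rightarrow> real) \<Rightarrow> nat \<Rightarrow> ('a \<times> 'a) measure" where
  "coupling_W m e 0 = ceta0 m"
| "coupling_W m e (Suc n) = (let
       r = the_inv_into (space (state m)) e;
       z = (\<lambda>w. (r (real_cdf_inv m e Fine n w), r (real_cdf_inv m e Coarse n w)))
     in meas2 m (\<lambda>B. \<integral>\<^sup>+w\<in>{0<..<1}. emeasure (cM m (Suc n) (z w)) B \<partial>lborel))"

text \<open>The four couplings; \<open>C\<close> carries the dominating measure, \<open>W\<close> the identification of the
  state space with the real line.\<close>

datatype 'a scheme = Sch_I | Sch_M | Sch_C "'a measure" | Sch_W "'a \<Rightarrow> real"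

fun scheme_setting :: "'a model \<Rightarrow> 'a scheme \<Rightarrow> bool" where
  "scheme_setting m Sch_I \<longleftrightarrow> True"
| "scheme_setting m Sch_M \<longleftrightarrow> True"
| "scheme_setting m (Sch_C lam) \<longleftrightarrow>
     sigma_finite_measure lam \<and> sets lam = sets (state m) \<and>
     (\<forall>s. (\<exists>q \<in> borel_measurable lam. eta0 m s = density lam q) \<and>
       (\<forall>n\<ge>1. \<forall>x \<in> space (state m). \<exists>q \<in> borel_measurable lam. M m s n x = density lam q))"
| "scheme_setting m (Sch_W e) \<longleftrightarrow>
     bij_betw e (space (state m)) UNIV \<and> e \<in> state m \<rightarrow>\<^sub>M borel \<and>
     the_inv_into (space (state m)) e \<in> borel \<rightarrow>\<^sub>M state m \<and>
     (\<forall>s n. continuous_on UNIV (real_cdf m e s n) \<and>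
       (\<forall>w \<in> {0<..<1}. \<exists>!t. real_cdf m e s n t = w) \<and>
       continuous_on {0<..<1} (real_cdf_inv m e s n))"

fun ceta :: "'a model \<Rightarrow> 'a scheme \<Rightarrow> nat \<Rightarrow> ('a \<times> 'a) measure" where
  "ceta m Sch_I n = coupling_I m n"
| "ceta m Sch_M n = coupling_M m n"
| "ceta m (Sch_C lam) n = coupling_C m lam n"
| "ceta m (Sch_W e) n = coupling_W m e n"

definition sigma2 :: "'a model \<Rightarrow> 'a scheme \<Rightarrow> nat \<Rightarrow> ('a \<Rightarrow> real) \<Rightarrow> real" where
  "sigma2 m s n \<phi> =
     (\<Sum>p\<le>n. \<integral>(x, y). (D m Fine p n \<phi> x - D m Coarse p n \<phi> y)\<^sup>2 \<partial>ceta m s p)"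

definition off_diagonal :: "'a model \<Rightarrow> ('a \<times> 'a) set" where
  "off_diagonal m = {(x, y) \<in> space (state2 m). x \<noteq> y}"

subsection \<open>Conditions\<close>

text \<open>The numerical constants of the conditions. Fields of function type are indexed by the level
  \<open>d\<close> (or \<open>r\<close>) of the sublevel set they refer to. They are kept apart from the model so that a
  statement can assert that a bound depends on these constants only.\<close>

record constants =
  delta :: real
  d_low :: real
  b :: "real \<Rightarrow> real"
  init_v :: real
  init_C :: "real \<Rightarrow> real"
  eps_minus :: "real \<Rightarrow> real"
  eps_plus :: "real \<Rightarrow> real"
  G_sup :: real
  G0_inf :: "real \<Rightarrow> real"
  mass_sup :: "real \<Rightarrow> real"

definition sublevel :: "'a model \<Rightarrow> ('a \<Rightarrow> real) \<Rightarrow> real \<Rightarrow> 'a set" where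
  "sublevel m V d = {x \<in> space (state m). V x \<le> d}"

text \<open>Integrals of the unbounded function \<open>exp \<circ> V\<close> in the conditions are nonnegative integrals, so
  that the bounds assert finiteness.\<close>

definition drift_cond :: "constants \<Rightarrow> 'a model \<Rightarrow> ('a \<Rightarrow> real) \<Rightarrow> bool" where
  "drift_cond k m V \<longleftrightarrow>
     V \<in> borel_measurable (state m) \<and> (\<forall>x \<in> space (state m). 1 \<le> V x) \<and>
     \<not> bdd_above (V ` space (state m)) \<and>
     0 < delta k \<and> delta k < 1 \<and> 1 \<le> d_low k \<and>
     (\<forall>d>d_low k. \<forall>s. \<forall>n\<ge>1. \<forall>x \<in> space (state m).
        ennreal (G m (n - 1) x) * (\<integral>\<^sup>+y. ennreal (exp (V y)) \<partial>M m s n x)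
          \<le> ennreal (exp ((1 - delta k) * V x + b k d * indicator (sublevel m V d) x)))"

text \<open>In \<open>ennreal\<close>, \<open>inverse 0 = \<infinity>\<close>, so the bound on the inverse forces positive mass.\<close>

definition init_cond :: "constants \<Rightarrow> 'a model \<Rightarrow> ('a \<Rightarrow> real) \<Rightarrow> bool" where
  "init_cond k m V \<longleftrightarrow>
     (\<forall>s. (\<integral>\<^sup>+x. ennreal (exp (V x)) \<partial>eta0 m s) \<le> ennreal (init_v k)) \<and>
     (\<forall>r>1. \<forall>s. inverse (emeasure (eta0 m s) (sublevel m V r)) \<le> ennreal (init_C k r))"

definition minorization_cond ::
  "constants \<Rightarrow> 'a model \<Rightarrow> ('a \<Rightarrow> real) \<Rightarrow> (real \<Rightarrow> 'a measure) \<Rightarrow> bool" where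
  "minorization_cond k m V \<nu> \<longleftrightarrow> (\<forall>d\<ge>d_low k.
     (\<forall>s. \<forall>n\<ge>1. \<forall>x \<in> space (state m). 0 < G m (n - 1) x * measure (M m s n x) (sublevel m V d)) \<and>
     0 < eps_minus k d \<and>
     \<nu> d \<in> space (prob_algebra (state m)) \<and> (\<integral>\<^sup>+x. ennreal (exp (V x)) \<partial>\<nu> d) < \<infinity> \<and>
     (\<forall>s. \<forall>n\<ge>1. \<forall>x \<in> sublevel m V d. \<forall>E \<in> sets (state m).
        eps_minus k d * measure (\<nu> d) (sublevel m V d \<inter> E)
          \<le> G m (n - 1) x * measure (M m s n x) (sublevel m V d \<inter> E)))"

definition majorization_cond ::
  "constants \<Rightarrow> 'a model \<Rightarrow> ('a \<Rightarrow> real) \<Rightarrow> (real \<Rightarrow> 'a measure) \<Rightarrow> bool" where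
  "majorization_cond k m V \<nu> \<longleftrightarrow> (\<forall>d\<ge>d_low k.
     eps_minus k d \<le> eps_plus k d \<and>
     (\<forall>s. \<forall>n\<ge>1. \<forall>x \<in> sublevel m V d. \<forall>E \<in> sets (state m).
        G m (n - 1) x * measure (M m s n x) (sublevel m V d \<inter> E)
          \<le> eps_plus k d * measure (\<nu> d) (sublevel m V d \<inter> E)))"

definition potential_cond :: "constants \<Rightarrow> 'a model \<Rightarrow> ('a \<Rightarrow> real) \<Rightarrow> bool" where
  "potential_cond k m V \<longleftrightarrow>
     (\<forall>n. \<forall>x \<in> space (state m). G m n x \<le> G_sup k) \<and>
     (\<forall>r>1. 0 < G0_inf k r \<and> (\<forall>x \<in> sublevel m V r. G0_inf k r \<le> G m 0 x))"

text \<open>The denominator below is positive by the minorization condition.\<close>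

definition lower_mass_cond :: "constants \<Rightarrow> 'a model \<Rightarrow> ('a \<Rightarrow> real) \<Rightarrow> bool" where
  "lower_mass_cond k m V \<longleftrightarrow> (\<forall>d\<ge>d_low k. \<forall>n s.
     let g = (\<lambda>x. 1 / (G m n x * measure (M m s (Suc n) x) (sublevel m V d)))
     in g \<in> weighted_L (state m) (\<lambda>x. exp (V x)) \<and>
        wnorm (state m) (\<lambda>x. exp (V x)) g \<le> mass_sup k d)"

definition standing_conds ::
  "constants \<Rightarrow> 'a model \<Rightarrow> ('a \<Rightarrow> real) \<Rightarrow> (real \<Rightarrow> 'a measure) \<Rightarrow> bool" where
  "standing_conds k m V \<nu> \<longleftrightarrow>
     drift_cond k m V \<and> init_cond k m V \<and> minorization_cond k m V \<nu> \<and>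
     majorization_cond k m V \<nu> \<and> potential_cond k m V \<and> lower_mass_cond k m V"

definition lipschitz_cond ::
  "(real \<Rightarrow> real) \<Rightarrow> 'a model \<Rightarrow> ('a \<Rightarrow> real) \<Rightarrow> ('a \<Rightarrow> 'a \<Rightarrow> real) \<Rightarrow> bool" where
  "lipschitz_cond K m V d \<longleftrightarrow> (\<forall>\<xi>>0. \<xi> \<le> 1 \<longrightarrow> (let w = (\<lambda>x. exp (V x) powr \<xi>) in
     \<forall>\<phi> \<in> weighted_L (state m) w \<inter> weighted_Lip (state m) w d.
     \<forall>x \<in> space (state m). \<forall>y \<in> space (state m). \<forall>s. \<forall>n\<ge>1.
       \<bar>Q m s n \<phi> x - Q m s n \<phi> y\<bar>
         \<le> K \<xi> * wnorm (state m) w \<phi> * d x y * (exp (V x) * exp (V y)) powr \<xi>))"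

end

theory Submission
  imports Defs
begin

text \<open>
  Write \<open>\<gamma>\<^sub>n, \<eta>\<^sub>n, Q\<^sub>p\<^sub>,\<^sub>n, D\<^sub>p\<^sub>,\<^sub>n, h\<^sub>p\<^sub>,\<^sub>n\<close> for the objects of one level and \<open>v = e\<^sup>V\<close>. The summand \<open>p = n\<close> of
  \<open>\<sigma>\<^sup>2\<close> is the first term of the bound, because \<open>D\<^sub>n\<^sub>,\<^sub>n(\<phi>) = \<phi> - \<eta>\<^sub>n(\<phi>)\<close>. For \<open>p < n\<close> the difference
  \<open>D\<^sup>f(x) - D\<^sup>c(y)\<close> is the sum of \<open>D\<^sup>f(x) - D\<^sup>f(y)\<close> and \<open>D\<^sup>f(y) - D\<^sup>c(y)\<close>. The second, a difference of levels
  at one point, is expanded algebraically into the three terms of \<open>B\<close> (\<open>D_level_difference\<close>). The first is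
  estimated either by the decay of \<open>D\<^sup>f\<close> off the diagonal, or through the Lipschitz condition for the kernel
  \<open>Q\<^sub>p\<^sub>+\<^sub>1\<close> in \<open>D\<^sub>p\<^sub>,\<^sub>n = Q\<^sub>p\<^sub>+\<^sub>1(D\<^sub>p\<^sub>+\<^sub>1\<^sub>,\<^sub>n) / \<eta>\<^sub>p(G\<^sub>p)\<close>. What the couplings contribute is only that their marginals are
  \<open>\<eta>\<^sup>f\<close> and \<open>\<eta>\<^sup>c\<close> (\<open>ceta_coupling\<close>), so that moments of total order at most one in \<open>v\<close> are finite.

  All this rests on the estimate \<open>\<bar>D\<^sub>p\<^sub>,\<^sub>n(\<phi>)\<bar> \<le> A \<rho>\<^sup>n\<^sup>-\<^sup>p \<parallel>\<phi>\<parallel> v\<^sup>\<xi>\<close> with constants independent of the model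
  (\<open>D_bound\<close>), proved in four steps.

  The moments \<open>\<eta>\<^sub>p(v)\<close> are bounded (\<open>moments\<close>): the drift holds down the ratio of the moment to the mass
  of a small set, and the lower mass condition returns mass to the small set.

  The flow forgets its starting point (\<open>forgetting\<close>). The cross difference
  \<open>Q(\<phi>)(x) Q(1)(y) - Q(\<phi>)(y) Q(1)(x)\<close> is propagated by the product of two independent copies of the kernel
  and is antisymmetric. The two-sided comparison of the kernels with one measure on a sublevel set makes the
  product kernel nearly symmetric there, so each step inside contracts it (\<open>antisymmetric_contraction\<close>),
  while excursions are suppressed by the drift at a rate that beats the decay of the denominators when the
  level is high enough (\<open>cross_bound\<close>).

  The function \<open>h\<close> is dominated by \<open>v\<^sup>\<xi>\<close> (\<open>h_bound\<close>): forgetting makes the increments of \<open>ln h\<^sub>p\<^sub>,\<^sub>n\<close> in \<open>n\<close>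
  summable, which bounds \<open>h\<close> on sublevel sets, and the drift extends the bound.

  Finally \<open>D\<^sub>p\<^sub>,\<^sub>n(\<phi>) = h\<^sub>p\<^sub>,\<^sub>n (Q\<^sub>p\<^sub>,\<^sub>n(\<phi>) / Q\<^sub>p\<^sub>,\<^sub>n(1) - \<eta>\<^sub>n(\<phi>))\<close>, and interpolation with the trivial bound on the second
  factor lowers its power of \<open>v\<close> as far as desired, at the expense of the rate.
\<close>

section \<open>Feynman--Kac flows with positive potentials\<close>

locale feynman_kac =
  fixes m :: "'a model"
  assumes valid: "valid_model m"
    and G_pos: "\<And>n x. x \<in> space (state m) \<Longrightarrow> 0 < G m n x"
begin

abbreviation X :: "'a measure" where "X \<equiv> state m"

lemma G_measurable [measurable]: "G m n \<in> borel_measurable X"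
  using valid by (auto simp: valid_model_def bounded_measurable_def)

lemma M_measurable_Suc [measurable]: "M m s (Suc n) \<in> X \<rightarrow>\<^sub>M prob_algebra X"
  using valid by (auto simp: valid_model_def)

lemma M_measurable_subprob [measurable]: "M m s (Suc n) \<in> X \<rightarrow>\<^sub>M subprob_algebra X"
  by (intro measurable_prob_algebraD) simp

lemma eta0_prob: "eta0 m s \<in> space (prob_algebra X)"
  using valid by (auto simp: valid_model_def)

lemma M_prob: "x \<in> space X \<Longrightarrow> prob_space (M m s (Suc n) x)"
  and M_sets: "x \<in> space X \<Longrightarrow> sets (M m s (Suc n) x) = sets X"
  and M_space: "x \<in> space X \<Longrightarrow> space (M m s (Suc n) x) = space X"
  using measurable_space[OF M_measurable_Suc, of x s n]
  by (auto simp: space_prob_algebra dest: sets_eq_imp_space_eq)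

lemma path_law_prob: "path_law m s n \<in> space (prob_algebra (Pi\<^sub>M {..n} (\<lambda>_. X)))"
proof (induction n)
  case 0
  have "(\<lambda>M'. distr M' (Pi\<^sub>M {..0} (\<lambda>_. X)) (\<lambda>x. \<lambda>i\<in>{..0::nat}. x))
      \<in> prob_algebra X \<rightarrow>\<^sub>M prob_algebra (Pi\<^sub>M {..0} (\<lambda>_. X))"
    by (intro measurable_distr_prob_space measurable_restrict) simp
  from measurable_space[OF this eta0_prob] show ?case by simp
next
  case (Suc n)
  have add: "(\<lambda>(\<omega>, y). fun_upd \<omega> (Suc n) y)
      \<in> Pi\<^sub>M {..n} (\<lambda>_. X) \<Otimes>\<^sub>M X \<rightarrow>\<^sub>M Pi\<^sub>M {..Suc n} (\<lambda>_. X)"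
    using measurable_add_dim[of "Suc n" "{..n}" "\<lambda>_. X"] by (simp add: atMost_Suc)
  have "(\<lambda>\<omega>. distr (M m s (Suc n) (\<omega> n)) (Pi\<^sub>M {..Suc n} (\<lambda>_. X)) (\<lambda>y. fun_upd \<omega> (Suc n) y))
      \<in> Pi\<^sub>M {..n} (\<lambda>_. X) \<rightarrow>\<^sub>M prob_algebra (Pi\<^sub>M {..Suc n} (\<lambda>_. X))"
    by (rule measurable_distr_prob_space2[OF _ add])
      (rule measurable_compose[OF measurable_component_singleton[where M = "\<lambda>_. X"] M_measurable_Suc], simp)
  from measurable_bind_prob_space[OF measurable_ident this] Suc
  show ?case by (auto dest: measurable_space simp: id_def)
qed

lemma space_nonempty: "space X \<noteq> {}"
  using eta0_prob[of Fine]
  by (auto simp: space_prob_algebra dest!: prob_space.not_empty sets_eq_imp_space_eq)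

lemma nn_integral_gamma:
  assumes [measurable]: "f \<in> borel_measurable X"
  shows "(\<integral>\<^sup>+x. f x \<partial>gamma m s n) =
    (\<integral>\<^sup>+\<omega>. ennreal (\<Prod>p<n. G m p (\<omega> p)) * f (\<omega> n) \<partial>path_law m s n)"
proof -
  have sets [measurable_cong]: "sets (path_law m s n) = sets (Pi\<^sub>M {..n} (\<lambda>_. X))"
    using path_law_prob[of s n] by (simp add: space_prob_algebra)
  have comp [measurable]: "(\<lambda>\<omega>. \<omega> p) \<in> path_law m s n \<rightarrow>\<^sub>M X" if "p \<le> n" for p
    using measurable_component_singleton[of p "{..n}" "\<lambda>_. X"] that
    by (simp cong: measurable_cong_sets add: sets)
  have [measurable]: "(\<lambda>\<omega>. \<Prod>p<n. G m p (\<omega> p)) \<in> borel_measurable (path_law m s n)"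
    by (intro borel_measurable_prod measurable_compose[OF comp G_measurable]) simp
  show ?thesis
    unfolding gamma_def by (subst nn_integral_distr; simp add: nn_integral_density)
qed

lemma sets_gamma [measurable_cong, simp]: "sets (gamma m s n) = sets X"
  by (simp add: gamma_def)

lemma space_gamma [simp]: "space (gamma m s n) = space X"
  by (rule sets_eq_imp_space_eq) simp

lemma nn_integral_gamma_0:
  assumes [measurable]: "f \<in> borel_measurable X"
  shows "(\<integral>\<^sup>+x. f x \<partial>gamma m s 0) = (\<integral>\<^sup>+x. f x \<partial>eta0 m s)"
proof -
  have [measurable_cong]: "sets (eta0 m s) = sets X"
    using eta0_prob[of s] by (simp add: space_prob_algebra)
  show ?thesis
    by (simp add: nn_integral_gamma, subst nn_integral_distr) (auto intro!: measurable_restrict)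
qed

text \<open>Integrating out the last coordinate of the path turns the path formula for \<open>\<gamma>\<^sub>n\<^sub>+\<^sub>1\<close> into the
  recursion \<open>\<gamma>\<^sub>n\<^sub>+\<^sub>1 = \<gamma>\<^sub>n Q\<^sub>n\<^sub>+\<^sub>1\<close>; no later argument refers to paths.\<close>

lemma nn_integral_gamma_Suc:
  assumes [measurable]: "f \<in> borel_measurable X"
  shows "(\<integral>\<^sup>+x. f x \<partial>gamma m s (Suc n)) =
    (\<integral>\<^sup>+x. ennreal (G m n x) * (\<integral>\<^sup>+y. f y \<partial>M m s (Suc n) x) \<partial>gamma m s n)"
proof -
  define P where "P n = Pi\<^sub>M {..n} (\<lambda>_. X)" for n :: nat
  have add: "(\<lambda>(\<omega>, y). fun_upd \<omega> (Suc n) y) \<in> P n \<Otimes>\<^sub>M X \<rightarrow>\<^sub>M P (Suc n)"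
    using measurable_add_dim[of "Suc n" "{..n}" "\<lambda>_. X"] by (simp add: atMost_Suc P_def)
  have comp [measurable]: "(\<lambda>\<omega>. \<omega> p) \<in> P l \<rightarrow>\<^sub>M X" if "p \<le> l" for p l
    using measurable_component_singleton[of p "{..l}" "\<lambda>_. X"] that by (simp add: P_def)
  have ker: "(\<lambda>\<omega>. distr (M m s (Suc n) (\<omega> n)) (P (Suc n)) (\<lambda>y. fun_upd \<omega> (Suc n) y))
      \<in> P n \<rightarrow>\<^sub>M subprob_algebra (P (Suc n))"
    by (rule measurable_prob_algebraD, rule measurable_distr_prob_space2[OF _ add])
      (rule measurable_compose[OF comp M_measurable_Suc], simp)
  have prodm [measurable]: "(\<lambda>\<omega>. \<Prod>p<l. G m p (\<omega> p)) \<in> borel_measurable (P l)" for l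
    by (intro borel_measurable_prod measurable_compose[OF comp G_measurable]) simp
  have sets [measurable_cong]: "sets (path_law m s n) = sets (P n)"
    using path_law_prob[of s n] by (simp add: space_prob_algebra P_def)
  have spc: "space (path_law m s n) = space (P n)"
    by (rule sets_eq_imp_space_eq) (rule sets)
  have [measurable]: "(\<lambda>x. \<integral>\<^sup>+y. f y \<partial>M m s (Suc n) x) \<in> borel_measurable X"
    by measurable
  have "(\<integral>\<^sup>+x. f x \<partial>gamma m s (Suc n)) =
    (\<integral>\<^sup>+\<omega>. \<integral>\<^sup>+\<omega>'. ennreal (\<Prod>p<Suc n. G m p (\<omega>' p)) * f (\<omega>' (Suc n))
       \<partial>distr (M m s (Suc n) (\<omega> n)) (P (Suc n)) (\<lambda>y. fun_upd \<omega> (Suc n) y) \<partial>path_law m s n)"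
    unfolding nn_integral_gamma[OF assms]
    by (simp only: path_law.simps P_def[symmetric], rule nn_integral_bind[where B = "P (Suc n)"])
      (use ker in \<open>simp_all cong: measurable_cong_sets add: sets\<close>)
  also have "\<dots> = (\<integral>\<^sup>+\<omega>. ennreal (\<Prod>p<n. G m p (\<omega> p)) *
      (ennreal (G m n (\<omega> n)) * (\<integral>\<^sup>+y. f y \<partial>M m s (Suc n) (\<omega> n))) \<partial>path_law m s n)"
  proof (rule nn_integral_cong)
    fix \<omega> assume "\<omega> \<in> space (path_law m s n)"
    then have \<omega>: "\<omega> \<in> space (P n)" by (simp add: spc)
    then have \<omega>X: "\<omega> p \<in> space X" if "p \<le> n" for p
      using measurable_space[OF comp[OF that]] by simp
    have [measurable_cong]: "sets (M m s (Suc n) (\<omega> n)) = sets X"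
      using M_sets \<omega>X by simp
    have [measurable]: "(\<lambda>y. fun_upd \<omega> (Suc n) y) \<in> X \<rightarrow>\<^sub>M P (Suc n)"
      using measurable_compose[OF measurable_Pair1' add, OF \<omega>] by simp
    then have upd': "(\<lambda>y. fun_upd \<omega> (Suc n) y) \<in> M m s (Suc n) (\<omega> n) \<rightarrow>\<^sub>M P (Suc n)"
      by (simp cong: measurable_cong_sets add: M_sets \<omega>X)
    have integrand: "(\<lambda>\<omega>'. ennreal (\<Prod>p<Suc n. G m p (\<omega>' p)) * f (\<omega>' (Suc n)))
        \<in> borel_measurable (P (Suc n))"
      using comp[of "Suc n" "Suc n"] prodm[of "Suc n"] by measurable
    then have integrand': "(\<lambda>\<omega>'. ennreal (\<Prod>p<Suc n. G m p (\<omega>' p)) * f (\<omega>' (Suc n)))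
        \<in> borel_measurable (distr (M m s (Suc n) (\<omega> n)) (P (Suc n)) (\<lambda>y. fun_upd \<omega> (Suc n) y))"
      by (simp only: measurable_distr_eq1)
    have "(\<integral>\<^sup>+\<omega>'. ennreal (\<Prod>p<Suc n. G m p (\<omega>' p)) * f (\<omega>' (Suc n))
       \<partial>distr (M m s (Suc n) (\<omega> n)) (P (Suc n)) (\<lambda>y. fun_upd \<omega> (Suc n) y)) =
       (\<integral>\<^sup>+y. ennreal (\<Prod>p<Suc n. G m p ((fun_upd \<omega> (Suc n) y) p)) * f y \<partial>M m s (Suc n) (\<omega> n))"
      by (rule trans[OF nn_integral_distr[OF upd' integrand']]) (simp only: fun_upd_same)
    also have "(\<lambda>y. \<Prod>p<Suc n. G m p ((fun_upd \<omega> (Suc n) y) p)) = (\<lambda>y. \<Prod>p<Suc n. G m p (\<omega> p))"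
      by (intro ext prod.cong) auto
    also have "(\<integral>\<^sup>+y. ennreal (\<Prod>p<Suc n. G m p (\<omega> p)) * f y \<partial>M m s (Suc n) (\<omega> n)) =
       ennreal (\<Prod>p<Suc n. G m p (\<omega> p)) * (\<integral>\<^sup>+y. f y \<partial>M m s (Suc n) (\<omega> n))"
      by (rule nn_integral_cmult) (simp add: assms cong: measurable_cong_sets add: M_sets \<omega>X)
    also have "ennreal (\<Prod>p<Suc n. G m p (\<omega> p)) =
        ennreal (\<Prod>p<n. G m p (\<omega> p)) * ennreal (G m n (\<omega> n))"
      using G_pos[OF \<omega>X, of n n] by (simp add: ennreal_mult'' less_imp_le)
    finally show "(\<integral>\<^sup>+\<omega>'. ennreal (\<Prod>p<Suc n. G m p (\<omega>' p)) * f (\<omega>' (Suc n))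
       \<partial>distr (M m s (Suc n) (\<omega> n)) (P (Suc n)) (\<lambda>y. fun_upd \<omega> (Suc n) y)) =
       ennreal (\<Prod>p<n. G m p (\<omega> p)) *
      (ennreal (G m n (\<omega> n)) * (\<integral>\<^sup>+y. f y \<partial>M m s (Suc n) (\<omega> n)))"
      by (simp only: mult.assoc)
  qed
  also have "\<dots> = (\<integral>\<^sup>+x. ennreal (G m n x) * (\<integral>\<^sup>+y. f y \<partial>M m s (Suc n) x) \<partial>gamma m s n)"
    by (subst nn_integral_gamma) simp_all
  finally show ?thesis .
qed

lemma G_bounded: "\<exists>c\<ge>0. \<forall>x\<in>space X. G m n x \<le> c"
proof -
  have "bounded (G m n ` space X)"
    using valid by (auto simp: valid_model_def bounded_measurable_def)
  then obtain c where "\<forall>x\<in>space X. \<bar>G m n x\<bar> \<le> c"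
    by (auto simp: bounded_iff)
  then show ?thesis
    by (intro exI[of _ "max 0 c"]) fastforce
qed

lemma gamma_mass_Suc:
  "emeasure (gamma m s (Suc n)) (space X) = (\<integral>\<^sup>+x. ennreal (G m n x) \<partial>gamma m s n)"
proof -
  have "emeasure (gamma m s (Suc n)) (space X) = (\<integral>\<^sup>+x. 1 \<partial>gamma m s (Suc n))"
    by simp
  also have "\<dots> = (\<integral>\<^sup>+x. ennreal (G m n x) * (\<integral>\<^sup>+y. 1 \<partial>M m s (Suc n) x) \<partial>gamma m s n)"
    by (rule nn_integral_gamma_Suc) simp
  also have "\<dots> = (\<integral>\<^sup>+x. ennreal (G m n x) \<partial>gamma m s n)"
    by (intro nn_integral_cong) (simp add: prob_space.emeasure_space_1 M_prob)
  finally show ?thesis .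
qed

lemma gamma_mass: "0 < emeasure (gamma m s n) (space X) \<and> emeasure (gamma m s n) (space X) < \<infinity>"
proof (induction n)
  case 0
  have "emeasure (gamma m s 0) (space X) = (\<integral>\<^sup>+x. indicator (space X) x \<partial>gamma m s 0)"
    by (subst nn_integral_indicator) auto
  also have "\<dots> = (\<integral>\<^sup>+x. indicator (space X) x \<partial>eta0 m s)"
    by (rule nn_integral_gamma_0) auto
  also have "\<dots> = 1"
    using eta0_prob[of s] by (subst nn_integral_indicator) (auto simp: space_prob_algebra in_space_prob_algebra)
  finally show ?case by simp
next
  case (Suc n)
  note eq = gamma_mass_Suc[of s n]
  obtain c where c: "\<forall>x\<in>space X. G m n x \<le> c" using G_bounded by blast
  have "(\<integral>\<^sup>+x. ennreal (G m n x) \<partial>gamma m s n) \<le> (\<integral>\<^sup>+x. ennreal c \<partial>gamma m s n)"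
    using c by (intro nn_integral_mono) (auto intro: ennreal_leI)
  also have "\<dots> < \<infinity>" using Suc by (simp add: ennreal_mult_less_top)
  finally have fin: "(\<integral>\<^sup>+x. ennreal (G m n x) \<partial>gamma m s n) < \<infinity>" .
  have "(\<integral>\<^sup>+x. ennreal (G m n x) \<partial>gamma m s n) \<noteq> 0"
  proof
    assume "(\<integral>\<^sup>+x. ennreal (G m n x) \<partial>gamma m s n) = 0"
    then have "AE x in gamma m s n. ennreal (G m n x) = 0"
      by (subst (asm) nn_integral_0_iff_AE) simp_all
    then have "AE x in gamma m s n. False"
      by (rule AE_mp) (intro AE_I2, auto simp: ennreal_eq_0_iff dest: G_pos[of _ n])
    then have "emeasure (gamma m s n) (space X) = 0"
      using AE_iff_measurable[of "space (gamma m s n)" "gamma m s n" "\<lambda>_. False"] by simp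
    then show False using Suc by simp
  qed
  then show ?case using fin eq by (simp add: zero_less_iff_neq_zero)
qed

lemma sets_eta [measurable_cong, simp]: "sets (eta m s n) = sets X"
  by (simp add: eta_def)

lemma space_eta [simp]: "space (eta m s n) = space X"
  by (rule sets_eq_imp_space_eq) simp

lemma prob_eta: "prob_space (eta m s n)"
proof
  show "emeasure (eta m s n) (space (eta m s n)) = 1"
    using gamma_mass[of s n]
    by (simp add: eta_def space_scale_measure mult.commute[of "inverse _"]
        divide_ennreal_def[symmetric] zero_less_iff_neq_zero)
qed

lemma nn_integral_eta:
  assumes [measurable]: "f \<in> borel_measurable X"
  shows "(\<integral>\<^sup>+x. f x \<partial>eta m s n) = (\<integral>\<^sup>+x. f x \<partial>gamma m s n) / emeasure (gamma m s n) (space X)"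
  by (simp add: eta_def nn_integral_scale_measure divide_ennreal_def mult.commute)

lemma eta_0: "eta m s 0 = eta0 m s"
proof (rule measure_eqI)
  show "sets (eta m s 0) = sets (eta0 m s)"
    using eta0_prob[of s] by (simp add: space_prob_algebra)
  fix A assume "A \<in> sets (eta m s 0)"
  then have A [measurable]: "A \<in> sets X" by simp
  have A': "A \<in> sets (eta0 m s)" using A eta0_prob[of s] by (simp add: space_prob_algebra)
  have "emeasure (gamma m s 0) B = emeasure (eta0 m s) B" if "B \<in> sets X" for B
    using nn_integral_gamma_0[of "indicator B" s] that eta0_prob[of s]
    by (simp add: space_prob_algebra)
  then show "emeasure (eta m s 0) A = emeasure (eta0 m s) A"
    using in_space_prob_algebra[OF eta0_prob[of s]] A by (simp add: eta_def)
qed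

lemma G_integral:
  "integrable (eta m s n) (G m n)"
  "(\<integral>\<^sup>+x. ennreal (G m n x) \<partial>eta m s n) = ennreal (\<integral>x. G m n x \<partial>eta m s n)"
  "0 < (\<integral>x. G m n x \<partial>eta m s n)"
proof -
  interpret prob_space "eta m s n" by (rule prob_eta)
  obtain c where c: "\<forall>x\<in>space X. G m n x \<le> c" using G_bounded by blast
  show int: "integrable (eta m s n) (G m n)"
    by (rule integrable_const_bound[where B = c])
      (use c G_pos in \<open>auto intro!: AE_I2 simp: abs_of_pos\<close>)
  show "(\<integral>\<^sup>+x. ennreal (G m n x) \<partial>eta m s n) = ennreal (\<integral>x. G m n x \<partial>eta m s n)"
    by (rule nn_integral_eq_integral[OF int]) (auto intro!: AE_I2 less_imp_le G_pos)
  have "(\<integral>x. G m n x \<partial>eta m s n) \<noteq> 0"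
  proof
    assume "(\<integral>x. G m n x \<partial>eta m s n) = 0"
    then have "AE x in eta m s n. G m n x = 0"
      by (subst (asm) integral_nonneg_eq_0_iff_AE[OF int]) (auto intro!: AE_I2 less_imp_le G_pos)
    then have "AE x in eta m s n. False"
      by (rule AE_mp) (intro AE_I2, auto dest: G_pos[of _ n])
    then show False by simp
  qed
  moreover have "0 \<le> (\<integral>x. G m n x \<partial>eta m s n)"
    by (intro integral_nonneg_AE AE_I2) (simp add: G_pos less_imp_le)
  ultimately show "0 < (\<integral>x. G m n x \<partial>eta m s n)" by simp
qed

lemma sets_eta_bar [measurable_cong, simp]: "sets (eta_bar m s n) = sets X"
  by (simp add: eta_bar_def)

lemma space_eta_bar [simp]: "space (eta_bar m s n) = space X"
  by (rule sets_eq_imp_space_eq) simp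

lemma nn_integral_eta_bar:
  assumes [measurable]: "f \<in> borel_measurable X"
  shows "(\<integral>\<^sup>+x. f x \<partial>eta_bar m s n) =
    (\<integral>\<^sup>+x. ennreal (G m n x) * f x \<partial>eta m s n) / ennreal (\<integral>x. G m n x \<partial>eta m s n)"
proof -
  have "(\<integral>\<^sup>+x. f x \<partial>eta_bar m s n) =
      (\<integral>\<^sup>+x. ennreal (G m n x) * f x / ennreal (\<integral>x. G m n x \<partial>eta m s n) \<partial>eta m s n)"
    unfolding eta_bar_def
    by (subst nn_integral_density)
      (auto intro!: nn_integral_cong simp: divide_ennreal[symmetric] less_imp_le G_pos G_integral(3) 
         ennreal_times_divide mult.commute)
  also have "\<dots> = (\<integral>\<^sup>+x. ennreal (G m n x) * f x \<partial>eta m s n) / ennreal (\<integral>x. G m n x \<partial>eta m s n)"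
    by (rule nn_integral_divide) measurable
  finally show ?thesis .
qed

lemma prob_eta_bar: "prob_space (eta_bar m s n)"
proof
  have "emeasure (eta_bar m s n) (space X) = (\<integral>\<^sup>+x. 1 \<partial>eta_bar m s n)"
    by simp
  also have "\<dots> = 1"
    using G_integral[of s n] by (subst nn_integral_eta_bar) (simp_all add: divide_ennreal)
  finally show "emeasure (eta_bar m s n) (space (eta_bar m s n)) = 1" by simp
qed

lemma nn_integral_eta_Suc:
  assumes [measurable]: "f \<in> borel_measurable X"
  shows "(\<integral>\<^sup>+x. f x \<partial>eta m s (Suc n)) = (\<integral>\<^sup>+x. \<integral>\<^sup>+y. f y \<partial>M m s (Suc n) x \<partial>eta_bar m s n)"
proof -
  let ?c = "emeasure (gamma m s n) (space X)"
  have c: "?c \<noteq> 0" "?c \<noteq> \<infinity>" using gamma_mass[of s n] by auto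
  have gamma: "(\<integral>\<^sup>+x. u x \<partial>gamma m s n) = (\<integral>\<^sup>+x. u x \<partial>eta m s n) * ?c"
    if "u \<in> borel_measurable X" for u
    using c by (simp add: nn_integral_eta[OF that] mult.commute[of _ ?c] ennreal_times_divide)
      (simp add: mult.commute[of ?c] mult_divide_eq_ennreal)
  have "(\<integral>\<^sup>+x. f x \<partial>eta m s (Suc n)) =
    (\<integral>\<^sup>+x. ennreal (G m n x) * (\<integral>\<^sup>+y. f y \<partial>M m s (Suc n) x) \<partial>gamma m s n)
      / (\<integral>\<^sup>+x. ennreal (G m n x) \<partial>gamma m s n)"
    by (simp add: nn_integral_eta nn_integral_gamma_Suc gamma_mass_Suc)
  also have "\<dots> = (\<integral>\<^sup>+x. ennreal (G m n x) * (\<integral>\<^sup>+y. f y \<partial>M m s (Suc n) x) \<partial>eta m s n)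
      / ennreal (\<integral>x. G m n x \<partial>eta m s n)"
    by (subst (1 2) gamma) (simp_all add: divide_mult_eq[OF c] G_integral(2))
  also have "\<dots> = (\<integral>\<^sup>+x. \<integral>\<^sup>+y. f y \<partial>M m s (Suc n) x \<partial>eta_bar m s n)"
    by (rule nn_integral_eta_bar[symmetric]) measurable
  finally show ?thesis .
qed

text \<open>Reweighting by the potential and then moving with the kernel. Stated for measures, because the
  couplings are obtained by applying a pair kernel to couplings of the reweighted laws.\<close>

lemma eta_Suc: "eta m s (Suc n) = eta_bar m s n \<bind> M m s (Suc n)"
proof (rule measure_eqI)
  have ne: "space (eta_bar m s n) \<noteq> {}" by (simp add: space_nonempty)
  have M: "M m s (Suc n) \<in> eta_bar m s n \<rightarrow>\<^sub>M subprob_algebra X" by measurable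
  show *: "sets (eta m s (Suc n)) = sets (eta_bar m s n \<bind> M m s (Suc n))"
    using M_sets by (subst sets_bind[where N = X]) (auto simp: space_nonempty)
  fix A assume "A \<in> sets (eta m s (Suc n))"
  then have A: "A \<in> sets X" by simp
  have "emeasure (eta m s (Suc n)) A = (\<integral>\<^sup>+x. indicator A x \<partial>eta m s (Suc n))"
    using A by simp
  also have "\<dots> = (\<integral>\<^sup>+x. \<integral>\<^sup>+y. indicator A y \<partial>M m s (Suc n) x \<partial>eta_bar m s n)"
    using A by (intro nn_integral_eta_Suc) simp
  also have "\<dots> = (\<integral>\<^sup>+x. emeasure (M m s (Suc n) x) A \<partial>eta_bar m s n)"
    using A by (intro nn_integral_cong) (simp add: M_sets)
  also have "\<dots> = emeasure (eta_bar m s n \<bind> M m s (Suc n)) A"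
    by (rule emeasure_bind[OF ne M A, symmetric])
  finally show "emeasure (eta m s (Suc n)) A = emeasure (eta_bar m s n \<bind> M m s (Suc n)) A" .
qed

end

section \<open>Feynman--Kac semigroups on bounded functions\<close>

lemma bounded_measurableI:
  assumes "\<phi> \<in> borel_measurable X" "\<And>x. x \<in> space X \<Longrightarrow> \<bar>\<phi> x\<bar> \<le> c"
  shows "\<phi> \<in> bounded_measurable X"
  using assms by (auto simp: bounded_measurable_def bounded_iff)

lemma bounded_measurableE:
  assumes "\<phi> \<in> bounded_measurable X"
  obtains c where "0 \<le> c" "\<And>x. x \<in> space X \<Longrightarrow> \<bar>\<phi> x\<bar> \<le> c"
proof -
  obtain c where "\<forall>x\<in>space X. \<bar>\<phi> x\<bar> \<le> c"
    using assms by (auto simp: bounded_measurable_def bounded_iff)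
  then show ?thesis
    by (intro that[of "max 0 c"]) fastforce+
qed

lemma bounded_measurable_measurable [measurable_dest]:
  "\<phi> \<in> bounded_measurable X \<Longrightarrow> \<phi> \<in> borel_measurable X"
  by (simp add: bounded_measurable_def)

lemma bounded_measurable_const: "(\<lambda>_. a) \<in> bounded_measurable X"
  by (rule bounded_measurableI[where c = "\<bar>a\<bar>"]) auto

lemma bounded_measurable_diff_const:
  assumes "\<phi> \<in> bounded_measurable X"
  shows "(\<lambda>x. \<phi> x - a) \<in> bounded_measurable X"
proof -
  obtain c where c: "\<And>x. x \<in> space X \<Longrightarrow> \<bar>\<phi> x\<bar> \<le> c" by (rule bounded_measurableE[OF assms]) blast
  show ?thesis
    by (rule bounded_measurableI[where c = "c + \<bar>a\<bar>"])
      (use assms in measurable, use c in fastforce)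
qed

lemma bounded_measurable_cmult:
  assumes "\<phi> \<in> bounded_measurable X"
  shows "(\<lambda>x. a * \<phi> x) \<in> bounded_measurable X"
proof -
  obtain c where c: "\<And>x. x \<in> space X \<Longrightarrow> \<bar>\<phi> x\<bar> \<le> c" by (rule bounded_measurableE[OF assms]) blast
  show ?thesis
    by (rule bounded_measurableI[where c = "\<bar>a\<bar> * c"])
      (use assms in measurable, use c in \<open>auto simp: abs_mult intro: mult_left_mono\<close>)
qed

lemma bounded_measurable_integrable:
  assumes "\<phi> \<in> bounded_measurable X" "finite_measure \<mu>" "sets \<mu> = sets X"
  shows "integrable \<mu> \<phi>"
proof -
  obtain c where c: "\<And>x. x \<in> space X \<Longrightarrow> \<bar>\<phi> x\<bar> \<le> c" by (rule bounded_measurableE[OF assms(1)]) blast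
  interpret finite_measure \<mu> by fact
  have [simp]: "space \<mu> = space X" by (rule sets_eq_imp_space_eq) fact
  show ?thesis
    by (rule integrable_const_bound[where B = c])
      (use assms c in \<open>auto intro!: AE_I2 dest: bounded_measurable_measurable
        cong: measurable_cong_sets\<close>)
qed

lemma abs_le_supnorm:
  assumes "\<phi> \<in> bounded_measurable X" "x \<in> space X"
  shows "\<bar>\<phi> x\<bar> \<le> supnorm X \<phi>"
proof -
  obtain c where c: "\<And>x. x \<in> space X \<Longrightarrow> \<bar>\<phi> x\<bar> \<le> c" by (rule bounded_measurableE[OF assms(1)]) blast
  then have "bdd_above ((\<lambda>x. \<bar>\<phi> x\<bar> / 1) ` space X)" by (auto intro!: bdd_aboveI2)
  from cSUP_upper[OF assms(2) this] show ?thesis by (simp add: wnorm_def)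
qed

lemma Q_semi_refl [simp]: "Q_semi m s n n \<phi> = \<phi>"
  by (simp add: Q_semi_def)

lemma Q_semi_step: "p < n \<Longrightarrow> Q_semi m s p n \<phi> = Q m s (Suc p) (Q_semi m s (Suc p) n \<phi>)"
  unfolding Q_semi_def by (subst upt_conv_Cons; simp del: upt_Suc)

lemma Q_semi_Suc: "p \<le> n \<Longrightarrow> Q_semi m s p (Suc n) \<phi> = Q_semi m s p n (Q m s (Suc n) \<phi>)"
  by (simp add: Q_semi_def upt_Suc_append)

context feynman_kac
begin

lemma M_finite: "x \<in> space X \<Longrightarrow> finite_measure (M m s (Suc n) x)"
  using M_prob by (simp add: prob_space_def)

lemma G_bounded_measurable: "G m n \<in> bounded_measurable X"
  using valid by (simp add: valid_model_def)

lemma integral_M_measurable [measurable]: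
  fixes \<phi> :: "'a \<Rightarrow> real"
  assumes [measurable]: "\<phi> \<in> borel_measurable X"
  shows "(\<lambda>x. \<integral>y. \<phi> y \<partial>M m s (Suc n) x) \<in> borel_measurable X"
  by (rule measurable_compose[OF M_measurable_subprob integral_measurable_subprob_algebra[OF assms]])

lemma Q_measurable [measurable]:
  assumes [measurable]: "\<phi> \<in> borel_measurable X"
  shows "Q m s (Suc n) \<phi> \<in> borel_measurable X"
  unfolding Q_def by measurable

lemma integrable_M:
  assumes "\<phi> \<in> bounded_measurable X" "x \<in> space X"
  shows "integrable (M m s (Suc n) x) \<phi>"
  using bounded_measurable_integrable[OF assms(1)] M_finite M_sets assms(2) by blast

lemma integrable_eta:
  assumes "\<phi> \<in> bounded_measurable X"
  shows "integrable (eta m s n) \<phi>"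
  using bounded_measurable_integrable[OF assms, of "eta m s n"] prob_eta
  by (simp add: prob_space_def)

lemma Q_bounded:
  assumes "\<phi> \<in> bounded_measurable X"
  shows "Q m s (Suc n) \<phi> \<in> bounded_measurable X"
proof -
  obtain c where c: "0 \<le> c" "\<And>x. x \<in> space X \<Longrightarrow> \<bar>\<phi> x\<bar> \<le> c" by (rule bounded_measurableE[OF assms]) blast
  obtain g where g: "\<forall>x\<in>space X. G m n x \<le> g" using G_bounded by blast
  show ?thesis
  proof (rule bounded_measurableI[where c = "g * c"])
    show "Q m s (Suc n) \<phi> \<in> borel_measurable X" using assms by measurable
    fix x assume x: "x \<in> space X"
    interpret prob_space "M m s (Suc n) x" using M_prob[OF x] .
    have "\<bar>\<integral>y. \<phi> y \<partial>M m s (Suc n) x\<bar> \<le> (\<integral>y. c \<partial>M m s (Suc n) x)"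
      by (rule integral_abs_bound[THEN order_trans], rule integral_mono)
        (use integrable_M[OF assms x] c x in \<open>auto simp: M_space\<close>)
    also have "\<dots> = c" using prob_space by simp
    finally show "\<bar>Q m s (Suc n) \<phi> x\<bar> \<le> g * c"
      using g x c(1) G_pos[OF x, of n] by (auto simp: Q_def abs_mult intro!: mult_mono)
  qed
qed

lemma Q_semi_bounded:
  assumes "\<phi> \<in> bounded_measurable X" "p \<le> n"
  shows "Q_semi m s p n \<phi> \<in> bounded_measurable X"
  using assms(2)
proof (induction rule: inc_induct)
  case base show ?case using assms(1) by simp
next
  case (step p)
  then show ?case by (simp add: Q_semi_step Q_bounded)
qed

lemma Q_cong:
  assumes "\<And>y. y \<in> space X \<Longrightarrow> \<phi> y = \<psi> y" "x \<in> space X"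
  shows "Q m s (Suc n) \<phi> x = Q m s (Suc n) \<psi> x"
  unfolding Q_def using assms by (auto intro!: Bochner_Integration.integral_cong simp: M_space)

lemma Q_mono:
  assumes "integrable (M m s (Suc n) x) \<phi>" "integrable (M m s (Suc n) x) \<psi>"
    and "\<And>y. y \<in> space X \<Longrightarrow> \<phi> y \<le> \<psi> y" "x \<in> space X"
  shows "Q m s (Suc n) \<phi> x \<le> Q m s (Suc n) \<psi> x"
  unfolding Q_def using assms G_pos[of x n]
  by (auto intro!: mult_left_mono integral_mono simp: M_space less_imp_le)

lemma Q_one: "x \<in> space X \<Longrightarrow> Q m s (Suc n) (\<lambda>_. 1) x = G m n x"
  using prob_space.prob_space[OF M_prob, of x s n] by (simp add: Q_def)

lemma Q_cmult: "Q m s (Suc n) (\<lambda>y. a * \<phi> y) x = a * Q m s (Suc n) \<phi> x"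
  by (simp add: Q_def)

lemma Q_semi_cong:
  assumes "\<And>y. y \<in> space X \<Longrightarrow> \<phi> y = \<psi> y" "p \<le> n" "x \<in> space X"
  shows "Q_semi m s p n \<phi> x = Q_semi m s p n \<psi> x"
  using assms(2,3)
proof (induction arbitrary: x rule: inc_induct)
  case base then show ?case using assms(1) by simp
next
  case (step p)
  then show ?case by (simp add: Q_semi_step) (rule Q_cong; simp)
qed

lemma Q_semi_diff_const:
  assumes \<phi>: "\<phi> \<in> bounded_measurable X" and "p \<le> n" "x \<in> space X"
  shows "Q_semi m s p n (\<lambda>y. \<phi> y - a) x = Q_semi m s p n \<phi> x - a * Q_semi m s p n (\<lambda>_. 1) x"
  using assms(2,3)
proof (induction arbitrary: x rule: inc_induct)
  case base then show ?case by simp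
next
  case (step p)
  have "Q_semi m s p n (\<lambda>y. \<phi> y - a) x = Q m s (Suc p) (Q_semi m s (Suc p) n (\<lambda>y. \<phi> y - a)) x"
    using step by (simp add: Q_semi_step)
  also have "\<dots> = Q m s (Suc p) (\<lambda>y. Q_semi m s (Suc p) n \<phi> y - a * Q_semi m s (Suc p) n (\<lambda>_. 1) y) x"
    by (rule Q_cong) (use step in auto)
  also have "\<dots> = Q m s (Suc p) (Q_semi m s (Suc p) n \<phi>) x
      - a * Q m s (Suc p) (Q_semi m s (Suc p) n (\<lambda>_. 1)) x"
    using step integrable_M[OF Q_semi_bounded[OF \<phi>], of "Suc p" n x s p]
      integrable_M[OF Q_semi_bounded[OF bounded_measurable_const[of 1]], of "Suc p" n x s p]
    by (simp add: Q_def right_diff_distrib)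
  also have "\<dots> = Q_semi m s p n \<phi> x - a * Q_semi m s p n (\<lambda>_. 1) x"
    using step by (simp add: Q_semi_step)
  finally show ?case .
qed

text \<open>One step of the flow: \<open>\<eta>\<^sub>n\<^sub>+\<^sub>1\<close> is the normalisation of \<open>\<eta>\<^sub>n Q\<^sub>n\<^sub>+\<^sub>1\<close>. Stated for
  nonnegative integrable functions, because it is also applied to the exponential moment.\<close>

lemma eta_Suc_integral:
  assumes meas [measurable]: "f \<in> borel_measurable X"
    and pos: "\<And>x. x \<in> space X \<Longrightarrow> 0 \<le> f x"
    and int: "\<And>x. x \<in> space X \<Longrightarrow> integrable (M m s (Suc n) x) f"
    and intQ: "integrable (eta m s n) (Q m s (Suc n) f)"
  shows "integrable (eta m s (Suc n)) f"
    and "(\<integral>x. f x \<partial>eta m s (Suc n)) =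
      (\<integral>x. Q m s (Suc n) f x \<partial>eta m s n) / (\<integral>x. G m n x \<partial>eta m s n)"
proof -
  have Q0: "0 \<le> Q m s (Suc n) f x" if "x \<in> space X" for x
    unfolding Q_def using that G_pos[OF that, of n] pos
    by (auto intro!: mult_nonneg_nonneg integral_nonneg_AE AE_I2 simp: M_space less_imp_le)
  have "(\<integral>\<^sup>+x. ennreal (f x) \<partial>eta m s (Suc n)) =
      (\<integral>\<^sup>+x. ennreal (G m n x) * (\<integral>\<^sup>+y. ennreal (f y) \<partial>M m s (Suc n) x) \<partial>eta m s n)
      / ennreal (\<integral>x. G m n x \<partial>eta m s n)"
    by (simp add: nn_integral_eta_Suc nn_integral_eta_bar)
  also have "(\<integral>\<^sup>+x. ennreal (G m n x) * (\<integral>\<^sup>+y. ennreal (f y) \<partial>M m s (Suc n) x) \<partial>eta m s n) =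
      (\<integral>\<^sup>+x. ennreal (Q m s (Suc n) f x) \<partial>eta m s n)"
  proof (rule nn_integral_cong)
    fix x assume "x \<in> space (eta m s n)"
    then have x: "x \<in> space X" by simp
    have "(\<integral>\<^sup>+y. ennreal (f y) \<partial>M m s (Suc n) x) = ennreal (\<integral>y. f y \<partial>M m s (Suc n) x)"
      by (rule nn_integral_eq_integral[OF int[OF x]]) (use pos x in \<open>auto intro!: AE_I2 simp: M_space\<close>)
    then show "ennreal (G m n x) * (\<integral>\<^sup>+y. ennreal (f y) \<partial>M m s (Suc n) x) = ennreal (Q m s (Suc n) f x)"
      using G_pos[OF x, of n] by (simp add: Q_def ennreal_mult')
  qed
  also have "\<dots> = ennreal (\<integral>x. Q m s (Suc n) f x \<partial>eta m s n)"
    by (rule nn_integral_eq_integral[OF intQ]) (use Q0 in \<open>auto intro!: AE_I2\<close>)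
  also have "\<dots> / ennreal (\<integral>x. G m n x \<partial>eta m s n) =
      ennreal ((\<integral>x. Q m s (Suc n) f x \<partial>eta m s n) / (\<integral>x. G m n x \<partial>eta m s n))"
    by (rule divide_ennreal) (use Q0 G_integral(3) in \<open>auto intro!: integral_nonneg_AE AE_I2\<close>)
  finally have nn: "(\<integral>\<^sup>+x. ennreal (f x) \<partial>eta m s (Suc n)) =
      ennreal ((\<integral>x. Q m s (Suc n) f x \<partial>eta m s n) / (\<integral>x. G m n x \<partial>eta m s n))" .
  have val: "0 \<le> (\<integral>x. Q m s (Suc n) f x \<partial>eta m s n) / (\<integral>x. G m n x \<partial>eta m s n)"
    by (intro divide_nonneg_pos integral_nonneg_AE AE_I2 G_integral(3)) (simp add: Q0)
  show "integrable (eta m s (Suc n)) f"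
    by (rule integrableI_nn_integral_finite[OF _ _ nn]) (use pos in auto)
  show "(\<integral>x. f x \<partial>eta m s (Suc n)) =
      (\<integral>x. Q m s (Suc n) f x \<partial>eta m s n) / (\<integral>x. G m n x \<partial>eta m s n)"
    by (rule integral_eq_nn_integral[THEN trans], simp) (use pos val nn in \<open>auto\<close>)
qed

lemma eta_Suc_bounded:
  assumes \<phi>: "\<phi> \<in> bounded_measurable X"
  shows "(\<integral>x. Q m s (Suc n) \<phi> x \<partial>eta m s n) = (\<integral>x. G m n x \<partial>eta m s n) * (\<integral>x. \<phi> x \<partial>eta m s (Suc n))"
proof -
  obtain c where c: "\<And>x. x \<in> space X \<Longrightarrow> \<bar>\<phi> x\<bar> \<le> c" by (rule bounded_measurableE[OF \<phi>]) blast
  have [measurable]: "\<phi> \<in> borel_measurable X" using \<phi> by measurable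
  let ?f = "\<lambda>x. \<phi> x - (- c)"
  have f: "?f \<in> bounded_measurable X" by (rule bounded_measurable_diff_const[OF \<phi>])
  have eq: "(\<integral>x. ?f x \<partial>eta m s (Suc n)) =
      (\<integral>x. Q m s (Suc n) ?f x \<partial>eta m s n) / (\<integral>x. G m n x \<partial>eta m s n)"
  proof (rule eta_Suc_integral)
    show "0 \<le> \<phi> x - (- c)" if "x \<in> space X" for x using c[OF that] by linarith
  qed (use integrable_M[OF f] integrable_eta[OF Q_bounded[OF f]] in simp_all)
  have "(\<integral>x. Q m s (Suc n) ?f x \<partial>eta m s n) =
      (\<integral>x. Q m s (Suc n) \<phi> x + c * G m n x \<partial>eta m s n)"
  proof (intro Bochner_Integration.integral_cong refl)
    fix x assume "x \<in> space (eta m s n)"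
    then have "x \<in> space X" by simp
    then show "Q m s (Suc n) ?f x = Q m s (Suc n) \<phi> x + c * G m n x"
      using Q_semi_diff_const[OF \<phi>, of n "Suc n" x s "-c"] Q_one[of x s n]
      by (simp add: Q_semi_Suc)
  qed
  also have "\<dots> = (\<integral>x. Q m s (Suc n) \<phi> x \<partial>eta m s n) + c * (\<integral>x. G m n x \<partial>eta m s n)"
    using integrable_eta[OF Q_bounded[OF \<phi>]] G_integral(1) by simp
  finally have "(\<integral>x. Q m s (Suc n) ?f x \<partial>eta m s n) =
      (\<integral>x. Q m s (Suc n) \<phi> x \<partial>eta m s n) + c * (\<integral>x. G m n x \<partial>eta m s n)" .
  moreover have "(\<integral>x. ?f x \<partial>eta m s (Suc n)) = (\<integral>x. \<phi> x \<partial>eta m s (Suc n)) + c"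
    using integrable_eta[OF \<phi>, of s "Suc n"] prob_space.prob_space[OF prob_eta, of s "Suc n"] prob_eta[of s "Suc n"]
    by (simp add: prob_space_def finite_measure.integrable_const)
  ultimately show ?thesis
    using eq G_integral(3)[of s n] by (auto simp: field_simps)
qed

text \<open>The factor is the product of the successive means of the potentials, which does not depend on
  the test function; dividing by it is what turns \<open>Q_semi\<close> into \<open>h\<close> and \<open>D\<close>.\<close>

lemma eta_Q_semi:
  assumes \<phi>: "\<phi> \<in> bounded_measurable X" and "p \<le> n"
  shows "(\<integral>x. Q_semi m s p n \<phi> x \<partial>eta m s p) =
    (\<integral>x. Q_semi m s p n (\<lambda>_. 1) x \<partial>eta m s p) * (\<integral>x. \<phi> x \<partial>eta m s n)"
proof -
  have *: "(\<integral>x. Q_semi m s p n \<psi> x \<partial>eta m s p) =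
      (\<Prod>j=p..<n. \<integral>x. G m j x \<partial>eta m s j) * (\<integral>x. \<psi> x \<partial>eta m s n)"
    if \<psi>: "\<psi> \<in> bounded_measurable X" for \<psi>
    using assms(2)
  proof (induction rule: inc_induct)
    case base then show ?case by simp
  next
    case (step p)
    have "(\<integral>x. Q_semi m s p n \<psi> x \<partial>eta m s p) =
        (\<integral>x. G m p x \<partial>eta m s p) * (\<integral>x. Q_semi m s (Suc p) n \<psi> x \<partial>eta m s (Suc p))"
      using step Q_semi_bounded[OF \<psi>, of "Suc p" n s] by (simp add: Q_semi_step eta_Suc_bounded)
    also have "\<dots> = (\<Prod>j=p..<n. \<integral>x. G m j x \<partial>eta m s j) * (\<integral>x. \<psi> x \<partial>eta m s n)"
      using step by (simp add: prod.atLeast_Suc_lessThan)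
    finally show ?case .
  qed
  show ?thesis
    using *[OF \<phi>] *[OF bounded_measurable_const[of 1]] prob_space.prob_space[OF prob_eta, of s n] by simp
qed

lemma eta_Q_semi_one_step:
  assumes "p < n"
  shows "(\<integral>x. Q_semi m s p n (\<lambda>_. 1) x \<partial>eta m s p) =
    (\<integral>x. G m p x \<partial>eta m s p) * (\<integral>x. Q_semi m s (Suc p) n (\<lambda>_. 1) x \<partial>eta m s (Suc p))"
  using assms Q_semi_bounded[OF bounded_measurable_const[of 1], of "Suc p" n s]
  by (simp add: Q_semi_step eta_Suc_bounded)

end

section \<open>Drift, lower bounds and moments\<close>

text \<open>A level at which the drift, the initial and the small set conditions are all available; the drift
  is assumed only strictly above \<open>d_low\<close>. Its sublevel set is called the small set below.\<close>

definition level0 :: "constants \<Rightarrow> real" where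
  "level0 k = d_low k + 1"

text \<open>The factor by which \<open>Q (exp (\<xi> V))\<close> can exceed \<open>exp (\<xi> (1 - \<delta>) V)\<close>, for all \<open>\<xi> \<in> [0, 1]\<close> at once.
  Its second summand is what fractional powers cost, since the kernels are not normalised.\<close>

definition drift_const :: "constants \<Rightarrow> real" where
  "drift_const k = exp (max 0 (b k (level0 k))) + max 0 (G_sup k)"

text \<open>A lower bound for the mass that a point of the small set returns to the small set in one step.\<close>

definition mass_const :: "constants \<Rightarrow> real" where
  "mass_const k = exp (- level0 k) / mass_sup k (level0 k)"

text \<open>The inequalities between the constants that hold as soon as some model satisfies the conditions.
  They are isolated because the rate and the constant of a bound have to be chosen from the constants
  alone; if they fail, there is no model and the bound is vacuous.\<close>

definition coherent :: "constants \<Rightarrow> bool" where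
  "coherent k \<longleftrightarrow> 0 < delta k \<and> 1 \<le> d_low k \<and> 0 < mass_sup k (level0 k) \<and>
     (\<forall>r\<ge>d_low k. 0 < eps_minus k r \<and> eps_minus k r \<le> eps_plus k r)"

lemma drift_const_ge_1: "1 \<le> drift_const k"
  using one_le_exp_iff[of "max 0 (b k (level0 k))"] by (simp add: drift_const_def add_increasing2)

lemma drift_const_pos: "0 < drift_const k"
  using drift_const_ge_1[of k] by linarith

lemma mass_const_pos: "coherent k \<Longrightarrow> 0 < mass_const k"
  by (simp add: coherent_def mass_const_def)

lemma exp_decay_le:
  fixes a B e :: real
  assumes "0 < a" "0 < e" "0 < B"
  obtains r where "l \<le> r" "B * exp (- a * r) \<le> e"
proof
  let ?r = "max l (ln (B / e) / a)"
  show "l \<le> ?r" by simp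
  have "ln (B / e) \<le> a * ?r"
    using assms(1) by (subst mult.commute) (simp add: pos_divide_le_eq[symmetric])
  then have "B / e \<le> exp (a * ?r)"
    using assms by (metis divide_pos_pos exp_le_cancel_iff exp_ln)
  then show "B * exp (- a * ?r) \<le> e"
    using assms by (simp add: exp_minus field_simps)
qed

locale stable_model =
  fixes k :: constants and m :: "'a model" and V :: "'a \<Rightarrow> real" and \<nu> :: "real \<Rightarrow> 'a measure"
  assumes valid_m: "valid_model m" and standing: "standing_conds k m V \<nu>"

lemma (in stable_model) minorization_pos:
  assumes "d_low k \<le> r" "x \<in> space (state m)"
  shows "0 < G m n x * measure (M m s (Suc n) x) (sublevel m V r)"
proof -
  have "minorization_cond k m V \<nu>" using standing by (simp add: standing_conds_def)
  then have "\<forall>s. \<forall>n\<ge>1. \<forall>x \<in> space (state m). 0 < G m (n - 1) x * measure (M m s n x) (sublevel m V r)"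
    using assms(1) unfolding minorization_cond_def by blast
  from this[rule_format, of "Suc n" x s] assms(2) show ?thesis by simp
qed

sublocale stable_model \<subseteq> feynman_kac m
proof
  show "valid_model m" by (rule valid_m)
  fix n x assume x: "x \<in> space (state m)"
  have "0 \<le> G m n x"
    using valid_m x by (simp add: valid_model_def)
  then show "0 < G m n x"
    using minorization_pos[OF order_refl x, of n] by (cases "G m n x = 0") auto
qed

context stable_model
begin

abbreviation C :: "real \<Rightarrow> 'a set" where "C r \<equiv> sublevel m V r"

lemma V_measurable [measurable]: "V \<in> borel_measurable X"
  and V_ge_1: "x \<in> space X \<Longrightarrow> 1 \<le> V x"
  and delta: "0 < delta k" "delta k < 1"
  and d_low: "1 \<le> d_low k"
  using standing by (auto simp: standing_conds_def drift_cond_def)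

lemma C_sets [measurable]: "C r \<in> sets X"
  unfolding sublevel_def by measurable

lemma level0: "d_low k \<le> level0 k" "d_low k < level0 k" "1 < level0 k"
  using d_low by (auto simp: level0_def)

lemma G_le: "x \<in> space X \<Longrightarrow> G m n x \<le> max 0 (G_sup k)"
  using standing by (auto simp: standing_conds_def potential_cond_def max.coboundedI2)

lemma drift_nn:
  assumes x: "x \<in> space X"
  shows "ennreal (G m n x) * (\<integral>\<^sup>+y. ennreal (exp (V y)) \<partial>M m s (Suc n) x)
    \<le> ennreal (exp ((1 - delta k) * V x + max 0 (b k (level0 k))))"
proof -
  have "ennreal (G m n x) * (\<integral>\<^sup>+y. ennreal (exp (V y)) \<partial>M m s (Suc n) x)
    \<le> ennreal (exp ((1 - delta k) * V x + b k (level0 k) * indicator (C (level0 k)) x))"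
  proof -
    have "\<forall>d>d_low k. \<forall>s. \<forall>n\<ge>1. \<forall>x \<in> space X.
        ennreal (G m (n - 1) x) * (\<integral>\<^sup>+y. ennreal (exp (V y)) \<partial>M m s n x)
          \<le> ennreal (exp ((1 - delta k) * V x + b k d * indicator (C d) x))"
      using standing unfolding standing_conds_def drift_cond_def by (elim conjE)
    from this[rule_format, OF level0(2), of "Suc n" x s] x show ?thesis by simp
  qed
  also have "\<dots> \<le> ennreal (exp ((1 - delta k) * V x + max 0 (b k (level0 k))))"
    by (intro ennreal_leI) (auto simp: indicator_def)
  finally show ?thesis .
qed

lemma integrable_exp_V:
  assumes x: "x \<in> space X"
  shows "integrable (M m s (Suc n) x) (\<lambda>y. exp (V y))"
    and "G m n x * (\<integral>y. exp (V y) \<partial>M m s (Suc n) x)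
      \<le> exp ((1 - delta k) * V x + max 0 (b k (level0 k)))"
proof -
  note [measurable_cong] = M_sets[OF x]
  have "ennreal (G m n x) * (\<integral>\<^sup>+y. ennreal (exp (V y)) \<partial>M m s (Suc n) x) < \<infinity>"
    using drift_nn[OF x, of n s] by (rule order_le_less_trans) simp
  then have "(\<integral>\<^sup>+y. ennreal (exp (V y)) \<partial>M m s (Suc n) x) < \<infinity>"
    using G_pos[OF x, of n] by (auto simp: ennreal_mult_less_top ennreal_eq_0_iff)
  then show int: "integrable (M m s (Suc n) x) (\<lambda>y. exp (V y))"
    by (intro integrableI_nonneg) auto
  have "(\<integral>\<^sup>+y. ennreal (exp (V y)) \<partial>M m s (Suc n) x) = ennreal (\<integral>y. exp (V y) \<partial>M m s (Suc n) x)"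
    by (rule nn_integral_eq_integral[OF int]) simp
  then show "G m n x * (\<integral>y. exp (V y) \<partial>M m s (Suc n) x)
      \<le> exp ((1 - delta k) * V x + max 0 (b k (level0 k)))"
    using drift_nn[OF x, of n s] G_pos[OF x, of n]
    by (simp add: ennreal_mult'[symmetric] less_imp_le)
qed

text \<open>Fractional powers of \<open>v\<close> inherit the drift: with \<open>L = exp ((1 - \<delta>) V x)\<close>, the elementary
  inequality \<open>u\<^sup>\<xi> \<le> L\<^sup>\<xi> (u / L + 1)\<close> replaces Jensen's inequality and handles the unnormalised
  kernels directly.\<close>

lemma integrable_exp_V_power:
  assumes x: "x \<in> space X" and \<xi>: "0 \<le> \<xi>" "\<xi> \<le> 1"
  shows "integrable (M m s (Suc n) x) (\<lambda>y. exp (\<xi> * V y))"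
proof (rule Bochner_Integration.integrable_bound[OF integrable_exp_V(1)[OF x]])
  note [measurable_cong] = M_sets[OF x]
  show "(\<lambda>y. exp (\<xi> * V y)) \<in> borel_measurable (M m s (Suc n) x)" by measurable
  show "AE y in M m s (Suc n) x. norm (exp (\<xi> * V y)) \<le> norm (exp (V y))"
    using \<xi> V_ge_1 x by (intro AE_I2) (fastforce simp: M_space intro: mult_left_le_one_le)
qed

lemma drift:
  assumes x: "x \<in> space X" and \<xi>: "0 \<le> \<xi>" "\<xi> \<le> 1"
  shows "Q m s (Suc n) (\<lambda>y. exp (\<xi> * V y)) x
    \<le> drift_const k * exp (- \<xi> * delta k * V x) * exp (\<xi> * V x)"
proof -
  define L where "L = (1 - delta k) * V x"
  have ineq: "exp (\<xi> * t) \<le> exp (\<xi> * L) * (exp (- L) * exp t + 1)" for t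
  proof (cases "L \<le> t")
    case True
    then have "\<xi> * (t - L) \<le> 1 * (t - L)" using \<xi> by (intro mult_right_mono) auto
    then have "exp (\<xi> * t) \<le> exp (\<xi> * L) * (exp (- L) * exp t)"
      by (simp add: exp_add[symmetric] algebra_simps)
    also have "\<dots> \<le> exp (\<xi> * L) * (exp (- L) * exp t + 1)" by simp
    finally show ?thesis .
  next
    case False
    then have "exp (\<xi> * t) \<le> exp (\<xi> * L) * 1" using \<xi> by (simp add: mult_left_mono)
    also have "\<dots> \<le> exp (\<xi> * L) * (exp (- L) * exp t + 1)" by simp
    finally show ?thesis .
  qed
  interpret prob_space "M m s (Suc n) x" using M_prob[OF x] .
  have "(\<integral>y. exp (\<xi> * V y) \<partial>M m s (Suc n) x)
      \<le> (\<integral>y. exp (\<xi> * L) * (exp (- L) * exp (V y) + 1) \<partial>M m s (Suc n) x)"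
    using integrable_exp_V(1)[OF x, of s n] integrable_exp_V_power[OF x \<xi>]
    by (intro integral_mono ineq) auto
  also have "\<dots> = exp (\<xi> * L) * (exp (- L) * (\<integral>y. exp (V y) \<partial>M m s (Suc n) x) + 1)"
    using integrable_exp_V(1)[OF x, of s n] prob_space by simp
  finally have "Q m s (Suc n) (\<lambda>y. exp (\<xi> * V y)) x
      \<le> G m n x * (exp (\<xi> * L) * (exp (- L) * (\<integral>y. exp (V y) \<partial>M m s (Suc n) x) + 1))"
    using G_pos[OF x, of n] by (simp add: Q_def)
  also have "\<dots> = exp (\<xi> * L) * (exp (- L) * (G m n x * (\<integral>y. exp (V y) \<partial>M m s (Suc n) x)) + G m n x)"
    by (simp add: algebra_simps)
  also have "\<dots> \<le> exp (\<xi> * L) * (exp (- L) * exp (L + max 0 (b k (level0 k))) + max 0 (G_sup k))"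
    using integrable_exp_V(2)[OF x, of n s] G_le[OF x, of n]
    by (intro mult_left_mono add_mono) (simp_all add: L_def)
  also have "\<dots> = drift_const k * exp (- \<xi> * delta k * V x) * exp (\<xi> * V x)"
    by (simp add: drift_const_def L_def exp_add[symmetric] algebra_simps)
  finally show ?thesis .
qed

text \<open>Outside a high sublevel set the drift is a contraction by any prescribed factor.\<close>

lemma drift_bound:
  assumes "x \<in> space X" "0 \<le> \<xi>" "\<xi> \<le> 1"
  shows "Q m s (Suc n) (\<lambda>y. exp (\<xi> * V y)) x \<le> drift_const k * exp (\<xi> * V x)"
    and "r \<le> V x \<Longrightarrow> Q m s (Suc n) (\<lambda>y. exp (\<xi> * V y)) x
      \<le> drift_const k * exp (- \<xi> * delta k * r) * exp (\<xi> * V x)"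
proof -
  have 1: "drift_const k * exp (- \<xi> * delta k * V x) * exp (\<xi> * V x)
      \<le> drift_const k * exp (- \<xi> * delta k * r) * exp (\<xi> * V x)" if "r \<le> V x" for r
    using that assms delta drift_const_pos[of k]
    by (intro mult_right_mono mult_left_mono) (auto intro!: mult_left_mono)
  show "Q m s (Suc n) (\<lambda>y. exp (\<xi> * V y)) x \<le> drift_const k * exp (\<xi> * V x)"
    using order_trans[OF drift[OF assms] 1[of 0]] V_ge_1[OF assms(1)] by simp
  show "r \<le> V x \<Longrightarrow> Q m s (Suc n) (\<lambda>y. exp (\<xi> * V y)) x
      \<le> drift_const k * exp (- \<xi> * delta k * r) * exp (\<xi> * V x)"
    using order_trans[OF drift[OF assms] 1[of r]] by simp
qed

text \<open>The norm bound on the reciprocal, read as a lower bound on the mass sent to the small set.\<close>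

lemma lower_mass:
  assumes x: "x \<in> space X"
  shows "0 < mass_sup k (level0 k)"
    and "1 / (mass_sup k (level0 k) * exp (V x)) \<le> G m n x * measure (M m s (Suc n) x) (C (level0 k))"
proof -
  define g where "g x = 1 / (G m n x * measure (M m s (Suc n) x) (C (level0 k)))" for x
  have pos: "0 < G m n x * measure (M m s (Suc n) x) (C (level0 k))"
    by (rule minorization_pos[OF level0(1) x])
  have "lower_mass_cond k m V" using standing by (simp add: standing_conds_def)
  from this[unfolded lower_mass_cond_def Let_def, rule_format, OF level0(1), of n s]
  have *: "g \<in> weighted_L X (\<lambda>x. exp (V x))" "wnorm X (\<lambda>x. exp (V x)) g \<le> mass_sup k (level0 k)"
    by (auto simp: g_def[abs_def])
  then have "\<bar>g x\<bar> / exp (V x) \<le> wnorm X (\<lambda>x. exp (V x)) g"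
    unfolding wnorm_def weighted_L_def using x by (intro cSUP_upper) auto
  with * have le: "\<bar>g x\<bar> / exp (V x) \<le> mass_sup k (level0 k)" by linarith
  have "0 < \<bar>g x\<bar> / exp (V x)" using pos by (simp add: g_def)
  with le show mass: "0 < mass_sup k (level0 k)" by linarith
  have "1 \<le> mass_sup k (level0 k) * exp (V x) * (G m n x * measure (M m s (Suc n) x) (C (level0 k)))"
    using le pos by (simp add: g_def field_simps)
  then show "1 / (mass_sup k (level0 k) * exp (V x)) \<le> G m n x * measure (M m s (Suc n) x) (C (level0 k))"
    using mass by (simp add: field_simps)
qed

lemma eps: "d_low k \<le> r \<Longrightarrow> 0 < eps_minus k r \<and> eps_minus k r \<le> eps_plus k r"
  using standing unfolding standing_conds_def minorization_cond_def majorization_cond_def by blast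

lemma coherent: "coherent k"
  unfolding coherent_def using delta d_low eps lower_mass(1) space_nonempty by blast

lemma lower_mass_level:
  assumes "x \<in> space X" "V x \<le> r"
  shows "exp (- r) / mass_sup k (level0 k) \<le> G m n x * measure (M m s (Suc n) x) (C (level0 k))"
proof -
  have "exp (- r) / mass_sup k (level0 k) \<le> exp (- V x) / mass_sup k (level0 k)"
    using assms lower_mass(1)[OF assms(1)] by (intro divide_right_mono) auto
  also have "\<dots> = 1 / (mass_sup k (level0 k) * exp (V x))" by (simp add: exp_minus field_simps)
  also note lower_mass(2)[OF assms(1)]
  finally show ?thesis .
qed

lemma mass_const_le:
  assumes "x \<in> C (level0 k)"
  shows "mass_const k \<le> G m n x * measure (M m s (Suc n) x) (C (level0 k))"
    and "mass_const k \<le> G m n x"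
proof -
  have x: "x \<in> space X" "V x \<le> level0 k" using assms by (auto simp: sublevel_def)
  show 1: "mass_const k \<le> G m n x * measure (M m s (Suc n) x) (C (level0 k))" for s
    unfolding mass_const_def by (rule lower_mass_level[OF x])
  interpret prob_space "M m Fine (Suc n) x" using M_prob[OF x(1)] .
  show "mass_const k \<le> G m n x"
    using order_trans[OF 1[of Fine] mult_left_mono[OF prob_le_1[of "C (level0 k)"]]] G_pos[OF x(1), of n] by simp
qed

lemma Q_indicator:
  "x \<in> space X \<Longrightarrow> Q m s (Suc n) (indicator (C r)) x = G m n x * measure (M m s (Suc n) x) (C r)"
  using M_space[of x s n] sets.sets_into_space[OF C_sets, of r]
  by (simp add: Q_def Int_absorb2)

text \<open>The mass that stays in the small set at every step already gives the geometric lower bound. From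
  outside, the first step reaches the small set with mass at least of order \<open>1 / v\<close>.\<close>

lemma Q_semi_one_lower:
  assumes "p \<le> n"
  shows "x \<in> C (level0 k) \<Longrightarrow> mass_const k ^ (n - p) \<le> Q_semi m s p n (\<lambda>_. 1) x"
    and "x \<in> space X \<Longrightarrow> mass_const k ^ (n - p) * exp (- V x) \<le> Q_semi m s p n (\<lambda>_. 1) x"
proof -
  note bm1 = bounded_measurable_const[of "1::real" X]
  have c: "0 < mass_const k" by (rule mass_const_pos[OF coherent])
  have one_step: "G m p x * measure (M m s (Suc p) x) (C (level0 k)) * a \<le> Q_semi m s p n (\<lambda>_. 1) x"
    if p: "p < n" and x: "x \<in> space X"
      and a: "\<And>y. y \<in> C (level0 k) \<Longrightarrow> a \<le> Q_semi m s (Suc p) n (\<lambda>_. 1) y"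
      and nonneg: "\<And>y. y \<in> space X \<Longrightarrow> 0 \<le> Q_semi m s (Suc p) n (\<lambda>_. 1) y" for p x a
  proof -
    interpret prob_space "M m s (Suc p) x" using M_prob[OF x] .
    have "a * Q m s (Suc p) (indicator (C (level0 k))) x \<le> Q m s (Suc p) (Q_semi m s (Suc p) n (\<lambda>_. 1)) x"
    proof (subst Q_cmult[symmetric], rule Q_mono)
      show "integrable (M m s (Suc p) x) (\<lambda>y. a * indicator (C (level0 k)) y)"
        by (intro integrable_mult_right integrable_real_indicator)
           (auto simp: M_sets[OF x] less_top[symmetric])
      show "integrable (M m s (Suc p) x) (Q_semi m s (Suc p) n (\<lambda>_. 1))"
        using p by (intro integrable_M[OF Q_semi_bounded[OF bm1] x]) simp
    qed (use a nonneg x in \<open>auto simp: indicator_def\<close>)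
    then show ?thesis using p x by (simp add: Q_semi_step Q_indicator mult.commute)
  qed
  have nonneg: "0 \<le> Q_semi m s p n (\<lambda>_. 1) x" if "p \<le> n" "x \<in> space X" for p x
    using that
  proof (induction arbitrary: x rule: inc_induct)
    case base then show ?case by simp
  next
    case (step p)
    then have "0 \<le> (\<integral>y. Q_semi m s (Suc p) n (\<lambda>_. 1) y \<partial>M m s (Suc p) x)"
      by (intro integral_nonneg_AE AE_I2) (auto simp: M_space)
    with step G_pos[of x p] show ?case by (simp add: Q_semi_step Q_def)
  qed
  have A: "mass_const k ^ (n - p) \<le> Q_semi m s p n (\<lambda>_. 1) x" if "p \<le> n" "x \<in> C (level0 k)" for p x
    using that
  proof (induction arbitrary: x rule: inc_induct)
    case base then show ?case by simp
  next
    case (step p)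
    have x: "x \<in> space X" using step by (simp add: sublevel_def)
    have "mass_const k ^ (n - p) = mass_const k * mass_const k ^ (n - Suc p)"
      using step by (simp add: Suc_diff_Suc[symmetric])
    also have "\<dots> \<le> G m p x * measure (M m s (Suc p) x) (C (level0 k)) * mass_const k ^ (n - Suc p)"
      using mass_const_le(1) step c by (intro mult_right_mono) auto
    also have "\<dots> \<le> Q_semi m s p n (\<lambda>_. 1) x"
      using step.hyps step.IH nonneg x by (intro one_step) auto
    finally show ?case .
  qed
  then show "x \<in> C (level0 k) \<Longrightarrow> mass_const k ^ (n - p) \<le> Q_semi m s p n (\<lambda>_. 1) x"
    using assms by simp
  show "mass_const k ^ (n - p) * exp (- V x) \<le> Q_semi m s p n (\<lambda>_. 1) x" if x: "x \<in> space X"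
  proof (cases "p = n")
    case True then show ?thesis using V_ge_1[OF x] by simp
  next
    case False
    then have p: "p < n" using assms by simp
    have "mass_const k ^ (n - p) * exp (- V x)
        = exp (- level0 k) * (1 / (mass_sup k (level0 k) * exp (V x)) * mass_const k ^ (n - Suc p))"
      unfolding Suc_diff_Suc[OF p, symmetric] power_Suc
      by (simp add: mass_const_def exp_minus divide_inverse mult_ac)
    also have "\<dots> \<le> 1 * (1 / (mass_sup k (level0 k) * exp (V x)) * mass_const k ^ (n - Suc p))"
      using level0 lower_mass(1)[OF x] c by (intro mult_right_mono) auto
    also have "\<dots> \<le> G m p x * measure (M m s (Suc p) x) (C (level0 k)) * mass_const k ^ (n - Suc p)"
      unfolding mult_1_left using c by (intro mult_right_mono lower_mass(2)[OF x]) simp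
    also have "\<dots> \<le> Q_semi m s p n (\<lambda>_. 1) x"
      using p A nonneg x by (intro one_step) auto
    finally show ?thesis .
  qed
qed

lemma Q_semi_one_pos: "p \<le> n \<Longrightarrow> x \<in> space X \<Longrightarrow> 0 < Q_semi m s p n (\<lambda>_. 1) x"
  using Q_semi_one_lower(2)[of p n x s] mass_const_pos[OF coherent]
  by (smt (verit, best) exp_gt_zero mult_pos_pos zero_less_power)

text \<open>The moment and the mass of the small set are controlled together, through their ratio. The
  drift removes moment at a rate that can be made smaller than \<open>mass_const k\<close>, the rate at which
  mass can leave the small set; what the drift adds is carried by a sublevel set, from which mass flows
  back to the small set in one step.\<close>

lemma moment_ratio:
  assumes r: "drift_const k * exp (- delta k * r) \<le> mass_const k / 2"
    and R: "2 * (drift_const k * exp r * (exp r * mass_sup k (level0 k))) \<le> R"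
      "init_v k * init_C k (level0 k) \<le> R"
  shows "integrable (eta m s p) (\<lambda>x. exp (V x)) \<and>
    (\<integral>x. exp (V x) \<partial>eta m s p) \<le> R * measure (eta m s p) (C (level0 k))"
proof (induction p)
  case 0
  interpret prob_space "eta m s 0" by (rule prob_eta)
  have init: "(\<integral>\<^sup>+x. ennreal (exp (V x)) \<partial>eta m s 0) \<le> ennreal (init_v k)"
    "inverse (emeasure (eta m s 0) (C (level0 k))) \<le> ennreal (init_C k (level0 k))"
    using standing level0(3) by (auto simp: standing_conds_def init_cond_def eta_0)
  have int: "integrable (eta m s 0) (\<lambda>x. exp (V x))"
    using init(1) by (intro integrableI_nonneg) (auto simp: top_unique intro: le_less_trans)
  have eq: "(\<integral>\<^sup>+x. ennreal (exp (V x)) \<partial>eta m s 0) = ennreal (\<integral>x. exp (V x) \<partial>eta m s 0)"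
    by (rule nn_integral_eq_integral[OF int]) simp
  have pos: "0 < (\<integral>x. exp (V x) \<partial>eta m s 0)"
  proof -
    have "(\<integral>x. 1 \<partial>eta m s 0) \<le> (\<integral>x. exp (V x) \<partial>eta m s 0)"
      using int V_ge_1 by (intro integral_mono) (auto intro: order_trans[OF zero_le_one])
    then show ?thesis using prob_space by simp
  qed
  have iv: "(\<integral>x. exp (V x) \<partial>eta m s 0) \<le> init_v k"
    using init(1) pos unfolding eq by (simp add: ennreal_le_iff2)
  have mpos: "0 < measure (eta m s 0) (C (level0 k))"
    using init(2) by (auto simp: emeasure_eq_measure measure_nonneg less_le top_unique)
  have "1 / measure (eta m s 0) (C (level0 k)) \<le> init_C k (level0 k)"
    using init(2) mpos by (simp add: emeasure_eq_measure inverse_ennreal ennreal_le_iff2 inverse_eq_divide)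
  then have "1 \<le> init_C k (level0 k) * measure (eta m s 0) (C (level0 k))"
    using mpos by (simp add: field_simps)
  then have "(\<integral>x. exp (V x) \<partial>eta m s 0) * 1
      \<le> init_v k * (init_C k (level0 k) * measure (eta m s 0) (C (level0 k)))"
    using iv pos by (intro mult_mono) auto
  also have "\<dots> \<le> R * measure (eta m s 0) (C (level0 k))"
    using R(2) mpos by (simp add: mult.assoc[symmetric])
  finally show ?case using int by simp
next
  case (Suc p)
  interpret prob_space "eta m s p" by (rule prob_eta)
  let ?v = "\<lambda>x. exp (V x)"
  let ?q = "Q m s (Suc p) (indicator (C (level0 k)))"
  define B where "B = drift_const k * exp r * (exp r * mass_sup k (level0 k))"
  have mass: "0 < mass_sup k (level0 k)" using coherent by (simp add: coherent_def)
  have c: "0 < mass_const k" by (rule mass_const_pos[OF coherent])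
  have "0 \<le> B" unfolding B_def using drift_const_pos[of k] mass by simp
  then have "0 \<le> R" using R(1) by (simp add: B_def[symmetric])
  have ind: "indicator (C (level0 k)) \<in> bounded_measurable X"
    by (rule bounded_measurableI[where c = 1]) (auto simp: indicator_def)
  have q: "?q \<in> bounded_measurable X" by (rule Q_bounded[OF ind])
  have q0: "0 \<le> ?q x" if "x \<in> space X" for x
    using that G_pos[OF that, of p] by (simp add: Q_indicator)
  have Qv: "Q m s (Suc p) ?v x \<le> mass_const k / 2 * ?v x + B * ?q x" if x: "x \<in> space X" for x
  proof (cases "r \<le> V x")
    case True
    have "Q m s (Suc p) ?v x \<le> drift_const k * exp (- delta k * r) * ?v x"
      using drift_bound(2)[OF x, of 1 r s p] True by simp
    also have "\<dots> \<le> mass_const k / 2 * ?v x" using r by (intro mult_right_mono) auto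
    finally show ?thesis using q0[OF x] \<open>0 \<le> B\<close> by (simp add: add_increasing2)
  next
    case False
    have "exp (- r) / mass_sup k (level0 k) \<le> ?q x"
      using lower_mass_level[OF x, of r p s] False x by (simp add: Q_indicator)
    then have 1: "1 \<le> exp r * mass_sup k (level0 k) * ?q x"
      using mass by (simp add: exp_minus field_simps)
    have "Q m s (Suc p) ?v x \<le> drift_const k * ?v x"
      using drift_bound(1)[OF x, of 1 s p] by simp
    also have "\<dots> \<le> drift_const k * exp r * (exp r * mass_sup k (level0 k) * ?q x)"
      using False drift_const_pos[of k] mult_left_mono[OF 1, of "drift_const k * exp r"]
      by (smt (verit) exp_le_cancel_iff mult_left_mono mult.right_neutral mult_pos_pos exp_gt_zero)
    also have "\<dots> = B * ?q x" by (simp add: B_def)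
    finally show ?thesis using c by (simp add: add_increasing)
  qed
  have Qv0: "0 \<le> Q m s (Suc p) ?v x" if "x \<in> space X" for x
    unfolding Q_def using G_pos[OF that, of p] by (auto intro!: mult_nonneg_nonneg integral_nonneg_AE)
  have intq: "integrable (eta m s p) ?q" by (rule integrable_eta[OF q])
  have intB: "integrable (eta m s p) (\<lambda>x. mass_const k / 2 * ?v x + B * ?q x)"
    using Suc intq by auto
  have intQ: "integrable (eta m s p) (Q m s (Suc p) ?v)"
    by (rule Bochner_Integration.integrable_bound[OF intB])
      (use Qv Qv0 in \<open>auto intro!: AE_I2 Q_measurable order_trans[OF _ abs_ge_self]\<close>)
  have inti: "integrable (M m s (Suc p) x) ?v" if "x \<in> space X" for x
    by (rule integrable_exp_V[OF that])
  note new = eta_Suc_integral[OF _ _ inti intQ]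
  have "mass_const k * measure (eta m s p) (C (level0 k)) = (\<integral>x. mass_const k * indicator (C (level0 k)) x \<partial>eta m s p)"
    using sets.sets_into_space[OF C_sets, of "level0 k"] by (simp add: Int_absorb2)
  also have "\<dots> \<le> (\<integral>x. ?q x \<partial>eta m s p)"
  proof (rule integral_mono)
    show "integrable (eta m s p) (\<lambda>x. mass_const k * indicator (C (level0 k)) x)"
      by (intro integrable_mult_right integrable_eta[OF ind])
    show "mass_const k * indicator (C (level0 k)) x \<le> ?q x" if "x \<in> space (eta m s p)" for x
      using that q0[of x] mass_const_le(1)[of x p s] Q_indicator[of x s p "level0 k"]
      by (auto simp: indicator_def)
  qed (rule intq)
  finally have mq: "mass_const k * measure (eta m s p) (C (level0 k)) \<le> (\<integral>x. ?q x \<partial>eta m s p)" .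
  have "(\<integral>x. Q m s (Suc p) ?v x \<partial>eta m s p) \<le> (\<integral>x. mass_const k / 2 * ?v x + B * ?q x \<partial>eta m s p)"
    by (rule integral_mono[OF intQ intB]) (use Qv in auto)
  also have "\<dots> = mass_const k / 2 * (\<integral>x. ?v x \<partial>eta m s p) + B * (\<integral>x. ?q x \<partial>eta m s p)"
    using Suc intq by simp
  also have "\<dots> \<le> mass_const k / 2 * (R * measure (eta m s p) (C (level0 k))) + R / 2 * (\<integral>x. ?q x \<partial>eta m s p)"
    using Suc c R(1) q0
    by (intro add_mono mult_left_mono mult_right_mono) (auto simp: B_def intro!: integral_nonneg_AE AE_I2)
  also have "\<dots> \<le> R / 2 * (\<integral>x. ?q x \<partial>eta m s p) + R / 2 * (\<integral>x. ?q x \<partial>eta m s p)"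
    using mult_left_mono[OF mq, of "R / 2"] \<open>0 \<le> R\<close> by (simp add: algebra_simps)
  also have "\<dots> = R * ((\<integral>x. G m p x \<partial>eta m s p) * measure (eta m s (Suc p)) (C (level0 k)))"
    using eta_Suc_bounded[OF ind, of s p] sets.sets_into_space[OF C_sets, of "level0 k"]
    by (simp add: Int_absorb2)
  finally have "(\<integral>x. Q m s (Suc p) ?v x \<partial>eta m s p) / (\<integral>x. G m p x \<partial>eta m s p)
      \<le> R * measure (eta m s (Suc p)) (C (level0 k))"
    using G_integral(3)[of s p] by (simp add: pos_divide_le_eq mult_ac)
  then show ?case using new by simp
qed

end

definition uniform_moments :: "constants \<Rightarrow> 'a model \<Rightarrow> ('a \<Rightarrow> real) \<Rightarrow> real \<Rightarrow> bool" where
  "uniform_moments k m V R \<longleftrightarrow> (\<forall>s p.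
     integrable (eta m s p) (\<lambda>x. exp (V x)) \<and> (\<integral>x. exp (V x) \<partial>eta m s p) \<le> R \<and>
     1 / R \<le> measure (eta m s p) (sublevel m V (level0 k)) \<and>
     mass_const k / R \<le> (\<integral>x. G m p x \<partial>eta m s p))"

lemma uniform_momentsD:
  assumes "uniform_moments k m V R"
  shows "integrable (eta m s p) (\<lambda>x. exp (V x))" "(\<integral>x. exp (V x) \<partial>eta m s p) \<le> R"
    "1 / R \<le> measure (eta m s p) (sublevel m V (level0 k))"
    "mass_const k / R \<le> (\<integral>x. G m p x \<partial>eta m s p)"
  using assms unfolding uniform_moments_def by blast+

lemma moments:
  assumes "coherent k"
  obtains R where "1 \<le> R"
    "\<And>(m :: 'a model) V \<nu>. stable_model k m V \<nu> \<Longrightarrow> uniform_moments k m V R"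
proof -
  have c: "0 < mass_const k" by (rule mass_const_pos[OF assms])
  obtain r where r: "drift_const k * exp (- delta k * r) \<le> mass_const k / 2"
    by (rule exp_decay_le[of "delta k" "mass_const k / 2" "drift_const k"])
      (use assms c drift_const_pos[of k] in \<open>auto simp: coherent_def\<close>)
  define R where "R = Max {1, 2 * (drift_const k * exp r * (exp r * mass_sup k (level0 k))),
    init_v k * init_C k (level0 k)}"
  have R: "1 \<le> R" "2 * (drift_const k * exp r * (exp r * mass_sup k (level0 k))) \<le> R"
      "init_v k * init_C k (level0 k) \<le> R"
    unfolding R_def by (auto intro: Max_ge)
  have "uniform_moments k m V R" if "stable_model k m V \<nu>" for m :: "'a model" and V \<nu>
    unfolding uniform_moments_def
  proof (intro allI)
    fix s p
    show "integrable (eta m s p) (\<lambda>x. exp (V x)) \<and> (\<integral>x. exp (V x) \<partial>eta m s p) \<le> R \<and>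
      1 / R \<le> measure (eta m s p) (sublevel m V (level0 k)) \<and>
      mass_const k / R \<le> (\<integral>x. G m p x \<partial>eta m s p)"
    proof -
      interpret stable_model k m V \<nu> by fact
      interpret prob_space "eta m s p" by (rule prob_eta)
      have 1: "integrable (eta m s p) (\<lambda>x. exp (V x))"
        and 2: "(\<integral>x. exp (V x) \<partial>eta m s p) \<le> R * prob (C (level0 k))"
        using moment_ratio[OF r R(2,3)] by auto
      have "(\<integral>x. 1 \<partial>eta m s p) \<le> (\<integral>x. exp (V x) \<partial>eta m s p)"
        using 1 V_ge_1 by (intro integral_mono) (auto intro: order_trans[OF zero_le_one])
      then have "1 \<le> R * prob (C (level0 k))" using 2 prob_space by simp
      then have 3: "1 / R \<le> prob (C (level0 k))" using R by (simp add: field_simps)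
      have 4: "R * prob (C (level0 k)) \<le> R" using R by (simp add: mult_left_le)
      have ind: "indicator (C (level0 k)) \<in> bounded_measurable X"
        by (rule bounded_measurableI[where c = 1]) (auto simp: indicator_def)
      have "mass_const k / R \<le> mass_const k * prob (C (level0 k))"
        using mult_left_mono[OF 3, of "mass_const k"] c by simp
      also have "\<dots> = (\<integral>x. mass_const k * indicator (C (level0 k)) x \<partial>eta m s p)"
        using sets.sets_into_space[OF C_sets, of "level0 k"] by (simp add: Int_absorb2)
      also have "\<dots> \<le> (\<integral>x. G m p x \<partial>eta m s p)"
      proof (rule integral_mono)
        show "integrable (eta m s p) (\<lambda>x. mass_const k * indicator (C (level0 k)) x)"
          by (intro integrable_mult_right integrable_eta[OF ind])
        show "mass_const k * indicator (C (level0 k)) x \<le> G m p x" if "x \<in> space (eta m s p)" for x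
          using that mass_const_le(2)[of x p] G_pos[of x p] by (auto simp: indicator_def)
      qed (rule G_integral(1))
      finally show ?thesis using 1 2 3 4 by linarith
    qed
  qed
  with R(1) show ?thesis by (rule that)
qed

section \<open>Forgetting of the initial condition\<close>

lemma nn_integral_restrict_le:
  fixes a c :: ennreal
  assumes [measurable_cong]: "sets \<mu> = sets X" "sets \<nu> = sets X" and [measurable]: "A \<in> sets X"
    and le: "\<And>E. E \<in> sets X \<Longrightarrow> a * emeasure \<mu> (A \<inter> E) \<le> c * emeasure \<nu> (A \<inter> E)"
    and [measurable]: "f \<in> borel_measurable X"
  shows "a * (\<integral>\<^sup>+x. indicator A x * f x \<partial>\<mu>) \<le> c * (\<integral>\<^sup>+x. indicator A x * f x \<partial>\<nu>)"
proof -
  define S where "S a \<mu> = scale_measure a (density \<mu> (indicator A))" for a and \<mu> :: "'a measure"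
  have nn: "(\<integral>\<^sup>+x. f x \<partial>S a \<mu>) = a * (\<integral>\<^sup>+x. indicator A x * f x \<partial>\<mu>)"
    if [measurable_cong]: "sets \<mu> = sets X" for a \<mu>
    unfolding S_def by (subst nn_integral_scale_measure) (simp_all add: nn_integral_density)
  have em: "emeasure (S a \<mu>) E = a * emeasure \<mu> (A \<inter> E)"
    if [measurable_cong]: "sets \<mu> = sets X" and [measurable]: "E \<in> sets X" for a \<mu> E
  proof -
    have "emeasure (density \<mu> (indicator A)) E = (\<integral>\<^sup>+x. indicator A x * indicator E x \<partial>\<mu>)"
      by (rule emeasure_density) measurable
    also have "\<dots> = emeasure \<mu> (A \<inter> E)"
      by (simp only: indicator_inter_arith[symmetric]) (rule nn_integral_indicator, measurable)
    finally show ?thesis by (simp add: S_def)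
  qed
  have sS: "sets (S a \<mu>) = sets X" if "sets \<mu> = sets X" for a \<mu>
    using that by (simp add: S_def)
  have "S a \<mu> \<le> S c \<nu>"
    by (subst le_measure) (simp_all add: sS em le assms(1,2))
  from nn_integral_mono_measure[OF _ this, of f] show ?thesis
    using assms(1,2) by (simp add: nn sS)
qed

lemma nn_integral_pair_restrict_le:
  fixes a c a' c' :: ennreal
  assumes fin: "finite_measure \<mu>" "finite_measure \<mu>'" "finite_measure \<nu>" "finite_measure \<nu>'"
    and sets: "sets \<mu> = sets X" "sets \<mu>' = sets X" "sets \<nu> = sets X" "sets \<nu>' = sets X"
    and A: "A \<in> sets X"
    and le: "\<And>E. E \<in> sets X \<Longrightarrow> a * emeasure \<mu> (A \<inter> E) \<le> c * emeasure \<nu> (A \<inter> E)"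
    and le': "\<And>E. E \<in> sets X \<Longrightarrow> a' * emeasure \<mu>' (A \<inter> E) \<le> c' * emeasure \<nu>' (A \<inter> E)"
    and f [measurable]: "f \<in> borel_measurable (X \<Otimes>\<^sub>M X)"
  shows "a * a' * (\<integral>\<^sup>+z. indicator (A \<times> A) z * f z \<partial>(\<mu> \<Otimes>\<^sub>M \<mu>'))
    \<le> c * c' * (\<integral>\<^sup>+z. indicator (A \<times> A) z * f z \<partial>(\<nu> \<Otimes>\<^sub>M \<nu>'))"
proof -
  note [measurable] = A
  note [measurable_cong] = sets
  interpret m: finite_measure \<mu> by fact
  interpret m': finite_measure \<mu>' by fact
  interpret n: finite_measure \<nu> by fact
  interpret n': finite_measure \<nu>' by fact
  have iter: "(\<integral>\<^sup>+z. indicator (A \<times> A) z * f z \<partial>(\<alpha> \<Otimes>\<^sub>M \<beta>)) =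
      (\<integral>\<^sup>+x. indicator A x * (\<integral>\<^sup>+y. indicator A y * f (x, y) \<partial>\<beta>) \<partial>\<alpha>)"
    if "finite_measure \<beta>" and s: "sets \<alpha> = sets X" "sets \<beta> = sets X" for \<alpha> \<beta>
  proof -
    interpret b: finite_measure \<beta> by fact
    note [measurable_cong] = s
    have "(\<integral>\<^sup>+z. indicator (A \<times> A) z * f z \<partial>(\<alpha> \<Otimes>\<^sub>M \<beta>)) =
        (\<integral>\<^sup>+x. \<integral>\<^sup>+y. indicator (A \<times> A) (x, y) * f (x, y) \<partial>\<beta> \<partial>\<alpha>)"
      by (rule b.nn_integral_fst[symmetric]) measurable
    also have "\<dots> = (\<integral>\<^sup>+x. \<integral>\<^sup>+y. indicator A x * (indicator A y * f (x, y)) \<partial>\<beta> \<partial>\<alpha>)"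
      by (intro nn_integral_cong) (auto simp: indicator_def)
    also have "\<dots> = (\<integral>\<^sup>+x. indicator A x * (\<integral>\<^sup>+y. indicator A y * f (x, y) \<partial>\<beta>) \<partial>\<alpha>)"
    proof (intro nn_integral_cong nn_integral_cmult)
      fix x assume "x \<in> space \<alpha>"
      then have x: "x \<in> space X" using sets_eq_imp_space_eq[OF s(1)] by simp
      have [measurable]: "(\<lambda>y. f (x, y)) \<in> borel_measurable X"
        by (rule measurable_compose[OF measurable_Pair1'[OF x] f])
      show "(\<lambda>y. indicator A y * f (x, y)) \<in> borel_measurable \<beta>" by measurable
    qed
    finally show ?thesis .
  qed
  have meas [measurable]: "(\<lambda>x. \<integral>\<^sup>+y. indicator A y * f (x, y) \<partial>\<beta>) \<in> borel_measurable X"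
    if "finite_measure \<beta>" and s: "sets \<beta> = sets X" for \<beta>
  proof -
    interpret b: finite_measure \<beta> by fact
    note [measurable_cong] = s
    show ?thesis by measurable
  qed
  have pull: "t * (\<integral>\<^sup>+x. indicator A x * H x \<partial>\<nu>) = (\<integral>\<^sup>+x. indicator A x * (t * H x) \<partial>\<nu>)"
    if [measurable]: "H \<in> borel_measurable X" for t and H :: "'a \<Rightarrow> ennreal"
    by (subst nn_integral_cmult[symmetric]) (measurable, simp only: mult.left_commute)
  have "a * a' * (\<integral>\<^sup>+z. indicator (A \<times> A) z * f z \<partial>(\<mu> \<Otimes>\<^sub>M \<mu>')) =
      a' * (a * (\<integral>\<^sup>+x. indicator A x * (\<integral>\<^sup>+y. indicator A y * f (x, y) \<partial>\<mu>') \<partial>\<mu>))"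
    by (subst iter[OF fin(2) sets(1,2)]) (simp only: mult_ac)
  also have "\<dots> \<le> a' * (c * (\<integral>\<^sup>+x. indicator A x * (\<integral>\<^sup>+y. indicator A y * f (x, y) \<partial>\<mu>') \<partial>\<nu>))"
    by (intro mult_left_mono nn_integral_restrict_le[OF sets(1,3) A le] meas fin sets) auto
  also have "\<dots> = c * (\<integral>\<^sup>+x. indicator A x * (a' * (\<integral>\<^sup>+y. indicator A y * f (x, y) \<partial>\<mu>')) \<partial>\<nu>)"
    unfolding pull[OF meas[OF fin(2) sets(2)], symmetric] by (simp only: mult_ac)
  also have "\<dots> \<le> c * (\<integral>\<^sup>+x. indicator A x * (c' * (\<integral>\<^sup>+y. indicator A y * f (x, y) \<partial>\<nu>')) \<partial>\<nu>)"
  proof (intro mult_left_mono nn_integral_mono nn_integral_restrict_le[OF sets(2,4) A le'])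
    fix x assume "x \<in> space \<nu>"
    then have x: "x \<in> space X" using sets_eq_imp_space_eq[OF sets(3)] by simp
    show "(\<lambda>y. f (x, y)) \<in> borel_measurable X"
      by (rule measurable_compose[OF measurable_Pair1'[OF x] f])
  qed auto
  also have "\<dots> = c * c' * (\<integral>\<^sup>+z. indicator (A \<times> A) z * f z \<partial>(\<nu> \<Otimes>\<^sub>M \<nu>'))"
    unfolding pull[OF meas[OF fin(4) sets(4)], symmetric]
    by (subst iter[OF fin(4) sets(3,4)]) (simp only: mult_ac)
  finally show ?thesis .
qed

lemma nn_integral_pair_swap:
  assumes "finite_measure \<nu>" and [measurable]: "f \<in> borel_measurable (\<nu> \<Otimes>\<^sub>M \<nu>)"
  shows "(\<integral>\<^sup>+z. f (snd z, fst z) \<partial>(\<nu> \<Otimes>\<^sub>M \<nu>)) = (\<integral>\<^sup>+z. f z \<partial>(\<nu> \<Otimes>\<^sub>M \<nu>))"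
proof -
  interpret n: finite_measure \<nu> by fact
  interpret P: pair_sigma_finite \<nu> \<nu> ..
  have "(\<integral>\<^sup>+z. f (snd z, fst z) \<partial>(\<nu> \<Otimes>\<^sub>M \<nu>)) = (\<integral>\<^sup>+x. \<integral>\<^sup>+y. f (y, x) \<partial>\<nu> \<partial>\<nu>)"
    using n.nn_integral_fst[of "\<lambda>z. f (snd z, fst z)" \<nu>] by simp
  also have "\<dots> = (\<integral>\<^sup>+z. f z \<partial>(\<nu> \<Otimes>\<^sub>M \<nu>))"
    by (rule P.nn_integral_snd) simp
  finally show ?thesis .
qed

text \<open>Two measures that are comparable on \<open>A\<close> to a common measure have products that are comparable
  on \<open>A \<times> A\<close> to a symmetric one. An antisymmetric function has equal positive and negative parts
  under the symmetric measure, so its integral shows a cancellation by a fixed proportion.\<close>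

lemma antisymmetric_contraction:
  fixes F :: "'a \<times> 'a \<Rightarrow> real"
  assumes fin: "finite_measure \<mu>" "finite_measure \<mu>'" "finite_measure \<nu>"
    and sets: "sets \<mu> = sets X" "sets \<mu>' = sets X" "sets \<nu> = sets X"
    and A [measurable]: "A \<in> sets X"
    and pos: "0 < e" "e \<le> E" "0 < g" "0 < g'"
    and lower: "\<And>B. B \<in> sets X \<Longrightarrow> e * measure \<nu> (A \<inter> B) \<le> g * measure \<mu> (A \<inter> B)"
    and upper: "\<And>B. B \<in> sets X \<Longrightarrow> g * measure \<mu> (A \<inter> B) \<le> E * measure \<nu> (A \<inter> B)"
    and lower': "\<And>B. B \<in> sets X \<Longrightarrow> e * measure \<nu> (A \<inter> B) \<le> g' * measure \<mu>' (A \<inter> B)"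
    and upper': "\<And>B. B \<in> sets X \<Longrightarrow> g' * measure \<mu>' (A \<inter> B) \<le> E * measure \<nu> (A \<inter> B)"
    and F [measurable]: "F \<in> borel_measurable (X \<Otimes>\<^sub>M X)"
    and anti: "\<And>x y. F (y, x) = - F (x, y)"
    and int: "integrable (\<mu> \<Otimes>\<^sub>M \<mu>') F"
  shows "\<bar>\<integral>z. indicator (A \<times> A) z * F z \<partial>(\<mu> \<Otimes>\<^sub>M \<mu>')\<bar>
    \<le> (1 - (e / E)\<^sup>2) * (\<integral>z. indicator (A \<times> A) z * \<bar>F z\<bar> \<partial>(\<mu> \<Otimes>\<^sub>M \<mu>'))"
proof -
  note [measurable_cong] = sets
  interpret m: finite_measure \<mu> by fact
  interpret m': finite_measure \<mu>' by fact
  interpret n: finite_measure \<nu> by fact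
  let ?N = "\<mu> \<Otimes>\<^sub>M \<mu>'"
  define P where "P z = indicator (A \<times> A) z * max 0 (F z)" for z
  define M where "M z = indicator (A \<times> A) z * max 0 (- F z)" for z
  have [measurable]: "P \<in> borel_measurable (X \<Otimes>\<^sub>M X)" "M \<in> borel_measurable (X \<Otimes>\<^sub>M X)"
    unfolding P_def M_def by measurable
  have intP: "integrable ?N P" and intM: "integrable ?N M"
    by (rule Bochner_Integration.integrable_bound[OF int]; auto simp: P_def M_def indicator_def)+
  define a where "a = (\<integral>z. P z \<partial>?N)"
  define c where "c = (\<integral>z. M z \<partial>?N)"
  have nnP: "(\<integral>\<^sup>+z. ennreal (P z) \<partial>?N) = ennreal a" unfolding a_def
    by (rule nn_integral_eq_integral[OF intP]) (simp add: P_def)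
  have nnM: "(\<integral>\<^sup>+z. ennreal (M z) \<partial>?N) = ennreal c" unfolding c_def
    by (rule nn_integral_eq_integral[OF intM]) (simp add: M_def)
  have a0: "0 \<le> a" "0 \<le> c" unfolding a_def c_def by (auto intro!: integral_nonneg_AE simp: P_def M_def)
  define q where "q f = (\<integral>\<^sup>+z. ennreal (f z) \<partial>(\<nu> \<Otimes>\<^sub>M \<nu>))" for f :: "'a \<times> 'a \<Rightarrow> real"
  have ind: "indicator (A \<times> A) z * ennreal (f z) = ennreal (indicator (A \<times> A) z * f z)" for z and f :: "'a \<times> 'a \<Rightarrow> real"
    by (auto simp: indicator_def)
  have idem: "(\<lambda>z. indicator (A \<times> A) z * P z) = P" "(\<lambda>z. indicator (A \<times> A) z * M z) = M"
    by (auto simp: P_def M_def indicator_def)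
  have le: "ennreal e * ennreal e * q f \<le> ennreal g * ennreal g' * (\<integral>\<^sup>+z. ennreal (f z) \<partial>?N) \<and>
      ennreal g * ennreal g' * (\<integral>\<^sup>+z. ennreal (f z) \<partial>?N) \<le> ennreal E * ennreal E * q f"
    if f [measurable]: "f \<in> borel_measurable (X \<Otimes>\<^sub>M X)" and idem: "(\<lambda>z. indicator (A \<times> A) z * f z) = f"
    for f :: "'a \<times> 'a \<Rightarrow> real"
  proof -
    have em: "ennreal s * emeasure \<alpha> B \<le> ennreal t * emeasure \<beta> B"
      if "finite_measure \<alpha>" "finite_measure \<beta>" "s * measure \<alpha> B \<le> t * measure \<beta> B" "0 \<le> s" "0 \<le> t"
      for s t B and \<alpha> \<beta> :: "'a measure"
      using that by (simp add: finite_measure.emeasure_eq_measure ennreal_mult[symmetric])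
    show ?thesis
      using nn_integral_pair_restrict_le[OF fin(3,3,1,2) sets(3,3,1,2) A, of "ennreal e" "ennreal g" "ennreal e" "ennreal g'" "\<lambda>z. ennreal (f z)"]
        nn_integral_pair_restrict_le[OF fin(1,2,3,3) sets(1,2,3,3) A, of "ennreal g" "ennreal E" "ennreal g'" "ennreal E" "\<lambda>z. ennreal (f z)"]
        pos fin lower upper lower' upper'
      unfolding ind fun_cong[OF idem] q_def by (simp add: em)
  qed
  have swap: "q M = q P"
  proof -
    have "M z = P (snd z, fst z)" for z
      using anti[of "fst z" "snd z"] by (cases z) (auto simp: M_def P_def indicator_def)
    then show ?thesis
      using nn_integral_pair_swap[OF fin(3), of "\<lambda>z. ennreal (P z)"] unfolding q_def by simp
  qed
  have leP: "ennreal e * ennreal e * q P \<le> ennreal (g * g' * a)" "ennreal (g * g' * a) \<le> ennreal E * ennreal E * q P"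
    using le[OF _ idem(1)] pos a0 by (simp_all add: nnP ennreal_mult)
  have leM: "ennreal e * ennreal e * q P \<le> ennreal (g * g' * c)" "ennreal (g * g' * c) \<le> ennreal E * ennreal E * q P"
    using le[OF _ idem(2)] pos a0 by (simp_all add: nnM swap ennreal_mult)
  have "q P \<noteq> \<infinity>"
  proof
    assume "q P = \<infinity>"
    then have "ennreal e * ennreal e * q P = \<infinity>" using pos by (simp add: ennreal_mult_eq_top_iff)
    then show False using leP(1) by (simp add: top_unique)
  qed
  then obtain w where w: "0 \<le> w" "q P = ennreal w" by (cases "q P") auto
  have r: "e * e * w \<le> g * g' * a" "g * g' * a \<le> E * E * w" "e * e * w \<le> g * g' * c" "g * g' * c \<le> E * E * w"
    using leP leM pos w a0 by (simp_all add: ennreal_mult[symmetric] ennreal_le_iff)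
  have E: "0 < E" using pos by simp
  have key: "(e / E)\<^sup>2 * s \<le> t"
    if "g * g' * s \<le> E * E * w" "e * e * w \<le> g * g' * t" for s t
  proof -
    have "g * g' * ((e / E)\<^sup>2 * s) = (e / E)\<^sup>2 * (g * g' * s)" by simp
    also have "\<dots> \<le> (e / E)\<^sup>2 * (E * E * w)" using that by (intro mult_left_mono) auto
    also have "\<dots> = e * e * w" using E by (simp add: power2_eq_square)
    also have "\<dots> \<le> g * g' * t" by fact
    finally show ?thesis using pos by (simp add: mult_le_cancel_left_pos)
  qed
  have "(e / E)\<^sup>2 * a \<le> c" "(e / E)\<^sup>2 * c \<le> a" using key r by blast+
  moreover have "(e / E)\<^sup>2 \<le> 1" using pos E by (simp add: power_le_one)
  then have "(e / E)\<^sup>2 * a \<le> a" "(e / E)\<^sup>2 * c \<le> c" using a0 by (simp_all add: mult_left_le_one_le)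
  ultimately have "\<bar>a - c\<bar> \<le> (1 - (e / E)\<^sup>2) * (a + c)"
    by (auto simp: abs_le_iff algebra_simps)
  moreover have "(\<integral>z. indicator (A \<times> A) z * F z \<partial>?N) = a - c"
    unfolding a_def c_def Bochner_Integration.integral_diff[OF intP intM, symmetric]
    by (intro Bochner_Integration.integral_cong) (auto simp: P_def M_def max_def indicator_def)
  moreover have "(\<integral>z. indicator (A \<times> A) z * \<bar>F z\<bar> \<partial>?N) = a + c"
    unfolding a_def c_def Bochner_Integration.integral_add[OF intP intM, symmetric]
    by (intro Bochner_Integration.integral_cong) (auto simp: P_def M_def max_def indicator_def)
  ultimately show ?thesis by simp
qed

lemma integrable_pair_mult:
  fixes f g :: "'a \<Rightarrow> real"
  assumes fin: "finite_measure \<mu>" "finite_measure \<nu>" and f: "integrable \<mu> f" and g: "integrable \<nu> g"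
  shows "integrable (\<mu> \<Otimes>\<^sub>M \<nu>) (\<lambda>z. f (fst z) * g (snd z))"
    and "(\<integral>z. f (fst z) * g (snd z) \<partial>(\<mu> \<Otimes>\<^sub>M \<nu>)) = (\<integral>x. f x \<partial>\<mu>) * (\<integral>y. g y \<partial>\<nu>)"
proof -
  interpret m: finite_measure \<mu> by fact
  interpret n: finite_measure \<nu> by fact
  interpret pair_sigma_finite \<mu> \<nu> ..
  note [measurable] = borel_measurable_integrable[OF f] borel_measurable_integrable[OF g]
  show int: "integrable (\<mu> \<Otimes>\<^sub>M \<nu>) (\<lambda>z. f (fst z) * g (snd z))"
    by (rule Fubini_integrable) (use f g in \<open>auto simp: abs_mult\<close>)
  show "(\<integral>z. f (fst z) * g (snd z) \<partial>(\<mu> \<Otimes>\<^sub>M \<nu>)) = (\<integral>x. f x \<partial>\<mu>) * (\<integral>y. g y \<partial>\<nu>)"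
    by (subst integral_fst'[OF int, symmetric]) simp
qed

context stable_model
begin

text \<open>The difference of the ratios \<open>Q\<^sub>p\<^sub>,\<^sub>n(\<phi>) / Q\<^sub>p\<^sub>,\<^sub>n(1)\<close> at two points, with the denominators cleared. Unlike
  the ratios it is propagated linearly, by the product kernel, and it is antisymmetric.\<close>

definition cross :: "level \<Rightarrow> nat \<Rightarrow> nat \<Rightarrow> ('a \<Rightarrow> real) \<Rightarrow> 'a \<times> 'a \<Rightarrow> real" where
  "cross s p n \<phi> z =
     Q_semi m s p n \<phi> (fst z) * Q_semi m s p n (\<lambda>_. 1) (snd z) -
     Q_semi m s p n \<phi> (snd z) * Q_semi m s p n (\<lambda>_. 1) (fst z)"

text \<open>The Lyapunov function \<open>v \<otimes> v\<close>, enlarged by \<open>1 / \<kappa>\<close> on \<open>C \<times> C\<close>. A step from outside may then enter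
  \<open>C \<times> C\<close> at the price \<open>1 / \<kappa>\<close>, which the drift pays for, while a step that leaves \<open>C \<times> C\<close> gains the
  factor \<open>\<kappa>\<close>.\<close>

definition pair_weight :: "real \<Rightarrow> real \<Rightarrow> 'a \<times> 'a \<Rightarrow> real" where
  "pair_weight r \<kappa> z = exp (V (fst z)) * exp (V (snd z)) *
     (if z \<in> C r \<times> C r then 1 / \<kappa> else 1)"

text \<open>Two mechanisms make the cross difference small: each step of the pair inside \<open>C \<times> C\<close> contracts by
  \<open>\<rho>\<close>, and each step outside is damped by the drift. For a path with \<open>N\<close> steps inside, the
  elementary inequality \<open>\<rho>\<^sup>N \<le> \<rho>\<^sup>a + \<kappa>\<^sup>N\<^sup>-\<^sup>a\<close>, valid for every real \<open>a\<close> because either \<open>N \<ge> a\<close> or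
  \<open>N \<le> a\<close>, separates paths with many such steps from the others, for which every step is damped by
  \<open>\<kappa> (drift_const k)\<^sup>2\<close>. The induction carries this inequality for all \<open>a\<close> simultaneously, so that no
  measure on paths is needed: a step inside replaces \<open>a\<close> by \<open>a - 1\<close>.\<close>

lemma cross_bound:
  assumes r: "d_low k \<le> r"
    and \<rho>: "0 < \<rho>" "\<rho> \<le> 1" "1 - (eps_minus k r / eps_plus k r)\<^sup>2 \<le> \<rho>"
    and \<kappa>: "0 < \<kappa>" "\<kappa> \<le> 1" "exp (- delta k * r) \<le> \<kappa>\<^sup>2"
    and \<phi>: "\<phi> \<in> bounded_measurable X" "\<And>x. x \<in> space X \<Longrightarrow> \<bar>\<phi> x\<bar> \<le> L" "0 \<le> L"
    and "p \<le> n" "x \<in> space X" "y \<in> space X"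
  shows "\<bar>cross s p n \<phi> (x, y)\<bar> \<le> 2 * L *
    (\<rho> powr a * (Q_semi m s p n (\<lambda>_. 1) x * Q_semi m s p n (\<lambda>_. 1) y)
     + \<kappa> powr (- a) * (\<kappa> * (drift_const k)\<^sup>2) ^ (n - p) * pair_weight r \<kappa> (x, y))"
  using assms(11-13)
proof (induction arbitrary: x y a rule: inc_induct)
  case base
  have "\<bar>cross s n n \<phi> (x, y)\<bar> \<le> 2 * L"
    using \<phi>(2)[OF base(1)] \<phi>(2)[OF base(2)] by (simp add: cross_def)
  also have "\<dots> \<le> 2 * L * (\<rho> powr a + \<kappa> powr (- a))"
  proof -
    have "1 \<le> \<rho> powr a + \<kappa> powr (- a)"
    proof (cases "0 \<le> a")
      case True
      then have "1 \<le> \<kappa> powr (- a)" using \<kappa> by (simp add: powr_minus_divide powr_le1)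
      then show ?thesis by (simp add: add_increasing)
    next
      case False
      then have "1 \<le> \<rho> powr a" using \<rho> powr_le1[of "- a" \<rho>] by (simp add: powr_minus_divide field_simps)
      then show ?thesis by (simp add: add_increasing2)
    qed
    then show ?thesis using \<phi>(3) by (simp add: mult_le_cancel_left1)
  qed
  also have "\<dots> \<le> 2 * L * (\<rho> powr a + \<kappa> powr (- a) * pair_weight r \<kappa> (x, y))"
  proof -
    have "1 \<le> exp (V x) * exp (V y)"
      using V_ge_1[OF base(1)] V_ge_1[OF base(2)] by (simp add: exp_add[symmetric])
    moreover have "1 \<le> 1 / \<kappa>" using \<kappa> by simp
    ultimately have "1 \<le> pair_weight r \<kappa> (x, y)"
      using mult_mono[of 1 "exp (V x) * exp (V y)" 1 "1 / \<kappa>"] by (auto simp: pair_weight_def)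
    then show ?thesis using \<phi>(3) by (intro mult_left_mono add_left_mono) (auto simp: mult_le_cancel_left1)
  qed
  finally show ?case by simp
next
  case (step p)
  let ?\<mu> = "M m s (Suc p) x" and ?\<nu> = "M m s (Suc p) y"
  let ?N = "?\<mu> \<Otimes>\<^sub>M ?\<nu>" and ?g = "G m p x * G m p y"
  let ?one = "Q_semi m s (Suc p) n (\<lambda>_. 1)"
  define \<theta> where "\<theta> = \<kappa> * (drift_const k)\<^sup>2"
  define v2 where "v2 z = exp (V (fst z)) * exp (V (snd z))" for z
  define U where "U z = ?one (fst z) * ?one (snd z)" for z
  note xy = step.prems
  have p: "p < n" "Suc p \<le> n" using step.hyps by auto
  note bm1 = bounded_measurable_const[of "1::real" X]
  note Q\<phi> = Q_semi_bounded[OF \<phi>(1) p(2), of s] and Q1 = Q_semi_bounded[OF bm1 p(2), of s]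
  have fin: "finite_measure ?\<mu>" "finite_measure ?\<nu>" using M_finite xy by auto
  have sets: "sets ?\<mu> = sets X" "sets ?\<nu> = sets X" using M_sets xy by auto
  note [measurable_cong] = sets
  have spN: "space ?N = space X \<times> space X" using xy by (simp add: space_pair_measure M_space)
  have g: "0 < ?g" using G_pos xy by simp
  have \<theta>0: "0 < \<theta>" using \<kappa> drift_const_pos[of k] by (simp add: \<theta>_def)
  have intU: "integrable ?N U" and valU: "?g * (\<integral>z. U z \<partial>?N) = Q_semi m s p n (\<lambda>_. 1) x * Q_semi m s p n (\<lambda>_. 1) y"
    unfolding U_def
    using integrable_pair_mult[OF fin integrable_M[OF Q1 xy(1)] integrable_M[OF Q1 xy(2)]] p
    by (auto simp: Q_semi_step Q_def)
  have intv: "integrable ?N v2" and valv: "?g * (\<integral>z. v2 z \<partial>?N) = Q m s (Suc p) (\<lambda>y. exp (V y)) x * Q m s (Suc p) (\<lambda>y. exp (V y)) y"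
    unfolding v2_def
    using integrable_pair_mult[OF fin integrable_exp_V(1)[OF xy(1)] integrable_exp_V(1)[OF xy(2)]]
    by (auto simp: Q_def)
  have int\<Delta>: "integrable ?N (cross s (Suc p) n \<phi>)"
    and val\<Delta>: "cross s p n \<phi> (x, y) = ?g * (\<integral>z. cross s (Suc p) n \<phi> z \<partial>?N)"
  proof -
    note i1 = integrable_pair_mult[OF fin integrable_M[OF Q\<phi> xy(1)] integrable_M[OF Q1 xy(2)]]
    note i2 = integrable_pair_mult[OF fin integrable_M[OF Q1 xy(1)] integrable_M[OF Q\<phi> xy(2)]]
    have eq: "cross s (Suc p) n \<phi> = (\<lambda>z. Q_semi m s (Suc p) n \<phi> (fst z) * ?one (snd z)
        - ?one (fst z) * Q_semi m s (Suc p) n \<phi> (snd z))"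
      by (auto simp: cross_def)
    show "integrable ?N (cross s (Suc p) n \<phi>)"
      unfolding eq by (rule Bochner_Integration.integrable_diff[OF i1(1) i2(1)])
    show "cross s p n \<phi> (x, y) = ?g * (\<integral>z. cross s (Suc p) n \<phi> z \<partial>?N)"
      unfolding eq Bochner_Integration.integral_diff[OF i1(1) i2(1)] i1(2) i2(2)
      using p by (simp add: cross_def Q_semi_step Q_def algebra_simps)
  qed
  have meas\<Delta> [measurable]: "cross s (Suc p) n \<phi> \<in> borel_measurable (X \<Otimes>\<^sub>M X)"
  proof -
    note [measurable] = bounded_measurable_measurable[OF Q\<phi>] bounded_measurable_measurable[OF Q1]
    show ?thesis unfolding cross_def by measurable
  qed
  have U0: "0 \<le> U z" if "z \<in> space ?N" for z
    using that Q_semi_one_pos[OF p(2)] by (auto simp: U_def spN less_imp_le)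
  have v0: "0 < v2 z" for z by (simp add: v2_def)
  have IH: "\<bar>cross s (Suc p) n \<phi> z\<bar> \<le> 2 * L *
      (\<rho> powr a * U z + \<kappa> powr (- a) * \<theta> ^ (n - Suc p) * pair_weight r \<kappa> z)" if "z \<in> space ?N" for z a
    using step.IH[of "fst z" "snd z" a] that by (auto simp: spN U_def \<theta>_def)
  have "Q m s (Suc p) (\<lambda>y. exp (V y)) z \<ge> 0" if "z \<in> space X" for z
    using G_pos[OF that, of p] by (auto simp: Q_def intro!: mult_nonneg_nonneg integral_nonneg_AE)
  note vx = this[OF xy(1)] this[OF xy(2)]
  define t where "t = (if x \<in> C r \<and> y \<in> C r then 1 else 1 / \<kappa>)"
  have integral_bound: "\<bar>\<integral>z. cross s (Suc p) n \<phi> z \<partial>?N\<bar> \<le>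
      (\<integral>z. 2 * L * (\<rho> powr a * U z + \<kappa> powr (- a) * \<theta> ^ (n - Suc p) * (v2 z * t)) \<partial>?N)"
  proof (cases "x \<in> C r \<and> y \<in> C r")
    case True
    let ?A = "C r \<times> C r"
    have major: "eps_minus k r * measure (\<nu> r) (C r \<inter> B) \<le> G m p x * measure (M m s (Suc p) x) (C r \<inter> B)
        \<and> G m p x * measure (M m s (Suc p) x) (C r \<inter> B) \<le> eps_plus k r * measure (\<nu> r) (C r \<inter> B)"
      if "x \<in> C r" "B \<in> sets X" for x B
    proof -
      have "minorization_cond k m V \<nu>" "majorization_cond k m V \<nu>"
        using standing by (auto simp: standing_conds_def)
      then have "\<forall>s. \<forall>n\<ge>1. \<forall>x \<in> C r. \<forall>E \<in> sets X.
        eps_minus k r * measure (\<nu> r) (C r \<inter> E) \<le> G m (n - 1) x * measure (M m s n x) (C r \<inter> E)"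
        "\<forall>s. \<forall>n\<ge>1. \<forall>x \<in> C r. \<forall>E \<in> sets X.
        G m (n - 1) x * measure (M m s n x) (C r \<inter> E) \<le> eps_plus k r * measure (\<nu> r) (C r \<inter> E)"
        using r unfolding minorization_cond_def majorization_cond_def by blast+
      from this(1)[rule_format, of "Suc p" x B s] this(2)[rule_format, of "Suc p" x B s] that
      show ?thesis by simp
    qed
    have "\<nu> r \<in> space (prob_algebra X)"
    proof -
      have "minorization_cond k m V \<nu>" using standing by (auto simp: standing_conds_def)
      then show ?thesis using r unfolding minorization_cond_def by blast
    qed
    then have \<nu>: "finite_measure (\<nu> r)" "sets (\<nu> r) = sets X"
      by (auto simp: space_prob_algebra prob_space_def)
    have anti: "cross s (Suc p) n \<phi> (w, u) = - cross s (Suc p) n \<phi> (u, w)" for u w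
      by (simp add: cross_def)
    have "\<bar>\<integral>z. indicator ?A z * cross s (Suc p) n \<phi> z \<partial>?N\<bar>
        \<le> (1 - (eps_minus k r / eps_plus k r)\<^sup>2) * (\<integral>z. indicator ?A z * \<bar>cross s (Suc p) n \<phi> z\<bar> \<partial>?N)"
      using eps[OF r] major True G_pos xy
      by (intro antisymmetric_contraction[OF fin \<nu>(1) sets \<nu>(2) C_sets _ _ _ _ _ _ _ _ meas\<Delta> anti int\<Delta>,
            where g = "G m p x" and g' = "G m p y"]) auto
    also have "\<dots> \<le> \<rho> * (\<integral>z. indicator ?A z * \<bar>cross s (Suc p) n \<phi> z\<bar> \<partial>?N)"
      using \<rho>(3) by (intro mult_right_mono integral_nonneg_AE) auto
    finally have contr: "\<bar>\<integral>z. indicator ?A z * cross s (Suc p) n \<phi> z \<partial>?N\<bar>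
        \<le> \<rho> * (\<integral>z. indicator ?A z * \<bar>cross s (Suc p) n \<phi> z\<bar> \<partial>?N)" .
    have intA: "integrable ?N (\<lambda>z. indicator ?A z * f z)" "integrable ?N (\<lambda>z. indicator (- ?A) z * f z)"
      if "integrable ?N f" for f :: "'a \<times> 'a \<Rightarrow> real"
    proof -
      have [measurable]: "f \<in> borel_measurable ?N" using that by auto
      have "f \<in> borel_measurable (X \<Otimes>\<^sub>M X)" by measurable
      then have [measurable]: "(\<lambda>z. indicator (- ?A) z * f z) \<in> borel_measurable ?N"
      proof -
        have "(\<lambda>z. indicator (- ?A) z * f z) = (\<lambda>z. f z - indicator ?A z * f z)"
          by (auto simp: indicator_def)
        then show ?thesis by simp
      qed
      show "integrable ?N (\<lambda>z. indicator ?A z * f z)"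
        by (rule Bochner_Integration.integrable_bound[OF that]) (auto simp: indicator_def)
      show "integrable ?N (\<lambda>z. indicator (- ?A) z * f z)"
        by (rule Bochner_Integration.integrable_bound[OF that]) (auto simp: indicator_def)
    qed
    have "(\<integral>z. cross s (Suc p) n \<phi> z \<partial>?N) =
        (\<integral>z. indicator ?A z * cross s (Suc p) n \<phi> z + indicator (- ?A) z * cross s (Suc p) n \<phi> z \<partial>?N)"
      by (intro Bochner_Integration.integral_cong) (auto simp: indicator_def)
    also have "\<dots> = (\<integral>z. indicator ?A z * cross s (Suc p) n \<phi> z \<partial>?N)
        + (\<integral>z. indicator (- ?A) z * cross s (Suc p) n \<phi> z \<partial>?N)"
      by (intro Bochner_Integration.integral_add intA int\<Delta>)
    finally have "\<bar>\<integral>z. cross s (Suc p) n \<phi> z \<partial>?N\<bar> \<le>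
        \<rho> * (\<integral>z. indicator ?A z * \<bar>cross s (Suc p) n \<phi> z\<bar> \<partial>?N)
        + (\<integral>z. \<bar>indicator (- ?A) z * cross s (Suc p) n \<phi> z\<bar> \<partial>?N)"
      using contr integral_abs_bound[of ?N "\<lambda>z. indicator (- ?A) z * cross s (Suc p) n \<phi> z"]
      by linarith
    also have "\<dots> = (\<integral>z. \<rho> * (indicator ?A z * \<bar>cross s (Suc p) n \<phi> z\<bar>)
        + \<bar>indicator (- ?A) z * cross s (Suc p) n \<phi> z\<bar> \<partial>?N)"
      using intA[OF integrable_abs[OF int\<Delta>]] intA[OF int\<Delta>] by simp
    also have "\<dots> \<le> (\<integral>z. 2 * L * (\<rho> powr a * U z + \<kappa> powr (- a) * \<theta> ^ (n - Suc p) * v2 z) \<partial>?N)"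
    proof (rule integral_mono)
      show "integrable ?N (\<lambda>z. \<rho> * (indicator ?A z * \<bar>cross s (Suc p) n \<phi> z\<bar>)
        + \<bar>indicator (- ?A) z * cross s (Suc p) n \<phi> z\<bar>)"
        using intA[OF integrable_abs[OF int\<Delta>]] intA[OF int\<Delta>] by simp
      show "integrable ?N (\<lambda>z. 2 * L * (\<rho> powr a * U z + \<kappa> powr (- a) * \<theta> ^ (n - Suc p) * v2 z))"
        using intU intv by simp
      fix z assume z: "z \<in> space ?N"
      show "\<rho> * (indicator ?A z * \<bar>cross s (Suc p) n \<phi> z\<bar>) + \<bar>indicator (- ?A) z * cross s (Suc p) n \<phi> z\<bar>
          \<le> 2 * L * (\<rho> powr a * U z + \<kappa> powr (- a) * \<theta> ^ (n - Suc p) * v2 z)"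
      proof (cases "z \<in> ?A")
        case True
        (* a step inside uses up one unit of the budget a; the factor \<kappa> gained cancels the 1 / \<kappa> of the weight *)
        have "\<rho> * \<bar>cross s (Suc p) n \<phi> z\<bar> \<le> \<rho> * (2 * L *
            (\<rho> powr (a - 1) * U z + \<kappa> powr (- (a - 1)) * \<theta> ^ (n - Suc p) * pair_weight r \<kappa> z))"
          using IH[OF z, of "a - 1"] \<rho> by (intro mult_left_mono) auto
        also have "\<dots> = 2 * L * (\<rho> powr a * U z + \<rho> * (\<kappa> powr (- a) * \<theta> ^ (n - Suc p) * v2 z))"
        proof -
          have "\<rho> powr a = \<rho> * \<rho> powr (a - 1)" using \<rho> by (simp add: powr_diff)
          moreover have "\<kappa> powr (- (a - 1)) = \<kappa> powr (- a) * \<kappa>"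
            using \<kappa> powr_add[of \<kappa> "- a" 1] by (simp add: algebra_simps)
          ultimately show ?thesis using True \<kappa> by (simp add: pair_weight_def v2_def algebra_simps)
        qed
        also have "\<dots> \<le> 2 * L * (\<rho> powr a * U z + 1 * (\<kappa> powr (- a) * \<theta> ^ (n - Suc p) * v2 z))"
          using \<rho> \<phi>(3) \<theta>0 v0[of z] by (intro mult_left_mono add_left_mono mult_right_mono) auto
        finally show ?thesis using True by simp
      next
        case False
        then show ?thesis using IH[OF z, of a] by (simp add: pair_weight_def v2_def)
      qed
    qed
    finally show ?thesis using True by (simp add: t_def)
  next
    case False
    have "\<bar>\<integral>z. cross s (Suc p) n \<phi> z \<partial>?N\<bar> \<le>
        (\<integral>z. 2 * L * (\<rho> powr a * U z + \<kappa> powr (- a) * \<theta> ^ (n - Suc p) * (v2 z / \<kappa>)) \<partial>?N)"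
    proof (rule integral_abs_bound[THEN order_trans], rule integral_mono)
      show "integrable ?N (\<lambda>z. \<bar>cross s (Suc p) n \<phi> z\<bar>)" using int\<Delta> by simp
      show "integrable ?N (\<lambda>z. 2 * L * (\<rho> powr a * U z + \<kappa> powr (- a) * \<theta> ^ (n - Suc p) * (v2 z / \<kappa>)))"
        using intU intv by simp
      fix z assume z: "z \<in> space ?N"
      have "pair_weight r \<kappa> z \<le> v2 z / \<kappa>"
        using \<kappa> by (simp add: pair_weight_def v2_def mult_left_le field_simps)
      then have "2 * L * (\<rho> powr a * U z + \<kappa> powr (- a) * \<theta> ^ (n - Suc p) * pair_weight r \<kappa> z)
          \<le> 2 * L * (\<rho> powr a * U z + \<kappa> powr (- a) * \<theta> ^ (n - Suc p) * (v2 z / \<kappa>))"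
        using \<phi>(3) \<theta>0 by (intro mult_left_mono add_left_mono) auto
      then show "\<bar>cross s (Suc p) n \<phi> z\<bar>
          \<le> 2 * L * (\<rho> powr a * U z + \<kappa> powr (- a) * \<theta> ^ (n - Suc p) * (v2 z / \<kappa>))"
        using IH[OF z, of a] by linarith
    qed
    then show ?thesis using False by (auto simp: t_def)
  qed
  let ?Q = "\<lambda>x. Q m s (Suc p) (\<lambda>y. exp (V y)) x"
  have drift_pair: "?Q x * ?Q y * t \<le> \<theta> * pair_weight r \<kappa> (x, y)"
  proof -
    note b = drift_bound(1)[OF xy(1), of 1 s p, simplified] drift_bound(1)[OF xy(2), of 1 s p, simplified]
    show ?thesis
    proof (cases "x \<in> C r \<and> y \<in> C r")
      case True
      have "?Q x * ?Q y \<le> (drift_const k * exp (V x)) * (drift_const k * exp (V y))"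
        using b vx drift_const_pos[of k] by (intro mult_mono) auto
      then show ?thesis
        using True \<kappa>(1) by (simp add: t_def pair_weight_def \<theta>_def power2_eq_square mult_ac)
    next
      case False
      (* at least one of the two coordinates lies above level r and is damped; the other only stays controlled *)
      have "?Q x * ?Q y \<le> (drift_const k)\<^sup>2 * exp (- delta k * r) * (exp (V x) * exp (V y))"
      proof (cases "x \<in> C r")
        case True
        then have "r \<le> V y" using False xy by (auto simp: sublevel_def)
        then have "?Q y \<le> drift_const k * exp (- delta k * r) * exp (V y)"
          using drift_bound(2)[OF xy(2), of 1 r s p] by simp
        then have "?Q x * ?Q y \<le> (drift_const k * exp (V x)) * (drift_const k * exp (- delta k * r) * exp (V y))"
          using b vx drift_const_pos[of k] by (intro mult_mono) auto
        then show ?thesis by (simp add: power2_eq_square mult_ac)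
      next
        case False
        then have "r \<le> V x" using xy by (auto simp: sublevel_def)
        then have "?Q x \<le> drift_const k * exp (- delta k * r) * exp (V x)"
          using drift_bound(2)[OF xy(1), of 1 r s p] by simp
        then have "?Q x * ?Q y \<le> (drift_const k * exp (- delta k * r) * exp (V x)) * (drift_const k * exp (V y))"
          using b vx drift_const_pos[of k] by (intro mult_mono) auto
        then show ?thesis by (simp add: power2_eq_square mult_ac)
      qed
      also have "\<dots> \<le> (drift_const k)\<^sup>2 * \<kappa>\<^sup>2 * (exp (V x) * exp (V y))"
        using \<kappa>(3) by (intro mult_right_mono mult_left_mono) auto
      finally have "?Q x * ?Q y / \<kappa> \<le> \<theta> * (exp (V x) * exp (V y))"
        using \<kappa>(1) by (simp add: \<theta>_def field_simps power2_eq_square)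
      then show ?thesis using False by (auto simp: t_def pair_weight_def)
    qed
  qed
  have "\<bar>cross s p n \<phi> (x, y)\<bar> \<le> ?g *
      (\<integral>z. 2 * L * (\<rho> powr a * U z + \<kappa> powr (- a) * \<theta> ^ (n - Suc p) * (v2 z * t)) \<partial>?N)"
    using g integral_bound by (simp add: val\<Delta> abs_mult abs_of_pos G_pos xy)
  also have "\<dots> = 2 * L * (\<rho> powr a * (?g * (\<integral>z. U z \<partial>?N))
      + \<kappa> powr (- a) * \<theta> ^ (n - Suc p) * (?g * (\<integral>z. v2 z \<partial>?N) * t))"
    using intU intv by (simp add: algebra_simps)
  also have "\<dots> \<le> 2 * L * (\<rho> powr a * (Q_semi m s p n (\<lambda>_. 1) x * Q_semi m s p n (\<lambda>_. 1) y)
      + \<kappa> powr (- a) * \<theta> ^ (n - Suc p) * (\<theta> * pair_weight r \<kappa> (x, y)))"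
    unfolding valU valv using drift_pair \<phi>(3) \<theta>0 by (intro mult_left_mono add_left_mono) auto
  finally show ?case
    unfolding Suc_diff_Suc[OF p(1), symmetric] by (simp add: \<theta>_def mult_ac)
qed

end

lemma supnorm_nonneg:
  assumes "\<phi> \<in> bounded_measurable X" "space X \<noteq> {}"
  shows "0 \<le> supnorm X \<phi>"
proof -
  obtain x where "x \<in> space X" using assms(2) by blast
  from abs_le_supnorm[OF assms(1) this] show ?thesis by linarith
qed

lemma supnorm_le:
  assumes "space X \<noteq> {}" "\<And>x. x \<in> space X \<Longrightarrow> \<bar>\<phi> x\<bar> \<le> c"
  shows "supnorm X \<phi> \<le> c"
  unfolding wnorm_def using assms by (intro cSUP_least) auto

context stable_model
begin

lemma ratio_le_supnorm:
  assumes \<phi>: "\<phi> \<in> bounded_measurable X" and pn: "p \<le> n" and x: "x \<in> space X"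
  shows "\<bar>Q_semi m s p n \<phi> x / Q_semi m s p n (\<lambda>_. 1) x\<bar> \<le> supnorm X \<phi>"
proof -
  have "\<bar>Q_semi m s p n \<phi> x\<bar> \<le> supnorm X \<phi> * Q_semi m s p n (\<lambda>_. 1) x"
    using pn x
  proof (induction arbitrary: x rule: inc_induct)
    case base then show ?case using abs_le_supnorm[OF \<phi>] by simp
  next
    case (step p)
    let ?f = "Q_semi m s (Suc p) n \<phi>" and ?o = "Q_semi m s (Suc p) n (\<lambda>_. 1)"
    have i: "integrable (M m s (Suc p) x) ?f" "integrable (M m s (Suc p) x) ?o"
      using step by (auto intro!: integrable_M Q_semi_bounded \<phi> bounded_measurable_const)
    have "\<bar>\<integral>y. ?f y \<partial>M m s (Suc p) x\<bar> \<le> (\<integral>y. supnorm X \<phi> * ?o y \<partial>M m s (Suc p) x)"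
      by (rule integral_abs_bound[THEN order_trans], rule integral_mono)
        (use i step in \<open>auto simp: M_space\<close>)
    then show ?case
      using step G_pos[of x p] by (simp add: Q_semi_step Q_def abs_mult abs_of_pos)
  qed
  then show ?thesis
    using Q_semi_one_pos[OF pn x, of s] by (simp add: abs_divide abs_of_pos pos_divide_le_eq)
qed

text \<open>Averaging the cross difference in its second point over \<open>\<eta>\<^sub>p\<close> and dividing by the denominators
  compares the ratio at \<open>x\<close> with \<open>\<eta>\<^sub>n(\<phi>)\<close>. In the first term the denominators cancel exactly.\<close>

lemma forgetting_bound:
  assumes r: "d_low k \<le> r"
    and \<rho>: "0 < \<rho>" "\<rho> \<le> 1" "1 - (eps_minus k r / eps_plus k r)\<^sup>2 \<le> \<rho>"
    and \<kappa>: "0 < \<kappa>" "\<kappa> \<le> 1" "exp (- delta k * r) \<le> \<kappa>\<^sup>2"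
    and \<phi>: "\<phi> \<in> bounded_measurable X" "\<And>x. x \<in> space X \<Longrightarrow> \<bar>\<phi> x\<bar> \<le> L" "0 \<le> L"
    and pn: "p \<le> n" and x: "x \<in> space X"
    and int: "integrable (eta m s p) (\<lambda>x. exp (V x))"
  shows "\<bar>Q_semi m s p n \<phi> x / Q_semi m s p n (\<lambda>_. 1) x - (\<integral>y. \<phi> y \<partial>eta m s n)\<bar> \<le> 2 * L *
    (\<rho> powr a + \<kappa> powr (- a) * (\<kappa> * (drift_const k)\<^sup>2) ^ (n - p) *
      (exp (V x) * (\<integral>y. exp (V y) \<partial>eta m s p) /
        (\<kappa> * (Q_semi m s p n (\<lambda>_. 1) x * (\<integral>y. Q_semi m s p n (\<lambda>_. 1) y \<partial>eta m s p)))))"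
proof -
  interpret prob_space "eta m s p" by (rule prob_eta)
  let ?one = "Q_semi m s p n (\<lambda>_. 1)"
  define J where "J = ?one x"
  define I where "I = (\<integral>y. ?one y \<partial>eta m s p)"
  define \<theta> where "\<theta> = (\<kappa> * (drift_const k)\<^sup>2) ^ (n - p)"
  note bm1 = bounded_measurable_const[of "1::real" X]
  note Q\<phi> = Q_semi_bounded[OF \<phi>(1) pn, of s] and Q1 = Q_semi_bounded[OF bm1 pn, of s]
  note int\<phi> = integrable_eta[OF Q\<phi>, of s p] and int1 = integrable_eta[OF Q1, of s p]
  have \<theta>: "0 \<le> \<theta>" using \<kappa> by (simp add: \<theta>_def)
  have J: "0 < J" unfolding J_def by (rule Q_semi_one_pos[OF pn x])
  have I: "0 < I"
  proof -
    have "I \<noteq> 0"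
    proof
      assume "I = 0"
      then have "AE y in eta m s p. ?one y = 0"
        unfolding I_def by (subst (asm) integral_nonneg_eq_0_iff_AE[OF int1])
          (auto intro!: AE_I2 less_imp_le Q_semi_one_pos[OF pn])
      then have "AE y in eta m s p. False"
        by (rule AE_mp) (intro AE_I2, auto dest: Q_semi_one_pos[OF pn, of _ s])
      then show False by simp
    qed
    moreover have "0 \<le> I" unfolding I_def
      by (intro integral_nonneg_AE AE_I2) (simp add: Q_semi_one_pos[OF pn] less_imp_le)
    ultimately show ?thesis by simp
  qed
  have eta\<phi>: "(\<integral>y. Q_semi m s p n \<phi> y \<partial>eta m s p) = I * (\<integral>y. \<phi> y \<partial>eta m s n)"
    unfolding I_def by (rule eta_Q_semi[OF \<phi>(1) pn])
  have cr: "(\<integral>y. cross s p n \<phi> (x, y) \<partial>eta m s p) = Q_semi m s p n \<phi> x * I - J * (I * (\<integral>y. \<phi> y \<partial>eta m s n))"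
  proof -
    have "(\<integral>y. cross s p n \<phi> (x, y) \<partial>eta m s p) =
        Q_semi m s p n \<phi> x * I - (\<integral>y. Q_semi m s p n \<phi> y \<partial>eta m s p) * J"
      using int\<phi> int1 by (simp add: cross_def I_def J_def)
    then show ?thesis by (simp only: eta\<phi> mult.commute)
  qed
  have "\<bar>\<integral>y. cross s p n \<phi> (x, y) \<partial>eta m s p\<bar>
      \<le> (\<integral>y. 2 * L * (\<rho> powr a * (J * ?one y) + \<kappa> powr (- a) * \<theta> * (exp (V x) * exp (V y) / \<kappa>)) \<partial>eta m s p)"
  proof (rule integral_abs_bound[THEN order_trans], rule integral_mono)
    show "integrable (eta m s p) (\<lambda>y. \<bar>cross s p n \<phi> (x, y)\<bar>)"
      unfolding cross_def fst_conv snd_conv using int\<phi> int1 by (intro integrable_abs) auto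
    show "integrable (eta m s p) (\<lambda>y. 2 * L * (\<rho> powr a * (J * ?one y) + \<kappa> powr (- a) * \<theta> * (exp (V x) * exp (V y) / \<kappa>)))"
      using int int1 by simp
    fix y assume "y \<in> space (eta m s p)"
    then have y: "y \<in> space X" by simp
    have "pair_weight r \<kappa> (x, y) \<le> exp (V x) * exp (V y) / \<kappa>"
      using \<kappa> by (simp add: pair_weight_def mult_left_le field_simps)
    then have "2 * L * (\<rho> powr a * (J * ?one y) + \<kappa> powr (- a) * \<theta> * pair_weight r \<kappa> (x, y))
        \<le> 2 * L * (\<rho> powr a * (J * ?one y) + \<kappa> powr (- a) * \<theta> * (exp (V x) * exp (V y) / \<kappa>))"
      using \<phi>(3) \<theta> by (intro mult_left_mono add_left_mono) auto
    then show "\<bar>cross s p n \<phi> (x, y)\<bar>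
        \<le> 2 * L * (\<rho> powr a * (J * ?one y) + \<kappa> powr (- a) * \<theta> * (exp (V x) * exp (V y) / \<kappa>))"
      using cross_bound[OF r \<rho> \<kappa> \<phi> pn x y, of s a] by (simp add: J_def \<theta>_def)
  qed
  also have "\<dots> = 2 * L * (\<rho> powr a * (J * I) + \<kappa> powr (- a) * \<theta> * (exp (V x) * (\<integral>y. exp (V y) \<partial>eta m s p) / \<kappa>))"
    using int int1 by (simp add: I_def)
  finally have "\<bar>Q_semi m s p n \<phi> x * I - J * (I * (\<integral>y. \<phi> y \<partial>eta m s n))\<bar> / (J * I)
      \<le> 2 * L * (\<rho> powr a * (J * I) + \<kappa> powr (- a) * \<theta> * (exp (V x) * (\<integral>y. exp (V y) \<partial>eta m s p) / \<kappa>)) / (J * I)"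
    unfolding cr using I J by (intro divide_right_mono) auto
  also have "\<dots> = 2 * L * (\<rho> powr a + \<kappa> powr (- a) * \<theta> * (exp (V x) * (\<integral>y. exp (V y) \<partial>eta m s p) / (\<kappa> * (J * I))))"
    using I J \<kappa>(1) by (simp add: field_simps)
  also have "\<bar>Q_semi m s p n \<phi> x * I - J * (I * (\<integral>y. \<phi> y \<partial>eta m s n))\<bar> / (J * I) =
      \<bar>Q_semi m s p n \<phi> x / J - (\<integral>y. \<phi> y \<partial>eta m s n)\<bar>"
  proof -
    have "Q_semi m s p n \<phi> x / J - (\<integral>y. \<phi> y \<partial>eta m s n) =
        (Q_semi m s p n \<phi> x * I - J * (I * (\<integral>y. \<phi> y \<partial>eta m s n))) / (J * I)"
      using I J by (simp add: field_simps)
    then show ?thesis using I J by (simp add: abs_divide abs_mult)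
  qed
  finally show ?thesis by (simp add: I_def J_def \<theta>_def)
qed

end

definition ratio_forgets :: "'a model \<Rightarrow> ('a \<Rightarrow> real) \<Rightarrow> real \<Rightarrow> real \<Rightarrow> real \<Rightarrow> bool" where
  "ratio_forgets m V a q F \<longleftrightarrow> (\<forall>s p n \<phi>. \<forall>x \<in> space (state m).
     \<phi> \<in> bounded_measurable (state m) \<longrightarrow> p \<le> n \<longrightarrow>
     \<bar>Q_semi m s p n \<phi> x / Q_semi m s p n (\<lambda>_. 1) x - (\<integral>y. \<phi> y \<partial>eta m s n)\<bar>
       \<le> F * q ^ (n - p) * supnorm (state m) \<phi> * exp (a * V x))"

definition D_decays :: "'a model \<Rightarrow> ('a \<Rightarrow> real) \<Rightarrow> real \<Rightarrow> real \<Rightarrow> real \<Rightarrow> bool" where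
  "D_decays m V a q F \<longleftrightarrow> (\<forall>s p n \<phi>. \<forall>x \<in> space (state m).
     \<phi> \<in> bounded_measurable (state m) \<longrightarrow> p \<le> n \<longrightarrow>
     \<bar>D m s p n \<phi> x\<bar> \<le> F * q ^ (n - p) * supnorm (state m) \<phi> * exp (a * V x))"

definition h_dominated :: "'a model \<Rightarrow> ('a \<Rightarrow> real) \<Rightarrow> real \<Rightarrow> real \<Rightarrow> bool" where
  "h_dominated m V a F \<longleftrightarrow> (\<forall>s p n. \<forall>x \<in> space (state m).
     p \<le> n \<longrightarrow> h m s p n x \<le> F * exp (a * V x))"

lemma ratio_forgetsD:
  "ratio_forgets m V a q F \<Longrightarrow> \<phi> \<in> bounded_measurable (state m) \<Longrightarrow> p \<le> n \<Longrightarrow> x \<in> space (state m) \<Longrightarrow>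
    \<bar>Q_semi m s p n \<phi> x / Q_semi m s p n (\<lambda>_. 1) x - (\<integral>y. \<phi> y \<partial>eta m s n)\<bar>
      \<le> F * q ^ (n - p) * supnorm (state m) \<phi> * exp (a * V x)"
  unfolding ratio_forgets_def by blast

lemma D_decaysD:
  "D_decays m V a q F \<Longrightarrow> \<phi> \<in> bounded_measurable (state m) \<Longrightarrow> p \<le> n \<Longrightarrow> x \<in> space (state m) \<Longrightarrow>
    \<bar>D m s p n \<phi> x\<bar> \<le> F * q ^ (n - p) * supnorm (state m) \<phi> * exp (a * V x)"
  unfolding D_decays_def by blast

lemma h_dominatedD:
  "h_dominated m V a F \<Longrightarrow> p \<le> n \<Longrightarrow> x \<in> space (state m) \<Longrightarrow> h m s p n x \<le> F * exp (a * V x)"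
  unfolding h_dominated_def by blast

text \<open>Choice of the constants. The level \<open>r\<close> is taken so high that excursions above it
  are damped faster than the total mass can decay; only then is the exponent, a small multiple
  \<open>\<beta> (n - p)\<close> of the time, chosen so that the factor \<open>2\<^sup>n\<^sup>-\<^sup>p\<close> that it costs is still absorbed.\<close>

theorem forgetting:
  assumes "coherent k"
  obtains q F where "0 < q" "q < 1" "0 \<le> F"
    "\<And>(m :: 'a model) V \<nu>. stable_model k m V \<nu> \<Longrightarrow> ratio_forgets m V 2 q F"
proof -
  obtain R where R: "1 \<le> R" and mom: "\<And>(m :: 'a model) V \<nu>. stable_model k m V \<nu> \<Longrightarrow> uniform_moments k m V R"
    by (rule moments[OF assms, where ?'a = 'a]) (rule that)
  define c where "c = mass_const k"
  define B where "B = drift_const k"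
  have c: "0 < c" unfolding c_def by (rule mass_const_pos[OF assms])
  have B: "1 \<le> B" unfolding B_def by (rule drift_const_ge_1)
  have \<delta>: "0 < delta k" and d1: "1 \<le> d_low k"
    and eps: "\<And>r. d_low k \<le> r \<Longrightarrow> 0 < eps_minus k r \<and> eps_minus k r \<le> eps_plus k r"
    using assms by (auto simp: coherent_def)
  obtain r where r: "d_low k \<le> r" "B\<^sup>2 * exp (- (delta k / 2) * r) \<le> c\<^sup>2 / 4"
    by (rule exp_decay_le[of "delta k / 2" "c\<^sup>2 / 4" "B\<^sup>2" "d_low k"]) (use \<delta> c B in auto)
  define \<kappa> where "\<kappa> = exp (- (delta k / 2) * r)"
  have \<kappa>: "0 < \<kappa>" "\<kappa> < 1" "exp (- delta k * r) \<le> \<kappa>\<^sup>2"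
    using \<delta> d1 r(1) by (auto simp: \<kappa>_def power2_eq_square exp_add[symmetric])
  define \<rho> where "\<rho> = 1 - (eps_minus k r / eps_plus k r)\<^sup>2 / 2"
  have "0 < eps_minus k r / eps_plus k r" "eps_minus k r / eps_plus k r \<le> 1"
    using eps[OF r(1)] by (auto simp: divide_le_eq)
  then have "0 < (eps_minus k r / eps_plus k r)\<^sup>2" "(eps_minus k r / eps_plus k r)\<^sup>2 \<le> 1"
    by (auto simp: power_le_one less_imp_le)
  then have \<rho>: "0 < \<rho>" "\<rho> < 1" "1 - (eps_minus k r / eps_plus k r)\<^sup>2 \<le> \<rho>"
    unfolding \<rho>_def by linarith+
  define \<beta> where "\<beta> = - ln 2 / ln \<kappa>"
  have \<beta>: "0 < \<beta>" using \<kappa> by (simp add: \<beta>_def divide_pos_neg)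
  have \<kappa>\<beta>: "\<kappa> powr (- (\<beta> * real j)) = 2 ^ j" for j
  proof -
    have "ln \<kappa> \<noteq> 0" using \<kappa> by simp
    then have "- (\<beta> * real j) * ln \<kappa> = real j * ln 2" by (simp add: \<beta>_def field_simps)
    then have "\<kappa> powr (- (\<beta> * real j)) = exp (real j * ln 2)" using \<kappa> by (simp add: powr_def)
    then show ?thesis by (simp add: exp_of_nat_mult)
  qed
  have \<rho>\<beta>: "\<rho> powr (\<beta> * real j) = (\<rho> powr \<beta>) ^ j" for j
    using \<rho> by (simp add: powr_powr[symmetric] powr_realpow)
  define q where "q = max (1 / 2) (\<rho> powr \<beta>)"
  have "\<rho> powr \<beta> < 1" using \<rho> \<beta> powr_less_mono2[of \<beta> \<rho> 1] by simp
  then have q: "0 < q" "q < 1" by (auto simp: q_def)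
  define F where "F = 2 * (1 + R\<^sup>2 / \<kappa>)"
  have main: "\<bar>Q_semi m s p n \<phi> x / Q_semi m s p n (\<lambda>_. 1) x - (\<integral>y. \<phi> y \<partial>eta m s n)\<bar>
         \<le> F * q ^ (n - p) * supnorm (state m) \<phi> * exp (2 * V x)"
    if st: "stable_model k m V \<nu>" and \<phi>: "\<phi> \<in> bounded_measurable (state m)"
      and pn: "p \<le> n" and x: "x \<in> space (state m)" for m :: "'a model" and V \<nu> s p n \<phi> x
  proof -
    interpret stable_model k m V \<nu> by fact
    interpret prob_space "eta m s p" by (rule prob_eta)
    let ?one = "Q_semi m s p n (\<lambda>_. 1)" and ?j = "n - p"
    define L where "L = supnorm X \<phi>"
    have L: "0 \<le> L" unfolding L_def by (rule supnorm_nonneg[OF \<phi> space_nonempty])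
    define T where "T = exp (V x) * (\<integral>y. exp (V y) \<partial>eta m s p) / (\<kappa> * (?one x * (\<integral>y. ?one y \<partial>eta m s p)))"
    have low1: "c ^ ?j * exp (- V x) \<le> ?one x"
      unfolding c_def by (rule Q_semi_one_lower(2)[OF pn x])
    have low2: "c ^ ?j / R \<le> (\<integral>y. ?one y \<partial>eta m s p)"
    proof -
      have ind: "indicator (C (level0 k)) \<in> bounded_measurable X"
        by (rule bounded_measurableI[where c = 1]) (auto simp: indicator_def)
      have "c ^ ?j / R \<le> c ^ ?j * prob (C (level0 k))"
        using mult_left_mono[OF uniform_momentsD(3)[OF mom[OF st], of s p], of "c ^ ?j"] c by simp
      also have "\<dots> = (\<integral>y. c ^ ?j * indicator (C (level0 k)) y \<partial>eta m s p)"
        using sets.sets_into_space[OF C_sets, of "level0 k"] by (simp add: Int_absorb2)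
      also have "\<dots> \<le> (\<integral>y. ?one y \<partial>eta m s p)"
      proof (rule integral_mono)
        show "integrable (eta m s p) (\<lambda>y. c ^ ?j * indicator (C (level0 k)) y)"
          by (intro integrable_mult_right integrable_eta[OF ind])
        show "integrable (eta m s p) ?one"
          by (rule integrable_eta[OF Q_semi_bounded[OF bounded_measurable_const pn]])
        show "c ^ ?j * indicator (C (level0 k)) y \<le> ?one y" if "y \<in> space (eta m s p)" for y
          using that Q_semi_one_lower(1)[OF pn, of y s] Q_semi_one_pos[OF pn, of y s]
          by (auto simp: indicator_def c_def less_imp_le)
      qed
      finally show ?thesis .
    qed
    have "(c ^ ?j * exp (- V x)) * (c ^ ?j / R) \<le> ?one x * (\<integral>y. ?one y \<partial>eta m s p)"
      using low1 low2 c R by (intro mult_mono) (auto intro: order_trans[rotated])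
    moreover have cpos: "0 < (c ^ ?j * exp (- V x)) * (c ^ ?j / R)" using c R by simp
    ultimately have "T \<le> exp (V x) * R / (\<kappa> * ((c ^ ?j * exp (- V x)) * (c ^ ?j / R)))"
      unfolding T_def using uniform_momentsD(2)[OF mom[OF st], of s p] R \<kappa>(1) c
      by (intro frac_le mult_left_mono mult_pos_pos) (auto intro: less_le_trans)
    also have "\<dots> = R\<^sup>2 / \<kappa> * exp (2 * V x) * (1 / c\<^sup>2) ^ ?j"
    proof -
      have "exp (2 * V x) = exp (V x) * exp (V x)" by (simp add: exp_add[symmetric])
      moreover have "(c\<^sup>2) ^ ?j = c ^ ?j * c ^ ?j" by (simp add: power2_eq_square power_mult_distrib)
      ultimately show ?thesis
        using c R \<kappa>(1) by (simp add: power_divide exp_minus power2_eq_square field_simps)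
    qed
    finally have T: "T \<le> R\<^sup>2 / \<kappa> * exp (2 * V x) * (1 / c\<^sup>2) ^ ?j" .
    have "\<bar>Q_semi m s p n \<phi> x / ?one x - (\<integral>y. \<phi> y \<partial>eta m s n)\<bar>
        \<le> 2 * L * ((\<rho> powr \<beta>) ^ ?j + 2 ^ ?j * (\<kappa> * B\<^sup>2) ^ ?j * T)"
      using forgetting_bound[OF r(1) \<rho>(1) less_imp_le[OF \<rho>(2)] \<rho>(3) \<kappa>(1) less_imp_le[OF \<kappa>(2)] \<kappa>(3) \<phi>
          abs_le_supnorm[OF \<phi>] L[unfolded L_def] pn x uniform_momentsD(1)[OF mom[OF st]], of s "\<beta> * real ?j"]
      unfolding \<kappa>\<beta> \<rho>\<beta> by (simp add: L_def T_def B_def)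
    also have "\<dots> \<le> 2 * L * (q ^ ?j * exp (2 * V x) + R\<^sup>2 / \<kappa> * exp (2 * V x) * q ^ ?j)"
    proof (intro mult_left_mono add_mono)
      have "(\<rho> powr \<beta>) ^ ?j \<le> q ^ ?j * 1" using \<rho> by (simp add: q_def power_mono)
      also have "\<dots> \<le> q ^ ?j * exp (2 * V x)"
        using q V_ge_1[OF x] by (intro mult_left_mono) auto
      finally show "(\<rho> powr \<beta>) ^ ?j \<le> q ^ ?j * exp (2 * V x)" .
      have "2 ^ ?j * (\<kappa> * B\<^sup>2) ^ ?j * T \<le> 2 ^ ?j * (\<kappa> * B\<^sup>2) ^ ?j * (R\<^sup>2 / \<kappa> * exp (2 * V x) * (1 / c\<^sup>2) ^ ?j)"
        using T \<kappa>(1) by (intro mult_left_mono) auto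
      also have "\<dots> = R\<^sup>2 / \<kappa> * exp (2 * V x) * (2 * (\<kappa> * B\<^sup>2) * (1 / c\<^sup>2)) ^ ?j"
        by (simp only: power_mult_distrib mult_ac)
      also have "\<dots> \<le> R\<^sup>2 / \<kappa> * exp (2 * V x) * q ^ ?j"
      proof (intro mult_left_mono power_mono)
        have "2 * (\<kappa> * B\<^sup>2) * (1 / c\<^sup>2) \<le> 1 / 2"
          using r(2) c unfolding \<kappa>_def[symmetric] by (simp add: field_simps)
        then show "2 * (\<kappa> * B\<^sup>2) * (1 / c\<^sup>2) \<le> q" by (simp add: q_def)
      qed (use \<kappa> in auto)
      finally show "2 ^ ?j * (\<kappa> * B\<^sup>2) ^ ?j * T \<le> R\<^sup>2 / \<kappa> * exp (2 * V x) * q ^ ?j" .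
    qed (use L in auto)
    also have "\<dots> = F * q ^ ?j * L * exp (2 * V x)" by (simp add: F_def algebra_simps)
    finally show ?thesis by (simp add: L_def)
  qed
  show ?thesis
  proof (rule that[of q F])
    show "0 \<le> F" using \<kappa> by (auto simp: F_def)
  qed (use q main in \<open>auto simp: ratio_forgets_def\<close>)
qed

section \<open>Bounds on the normalised semigroups\<close>

lemma sum_geometric_le:
  fixes q :: real
  assumes "0 \<le> q" "q < 1"
  shows "(\<Sum>j<n. q ^ j) \<le> 1 / (1 - q)"
  using sum_le_suminf[OF summable_geometric[of q], of "{..<n}"] suminf_geometric[of q] assms by simp

context stable_model
begin

lemma eta_Q_semi_one_pos:
  assumes "p \<le> n"
  shows "0 < (\<integral>y. Q_semi m s p n (\<lambda>_. 1) y \<partial>eta m s p)"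
  using assms
proof (induction rule: inc_induct)
  case base
  then show ?case using prob_space.prob_space[OF prob_eta, of s n] by simp
next
  case (step p)
  then show ?case using G_integral(3)[of s p] by (simp add: eta_Q_semi_one_step)
qed

lemma h_refl: "h m s n n x = 1"
  using prob_space.prob_space[OF prob_eta, of s n] by (simp add: h_def)

lemma h_nonneg: "p \<le> n \<Longrightarrow> x \<in> space X \<Longrightarrow> 0 \<le> h m s p n x"
  using Q_semi_one_pos eta_Q_semi_one_pos by (auto simp: h_def less_imp_le)

lemma h_bounded:
  assumes "p \<le> n"
  shows "h m s p n \<in> bounded_measurable X"
  using bounded_measurable_cmult[OF Q_semi_bounded[OF bounded_measurable_const assms],
      where a = "1 / (\<integral>z. Q_semi m s p n (\<lambda>_. 1) z \<partial>eta m s p)"]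
  by (simp add: h_def[abs_def])

lemma h_step:
  assumes "p < n"
  shows "h m s p n x = Q m s (Suc p) (h m s (Suc p) n) x / (\<integral>y. G m p y \<partial>eta m s p)"
proof -
  let ?c = "\<integral>z. Q_semi m s (Suc p) n (\<lambda>_. 1) z \<partial>eta m s (Suc p)"
  have "h m s p n x = Q m s (Suc p) (Q_semi m s (Suc p) n (\<lambda>_. 1)) x
      / ((\<integral>y. G m p y \<partial>eta m s p) * ?c)"
    unfolding h_def eta_Q_semi_one_step[OF assms] by (simp only: Q_semi_step[OF assms])
  then show ?thesis
    using Q_cmult[of s p "1 / ?c" "Q_semi m s (Suc p) n (\<lambda>_. 1)" x]
    by (simp add: h_def[abs_def])
qed

lemma D_eq:
  assumes "\<phi> \<in> bounded_measurable X" "p \<le> n" "x \<in> space X"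
  shows "D m s p n \<phi> x = h m s p n x *
    (Q_semi m s p n \<phi> x / Q_semi m s p n (\<lambda>_. 1) x - (\<integral>y. \<phi> y \<partial>eta m s n))"
proof -
  have "Q_semi m s p n (\<lambda>_. 1) x \<noteq> 0" using Q_semi_one_pos[OF assms(2,3), of s] by simp
  then show ?thesis
    unfolding D_def h_def Q_semi_diff_const[OF assms]
    by (simp add: right_diff_distrib diff_divide_distrib mult.commute)
qed

lemma h_Suc:
  assumes pn: "p \<le> n" and x: "x \<in> space X"
  shows "h m s p (Suc n) x = h m s p n x *
    (Q_semi m s p n (G m n) x / Q_semi m s p n (\<lambda>_. 1) x) / (\<integral>y. G m n y \<partial>eta m s n)"
proof -
  have eq: "Q_semi m s p (Suc n) (\<lambda>_. 1) z = Q_semi m s p n (G m n) z" if "z \<in> space X" for z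
    using that pn by (simp add: Q_semi_Suc) (rule Q_semi_cong, auto simp: Q_one)
  have "(\<integral>z. Q_semi m s p (Suc n) (\<lambda>_. 1) z \<partial>eta m s p) = (\<integral>z. Q_semi m s p n (G m n) z \<partial>eta m s p)"
    by (intro Bochner_Integration.integral_cong) (auto simp: eq)
  also have "\<dots> = (\<integral>z. Q_semi m s p n (\<lambda>_. 1) z \<partial>eta m s p) * (\<integral>y. G m n y \<partial>eta m s n)"
    by (rule eta_Q_semi[OF G_bounded_measurable pn])
  finally show ?thesis
    using Q_semi_one_pos[OF pn x, of s] by (simp add: h_def eq[OF x])
qed

text \<open>The increments of \<open>ln h\<^sub>p\<^sub>,\<^sub>n\<close> in \<open>n\<close> compare two filters started from different laws, hence are
  summable by forgetting.\<close>

lemma h_telescope: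
  assumes q: "0 < q" "q < 1" and A: "0 \<le> A" and x: "x \<in> space X" and pn: "p \<le> n"
    and forget: "\<And>n. p \<le> n \<Longrightarrow>
      Q_semi m s p n (G m n) x / Q_semi m s p n (\<lambda>_. 1) x
        \<le> (\<integral>y. G m n y \<partial>eta m s n) * (1 + A * q ^ (n - p))"
  shows "h m s p n x \<le> exp (A / (1 - q))"
proof -
  have "h m s p n x \<le> exp (A * (\<Sum>j<n - p. q ^ j))"
    using pn
  proof (induction rule: dec_induct)
    case base then show ?case by (simp add: h_refl)
  next
    case (step l)
    have "h m s p (Suc l) x = h m s p l x *
        ((Q_semi m s p l (G m l) x / Q_semi m s p l (\<lambda>_. 1) x) / (\<integral>y. G m l y \<partial>eta m s l))"
      using step by (simp add: h_Suc x)
    also have "\<dots> \<le> h m s p l x * (1 + A * q ^ (l - p))"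
    proof (intro mult_left_mono)
      show "Q_semi m s p l (G m l) x / Q_semi m s p l (\<lambda>_. 1) x / (\<integral>y. G m l y \<partial>eta m s l)
          \<le> 1 + A * q ^ (l - p)"
        using forget[OF step(1)] G_integral(3)[of s l] by (subst pos_divide_le_eq) (auto simp: mult.commute)
    qed (rule h_nonneg[OF step(1) x])
    also have "\<dots> \<le> exp (A * (\<Sum>j<l - p. q ^ j)) * exp (A * q ^ (l - p))"
      using step.IH A q h_nonneg[OF _ x, of p l s] step
      by (intro mult_mono exp_ge_add_one_self) auto
    also have "\<dots> = exp (A * (\<Sum>j<Suc l - p. q ^ j))"
      using step by (simp add: Suc_diff_le exp_add[symmetric] distrib_left)
    finally show ?case .
  qed
  also have "\<dots> \<le> exp (A * (1 / (1 - q)))"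
    using A sum_geometric_le[of q "n - p"] q by (simp add: mult_left_mono del: times_divide_eq_right)
  finally show ?thesis by simp
qed

end

text \<open>Telescoping bounds \<open>h\<close> on a sublevel set chosen so high that, above it, the drift outweighs the
  normalisation by \<open>\<eta>\<^sub>p(G\<^sub>p)\<close>. There the bound is propagated backwards in time by
  \<open>h\<^sub>p\<^sub>,\<^sub>n = Q\<^sub>p\<^sub>+\<^sub>1(h\<^sub>p\<^sub>+\<^sub>1\<^sub>,\<^sub>n) / \<eta>\<^sub>p(G\<^sub>p)\<close>. Telescoping alone would give a bound of the order \<open>exp (c v\<^sup>2)\<close>.\<close>

theorem h_bound:
  assumes "coherent k" and \<xi>: "0 < \<xi>" "\<xi> \<le> 1"
  obtains H where "1 \<le> H"
    "\<And>(m :: 'a model) V \<nu>. stable_model k m V \<nu> \<Longrightarrow> h_dominated m V \<xi> H"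
proof -
  obtain R where R: "1 \<le> R" and mom: "\<And>(m :: 'a model) V \<nu>. stable_model k m V \<nu> \<Longrightarrow> uniform_moments k m V R"
    by (rule moments[OF assms(1), where ?'a = 'a]) (rule that)
  obtain q F where q: "0 < q" "q < 1" "0 \<le> F"
    and forget: "\<And>(m :: 'a model) V \<nu>. stable_model k m V \<nu> \<Longrightarrow> ratio_forgets m V 2 q F"
    by (rule forgetting[OF assms(1), where ?'a = 'a]) (rule that)
  define g where "g = mass_const k / R"
  have g: "0 < g" using mass_const_pos[OF assms(1)] R by (simp add: g_def)
  have \<delta>: "0 < delta k" using assms(1) by (simp add: coherent_def)
  obtain r where r: "drift_const k * exp (- (\<xi> * delta k) * r) \<le> g"
    by (rule exp_decay_le[of "\<xi> * delta k" g "drift_const k"]) (use \<delta> \<xi> g drift_const_pos[of k] in auto)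
  define A where "A = F * max 0 (G_sup k) * exp (2 * r) / g"
  have A: "0 \<le> A" using q g by (simp add: A_def)
  define H where "H = exp (A / (1 - q))"
  have H: "1 \<le> H" using A q by (simp add: H_def)
  have main: "h m s p n x \<le> H * exp (\<xi> * V x)"
    if st: "stable_model k m V \<nu>" and pn: "p \<le> n" and x: "x \<in> space (state m)"
    for m :: "'a model" and V \<nu> s p n x
  proof -
    interpret stable_model k m V \<nu> by fact
    have low: "h m s p n x \<le> H * exp (\<xi> * V x)"
      if "V x \<le> r" "p \<le> n" "x \<in> space X" for p x
    proof -
      have "h m s p n x \<le> H"
        unfolding H_def
      proof (rule h_telescope[OF q(1,2) A that(3,2)])
        fix n assume pn: "p \<le> n"
        let ?e = "\<integral>y. G m n y \<partial>eta m s n"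
        have "Q_semi m s p n (G m n) x / Q_semi m s p n (\<lambda>_. 1) x \<le> ?e + F * q ^ (n - p) * supnorm X (G m n) * exp (2 * V x)"
          using ratio_forgetsD[OF forget[OF st] G_bounded_measurable pn that(3), of s n] by linarith
        also have "\<dots> \<le> ?e + F * q ^ (n - p) * max 0 (G_sup k) * exp (2 * r)"
          using that q G_le G_pos
          by (intro add_left_mono mult_mono mult_left_mono supnorm_le[OF space_nonempty])
            (auto simp: abs_of_pos intro!: mult_nonneg_nonneg supnorm_nonneg[OF G_bounded_measurable space_nonempty])
        also have "\<dots> = ?e + g * (A * q ^ (n - p))" using g by (simp add: A_def)
        also have "\<dots> \<le> ?e + ?e * (A * q ^ (n - p))"
          using uniform_momentsD(4)[OF mom[OF st], of s n] A q by (intro add_left_mono mult_right_mono) (auto simp: g_def)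
        finally show "Q_semi m s p n (G m n) x / Q_semi m s p n (\<lambda>_. 1) x \<le> ?e * (1 + A * q ^ (n - p))"
          by (simp add: distrib_left)
      qed
      also have "\<dots> \<le> H * exp (\<xi> * V x)"
        using H \<xi> V_ge_1[OF that(3)] by (simp add: mult_le_cancel_left1)
      finally show ?thesis .
    qed
    show ?thesis using pn x
    proof (induction arbitrary: x rule: inc_induct)
      case base
      have "1 * 1 \<le> H * exp (\<xi> * V x)"
        using H \<xi> V_ge_1[OF base] by (intro mult_mono) auto
      then show ?case by (simp add: h_refl)
    next
      case (step p)
      show ?case
      proof (cases "V x \<le> r")
        case True then show ?thesis using low step by simp
      next
        case False
        have "Q m s (Suc p) (h m s (Suc p) n) x \<le> Q m s (Suc p) (\<lambda>y. H * exp (\<xi> * V y)) x"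
          using step h_bounded[of "Suc p" n s] integrable_exp_V_power[of x \<xi> s p] \<xi>
          by (intro Q_mono integrable_mult_right) (auto intro: integrable_M)
        also have "\<dots> \<le> H * (drift_const k * exp (- \<xi> * delta k * r) * exp (\<xi> * V x))"
          unfolding Q_cmult using drift_bound(2)[of x \<xi> r s p] False step \<xi> H
          by (intro mult_left_mono) auto
        also have "\<dots> \<le> H * (g * exp (\<xi> * V x))"
          using r H by (intro mult_left_mono mult_right_mono) auto
        also have "\<dots> \<le> H * exp (\<xi> * V x) * (\<integral>y. G m p y \<partial>eta m s p)"
          using mult_left_mono[OF uniform_momentsD(4)[OF mom[OF st], of s p], of "H * exp (\<xi> * V x)"] H
          by (simp add: g_def mult_ac)
        finally show ?thesis
          using step G_integral(3)[of s p] by (simp add: h_step pos_divide_le_eq)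
      qed
    qed
  qed
  show ?thesis by (rule that[OF H]) (use main in \<open>auto simp: h_dominated_def\<close>)
qed

text \<open>Interpolating the forgetting bound \<open>q\<^sup>n\<^sup>-\<^sup>p v\<^sup>2\<close> with the trivial bound \<open>2\<close> trades the large
  power of \<open>v\<close> for a slower geometric rate.\<close>

theorem D_bound:
  assumes "coherent k" and \<xi>: "0 < \<xi>" "\<xi> \<le> 1"
  obtains \<rho> A where "0 < \<rho>" "\<rho> < 1" "1 \<le> A"
    "\<And>(m :: 'a model) V \<nu>. stable_model k m V \<nu> \<Longrightarrow>
       ratio_forgets m V \<xi> \<rho> A \<and> D_decays m V \<xi> \<rho> A \<and> h_dominated m V \<xi> A"
proof -
  have \<xi>2: "0 < \<xi> / 2" "\<xi> / 2 \<le> 1" using \<xi> by auto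
  obtain H where H: "1 \<le> H"
    and hb: "\<And>(m :: 'a model) V \<nu>. stable_model k m V \<nu> \<Longrightarrow> h_dominated m V (\<xi> / 2) H"
    by (rule h_bound[OF assms(1) \<xi>2, where ?'a = 'a]) (rule that)
  obtain q F where q: "0 < q" "q < 1" "0 \<le> F"
    and forget: "\<And>(m :: 'a model) V \<nu>. stable_model k m V \<nu> \<Longrightarrow> ratio_forgets m V 2 q F"
    by (rule forgetting[OF assms(1), where ?'a = 'a]) (rule that)
  define \<tau> where "\<tau> = \<xi> / 4"
  have \<tau>: "0 < \<tau>" "\<tau> \<le> 1" using \<xi> by (auto simp: \<tau>_def)
  define \<rho> where "\<rho> = q powr \<tau>"
  have \<rho>: "0 < \<rho>" "\<rho> < 1" using q \<tau> powr_less_mono2[of \<tau> q 1] by (auto simp: \<rho>_def)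
  define E where "E = max 2 F"
  have E: "1 \<le> E" "2 \<le> E" "F \<le> E" by (auto simp: E_def)
  have half: "\<bar>Q_semi m s p n \<phi> x / Q_semi m s p n (\<lambda>_. 1) x - (\<integral>y. \<phi> y \<partial>eta m s n)\<bar>
         \<le> E * \<rho> ^ (n - p) * supnorm (state m) \<phi> * exp (\<xi> / 2 * V x)"
    if st: "stable_model k m V \<nu>" and \<phi>: "\<phi> \<in> bounded_measurable (state m)"
      and pn: "p \<le> n" and x: "x \<in> space (state m)" for m :: "'a model" and V \<nu> s p n \<phi> x
  proof -
    interpret stable_model k m V \<nu> by fact
    define L where "L = supnorm X \<phi>"
    have L: "0 \<le> L" unfolding L_def by (rule supnorm_nonneg[OF \<phi> space_nonempty])
    let ?P = "Q_semi m s p n \<phi> x / Q_semi m s p n (\<lambda>_. 1) x" and ?e = "\<integral>y. \<phi> y \<partial>eta m s n"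
    define u where "u = q ^ (n - p) * exp (2 * V x)"
    have u: "0 < u" using q by (simp add: u_def)
    have utau: "u powr \<tau> = \<rho> ^ (n - p) * exp (\<xi> / 2 * V x)"
    proof -
      have "(q ^ (n - p)) powr \<tau> = \<rho> ^ (n - p)"
        using q by (simp add: \<rho>_def powr_realpow[symmetric] powr_powr mult.commute)
      moreover have "exp (2 * V x) powr \<tau> = exp (\<xi> / 2 * V x)"
        by (simp add: powr_def \<tau>_def algebra_simps)
      ultimately show ?thesis using q by (simp add: u_def powr_mult)
    qed
    have "\<bar>?P - ?e\<bar> \<le> E * L * u powr \<tau>"
    proof (cases "1 \<le> u")
      case True
      interpret prob_space "eta m s n" by (rule prob_eta)
      have eL: "\<bar>?e\<bar> \<le> L"
      proof -
        have "\<bar>?e\<bar> \<le> (\<integral>y. L \<partial>eta m s n)"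
          by (rule integral_abs_bound[THEN order_trans], rule integral_mono)
            (use integrable_eta[OF \<phi>] abs_le_supnorm[OF \<phi>] in \<open>auto simp: L_def\<close>)
        then show ?thesis using prob_space by simp
      qed
      have "\<bar>?P\<bar> \<le> L" unfolding L_def by (rule ratio_le_supnorm[OF \<phi> pn x])
      then have "\<bar>?P - ?e\<bar> \<le> 2 * L * 1" using eL by linarith
      also have "\<dots> \<le> E * L * u powr \<tau>"
        using True \<tau> E L by (intro mult_mono) (auto simp: ge_one_powr_ge_zero)
      finally show ?thesis .
    next
      case False
      have "\<bar>?P - ?e\<bar> \<le> F * L * u"
        using ratio_forgetsD[OF forget[OF st] \<phi> pn x, of s] by (simp add: L_def u_def mult_ac)
      also have "\<dots> \<le> E * L * u powr \<tau>"
      proof (intro mult_mono)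
        show "u \<le> u powr \<tau>" using False u \<tau> powr_mono'[of \<tau> 1 u] by simp
      qed (use E L u q in auto)
      finally show ?thesis .
    qed
    then show ?thesis unfolding utau by (simp add: L_def mult_ac)
  qed
  define A where "A = E * H"
  have A: "1 \<le> A" using E H mult_mono[of 1 E 1 H] by (simp add: A_def)
  have EA: "E \<le> A" "H \<le> A" using E H by (auto simp: A_def mult_le_cancel_left1 mult_le_cancel_right1)
  show ?thesis
  proof (rule that[OF \<rho> A])
    fix m :: "'a model" and V \<nu>
    assume st: "stable_model k m V \<nu>"
    interpret stable_model k m V \<nu> by fact
    have both: "\<bar>Q_semi m s p n \<phi> x / Q_semi m s p n (\<lambda>_. 1) x - (\<integral>y. \<phi> y \<partial>eta m s n)\<bar>
        \<le> A * \<rho> ^ (n - p) * supnorm (state m) \<phi> * exp (\<xi> * V x)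
      \<and> \<bar>D m s p n \<phi> x\<bar> \<le> A * \<rho> ^ (n - p) * supnorm (state m) \<phi> * exp (\<xi> * V x)"
      if \<phi>: "\<phi> \<in> bounded_measurable (state m)" and pn: "p \<le> n" and x: "x \<in> space (state m)"
      for s p n \<phi> x
    proof
      let ?L = "supnorm (state m) \<phi>"
      have L: "0 \<le> ?L" by (rule supnorm_nonneg[OF \<phi> space_nonempty])
      have le: "exp (\<xi> / 2 * V x) \<le> exp (\<xi> * V x)" using \<xi> V_ge_1[OF x] by simp
      let ?d = "Q_semi m s p n \<phi> x / Q_semi m s p n (\<lambda>_. 1) x - (\<integral>y. \<phi> y \<partial>eta m s n)"
      note * = half[OF st \<phi> pn x, of s]
      also have "E * \<rho> ^ (n - p) * ?L * exp (\<xi> / 2 * V x) \<le> A * \<rho> ^ (n - p) * ?L * exp (\<xi> * V x)"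
        using EA E L \<rho> le by (intro mult_mono) (auto intro!: mult_nonneg_nonneg)
      finally show "\<bar>?d\<bar> \<le> A * \<rho> ^ (n - p) * ?L * exp (\<xi> * V x)" .
      have "D m s p n \<phi> x = h m s p n x * ?d"
        by (rule D_eq[OF \<phi> pn x])
      then have "\<bar>D m s p n \<phi> x\<bar> = h m s p n x * \<bar>?d\<bar>"
        using h_nonneg[OF pn x, of s] by (simp add: abs_mult)
      also have "\<dots> \<le> (H * exp (\<xi> / 2 * V x)) * (E * \<rho> ^ (n - p) * ?L * exp (\<xi> / 2 * V x))"
        using h_dominatedD[OF hb[OF st] pn x, of s] * H by (intro mult_mono) auto
      also have "\<dots> = A * \<rho> ^ (n - p) * ?L * (exp (\<xi> / 2 * V x) * exp (\<xi> / 2 * V x))"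
        by (simp add: A_def mult_ac)
      also have "\<dots> = A * \<rho> ^ (n - p) * ?L * exp (\<xi> * V x)"
        by (simp add: exp_add[symmetric] field_simps)
      finally show "\<bar>D m s p n \<phi> x\<bar> \<le> A * \<rho> ^ (n - p) * ?L * exp (\<xi> * V x)" .
    qed
    have "h m s p n x \<le> A * exp (\<xi> * V x)" if pn: "p \<le> n" and x: "x \<in> space (state m)" for s p n x
    proof -
      have "h m s p n x \<le> H * exp (\<xi> / 2 * V x)" by (rule h_dominatedD[OF hb[OF st] pn x])
      also have "\<dots> \<le> A * exp (\<xi> * V x)"
        using EA H \<xi> V_ge_1[OF x] by (intro mult_mono) auto
      finally show ?thesis .
    qed
    with both show "ratio_forgets m V \<xi> \<rho> A \<and> D_decays m V \<xi> \<rho> A \<and> h_dominated m V \<xi> A"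
      unfolding ratio_forgets_def D_decays_def h_dominated_def by blast
  qed
qed

section \<open>The coupled flows have the right marginals\<close>

lemma meas2_eqI:
  assumes "sets P = sets (state2 m)" "\<And>B. B \<in> sets (state2 m) \<Longrightarrow> f B = emeasure P B"
  shows "meas2 m f = P"
proof -
  have "meas2 m f = measure_of (space P) (sets P) (emeasure P)"
    unfolding assms(1) sets_eq_imp_space_eq[OF assms(1)]
    by (rule measure_of_eq) (auto simp: sets.space_closed assms(2) sets.sigma_sets_eq)
  then show ?thesis by (simp add: measure_of_of_measure)
qed

definition add_measure :: "'a measure \<Rightarrow> 'a measure \<Rightarrow> 'a measure" where
  "add_measure P R = measure_of (space P) (sets P) (\<lambda>B. emeasure P B + emeasure R B)"

lemma sets_add_measure [simp]: "sets (add_measure P R) = sets P"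
  by (simp add: add_measure_def)

lemma emeasure_add_measure:
  assumes "sets R = sets P" "B \<in> sets P"
  shows "emeasure (add_measure P R) B = emeasure P B + emeasure R B"
  unfolding add_measure_def
proof (rule emeasure_measure_of)
  show "sets P \<subseteq> Pow (space P)" by (rule sets.space_closed)
  show "positive (sets (measure_of (space P) (sets P) (\<lambda>B. emeasure P B + emeasure R B)))
     (\<lambda>B. emeasure P B + emeasure R B)"
    by (simp add: positive_def)
  show "countably_additive (sets (measure_of (space P) (sets P) (\<lambda>B. emeasure P B + emeasure R B)))
     (\<lambda>B. emeasure P B + emeasure R B)"
    unfolding countably_additive_def
    by (auto simp: assms(1) suminf_add[symmetric] suminf_emeasure)
qed (use assms in auto)

lemma is_couplingI:
  assumes sets: "sets P = sets (X \<Otimes>\<^sub>M X)" "sets \<mu> = sets X" "sets \<nu> = sets X" and prob: "prob_space \<mu>"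
    and fst: "\<And>A. A \<in> sets X \<Longrightarrow> emeasure P (A \<times> space X) = emeasure \<mu> A"
    and snd: "\<And>A. A \<in> sets X \<Longrightarrow> emeasure P (space X \<times> A) = emeasure \<nu> A"
  shows "is_coupling X P \<mu> \<nu>"
proof -
  note [measurable_cong] = sets(1)
  have spP: "space P = space X \<times> space X"
    using sets_eq_imp_space_eq[OF sets(1)] by (simp add: space_pair_measure)
  have sp: "space \<mu> = space X" "space \<nu> = space X"
    using sets sets_eq_imp_space_eq by blast+
  have "prob_space P"
  proof
    show "emeasure P (space P) = 1"
      using fst[of "space X"] prob_space.emeasure_space_1[OF prob] sp by (simp add: spP)
  qed
  moreover have "distr P X fst = \<mu>"
  proof (rule measure_eqI)
    fix A assume "A \<in> sets (distr P X fst)"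
    then have A: "A \<in> sets X" by simp
    have "fst -` A \<inter> space P = A \<times> space X"
      using sets.sets_into_space[OF A] by (auto simp: spP)
    then show "emeasure (distr P X fst) A = emeasure \<mu> A"
      using A by (simp add: emeasure_distr fst)
  qed (simp add: sets)
  moreover have "distr P X snd = \<nu>"
  proof (rule measure_eqI)
    fix A assume "A \<in> sets (distr P X snd)"
    then have A: "A \<in> sets X" by simp
    have "snd -` A \<inter> space P = space X \<times> A"
      using sets.sets_into_space[OF A] by (auto simp: spP)
    then show "emeasure (distr P X snd) A = emeasure \<nu> A"
      using A by (simp add: emeasure_distr snd)
  qed (simp add: sets)
  ultimately show ?thesis
    using sets(1) by (simp add: is_coupling_def space_prob_algebra)
qed

lemma is_couplingD:
  assumes "is_coupling X P \<mu> \<nu>"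
  shows "sets P = sets (X \<Otimes>\<^sub>M X)" "prob_space P" "space P = space X \<times> space X"
    and "A \<in> sets X \<Longrightarrow> emeasure P (A \<times> space X) = emeasure \<mu> A"
    and "A \<in> sets X \<Longrightarrow> emeasure P (space X \<times> A) = emeasure \<nu> A"
    and "f \<in> borel_measurable X \<Longrightarrow> (\<integral>\<^sup>+z. f (fst z) \<partial>P) = (\<integral>\<^sup>+x. f x \<partial>\<mu>)"
    and "f \<in> borel_measurable X \<Longrightarrow> (\<integral>\<^sup>+z. f (snd z) \<partial>P) = (\<integral>\<^sup>+x. f x \<partial>\<nu>)"
proof -
  show sets: "sets P = sets (X \<Otimes>\<^sub>M X)" and "prob_space P"
    using assms by (auto simp: is_coupling_def space_prob_algebra)
  note [measurable_cong] = sets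
  show spP: "space P = space X \<times> space X"
    using sets_eq_imp_space_eq[OF sets] by (simp add: space_pair_measure)
  have m: "distr P X fst = \<mu>" "distr P X snd = \<nu>" using assms by (auto simp: is_coupling_def)
  have "fst -` A \<inter> space P = A \<times> space X" "snd -` A \<inter> space P = space X \<times> A" if "A \<in> sets X"
    using sets.sets_into_space[OF that] by (auto simp: spP)
  then show "A \<in> sets X \<Longrightarrow> emeasure P (A \<times> space X) = emeasure \<mu> A"
    "A \<in> sets X \<Longrightarrow> emeasure P (space X \<times> A) = emeasure \<nu> A"
    by (auto simp: m[symmetric] emeasure_distr)
  show "f \<in> borel_measurable X \<Longrightarrow> (\<integral>\<^sup>+z. f (fst z) \<partial>P) = (\<integral>\<^sup>+x. f x \<partial>\<mu>)"
    "f \<in> borel_measurable X \<Longrightarrow> (\<integral>\<^sup>+z. f (snd z) \<partial>P) = (\<integral>\<^sup>+x. f x \<partial>\<nu>)"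
    by (auto simp: m[symmetric] nn_integral_distr)
qed

lemma is_coupling_fst_snd:
  assumes "is_coupling X P \<mu> \<nu>"
  shows "distr P X fst = \<mu>" "distr P X snd = \<nu>"
  using assms by (auto simp: is_coupling_def)

text \<open>Splitting off a common part \<open>m\<close> of total mass \<open>a\<close> from a probability density \<open>F\<close> and
  putting the normalised remainder back with weight \<open>1 - a\<close> recovers \<open>F\<close>. Each marginal of the
  mixture in the scheme \<open>M\<close> has this form.\<close>

lemma nn_integral_recombine:
  fixes F m :: "'a \<Rightarrow> real"
  assumes "integrable \<mu> F" "integrable \<mu> m" and F: "(\<integral>x. F x \<partial>\<mu>) = 1" and a: "(\<integral>x. m x \<partial>\<mu>) = a"
    and m: "\<And>x. x \<in> space \<mu> \<Longrightarrow> 0 \<le> m x" "\<And>x. x \<in> space \<mu> \<Longrightarrow> m x \<le> F x"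
    and [measurable]: "u \<in> borel_measurable \<mu>"
  shows "(\<integral>\<^sup>+x. ennreal (m x) * u x \<partial>\<mu>) +
      (if a = 1 then 0 else ennreal (1 - a) * (\<integral>\<^sup>+x. ennreal ((F x - m x) / (\<integral>x. F x - m x \<partial>\<mu>)) * u x \<partial>\<mu>))
    = (\<integral>\<^sup>+x. ennreal (F x) * u x \<partial>\<mu>)"
proof -
  note [measurable] = borel_measurable_integrable[OF assms(1)] borel_measurable_integrable[OF assms(2)]
  have diff: "(\<integral>x. F x - m x \<partial>\<mu>) = 1 - a" using assms by simp
  have int: "integrable \<mu> (\<lambda>x. F x - m x)" using assms by simp
  have nonneg: "0 \<le> 1 - a"
    unfolding diff[symmetric] by (intro integral_nonneg_AE AE_I2) (simp add: m)
  show ?thesis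
  proof (cases "a = 1")
    case True
    then have "(\<integral>x. F x - m x \<partial>\<mu>) = 0" using diff by simp
    then have "AE x in \<mu>. F x - m x = 0"
      by (subst (asm) integral_nonneg_eq_0_iff_AE[OF int]) (auto simp: m)
    then have "(\<integral>\<^sup>+x. ennreal (m x) * u x \<partial>\<mu>) = (\<integral>\<^sup>+x. ennreal (F x) * u x \<partial>\<mu>)"
      by (intro nn_integral_cong_AE) auto
    then show ?thesis using True by simp
  next
    case False
    then have pos: "0 < 1 - a" using nonneg by simp
    have "ennreal (1 - a) * (\<integral>\<^sup>+x. ennreal ((F x - m x) / (1 - a)) * u x \<partial>\<mu>) =
        (\<integral>\<^sup>+x. ennreal (1 - a) * (ennreal ((F x - m x) / (1 - a)) * u x) \<partial>\<mu>)"
      by (rule nn_integral_cmult[symmetric]) measurable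
    also have "\<dots> = (\<integral>\<^sup>+x. ennreal (F x - m x) * u x \<partial>\<mu>)"
    proof (intro nn_integral_cong)
      fix x assume "x \<in> space \<mu>"
      then have "ennreal (1 - a) * ennreal ((F x - m x) / (1 - a)) = ennreal (F x - m x)"
        using pos m(2) by (simp add: ennreal_mult[symmetric])
      then show "ennreal (1 - a) * (ennreal ((F x - m x) / (1 - a)) * u x) = ennreal (F x - m x) * u x"
        by (simp only: mult.assoc[symmetric])
    qed
    finally have "(\<integral>\<^sup>+x. ennreal (m x) * u x \<partial>\<mu>) +
        ennreal (1 - a) * (\<integral>\<^sup>+x. ennreal ((F x - m x) / (1 - a)) * u x \<partial>\<mu>) =
        (\<integral>\<^sup>+x. ennreal (m x) * u x + ennreal (F x - m x) * u x \<partial>\<mu>)"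
      by (simp add: nn_integral_add)
    also have "\<dots> = (\<integral>\<^sup>+x. ennreal (F x) * u x \<partial>\<mu>)"
    proof (intro nn_integral_cong)
      fix x assume "x \<in> space \<mu>"
      then have "ennreal (m x) + ennreal (F x - m x) = ennreal (F x)"
        using m by (simp add: ennreal_plus[symmetric] del: ennreal_plus)
      then show "ennreal (m x) * u x + ennreal (F x - m x) * u x = ennreal (F x) * u x"
        by (simp only: distrib_right[symmetric])
    qed
    finally show ?thesis using False by (simp add: diff)
  qed
qed

context feynman_kac
begin

lemma cM_measurable [measurable]: "cM m (Suc n) \<in> state2 m \<rightarrow>\<^sub>M prob_algebra (state2 m)"
  using valid by (auto simp: valid_model_def)

lemma cM_measurable_subprob [measurable]: "cM m (Suc n) \<in> state2 m \<rightarrow>\<^sub>M subprob_algebra (state2 m)"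
  by (intro measurable_prob_algebraD cM_measurable)

lemma cM_coupling:
  "z \<in> space (state2 m) \<Longrightarrow>
    is_coupling X (cM m (Suc n) z) (M m Fine (Suc n) (fst z)) (M m Coarse (Suc n) (snd z))"
  using valid by (auto simp: valid_model_def space_pair_measure)

text \<open>The schemes \<open>I\<close> and \<open>W\<close> only differ in how they couple the reweighted laws before the pair kernel is
  applied.\<close>

lemma coupling_bind:
  assumes N: "is_coupling X N (eta_bar m Fine n) (eta_bar m Coarse n)"
  shows "is_coupling X (N \<bind> cM m (Suc n)) (eta m Fine (Suc n)) (eta m Coarse (Suc n))"
proof -
  note [measurable_cong] = is_couplingD(1)[OF N]
  have spN: "space N = space (state2 m)"
    using is_couplingD(3)[OF N] by (simp add: space_pair_measure)
  have ne: "space N \<noteq> {}" using is_couplingD(3)[OF N] space_nonempty by auto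
  have K: "cM m (Suc n) \<in> N \<rightarrow>\<^sub>M subprob_algebra (state2 m)" by measurable
  have "N \<bind> cM m (Suc n) \<in> space (prob_algebra (state2 m))"
    using measurable_space[OF measurable_bind_prob_space[OF measurable_ident cM_measurable], of N n]
      is_couplingD(1,2)[OF N] by (simp add: space_prob_algebra id_def)
  moreover have "distr (N \<bind> cM m (Suc n)) X fst = eta m Fine (Suc n)"
  proof -
    have "distr (N \<bind> cM m (Suc n)) X fst = N \<bind> (\<lambda>z. distr (cM m (Suc n) z) X fst)"
      by (rule distr_bind[OF K ne]) measurable
    also have "\<dots> = N \<bind> (\<lambda>z. M m Fine (Suc n) (fst z))"
      by (intro bind_cong refl is_coupling_fst_snd(1)[OF cM_coupling]) (simp add: spN)
    also have "\<dots> = distr N X fst \<bind> M m Fine (Suc n)"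
      by (rule bind_distr[symmetric, OF _ M_measurable_subprob ne]) measurable
    finally show ?thesis by (simp add: is_coupling_fst_snd[OF N] eta_Suc)
  qed
  moreover have "distr (N \<bind> cM m (Suc n)) X snd = eta m Coarse (Suc n)"
  proof -
    have "distr (N \<bind> cM m (Suc n)) X snd = N \<bind> (\<lambda>z. distr (cM m (Suc n) z) X snd)"
      by (rule distr_bind[OF K ne]) measurable
    also have "\<dots> = N \<bind> (\<lambda>z. M m Coarse (Suc n) (snd z))"
      by (intro bind_cong refl is_coupling_fst_snd(2)[OF cM_coupling]) (simp add: spN)
    also have "\<dots> = distr N X snd \<bind> M m Coarse (Suc n)"
      by (rule bind_distr[symmetric, OF _ M_measurable_subprob ne]) measurable
    finally show ?thesis by (simp add: is_coupling_fst_snd[OF N] eta_Suc)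
  qed
  ultimately show ?thesis by (simp add: is_coupling_def)
qed

lemma coupling_bind_meas2:
  assumes N: "is_coupling X N (eta_bar m Fine n) (eta_bar m Coarse n)"
    and f: "\<And>B. B \<in> sets (state2 m) \<Longrightarrow> f B = (\<integral>\<^sup>+z. emeasure (cM m (Suc n) z) B \<partial>N)"
  shows "is_coupling X (meas2 m f) (eta m Fine (Suc n)) (eta m Coarse (Suc n))"
proof -
  note [measurable_cong] = is_couplingD(1)[OF N]
  have ne: "space N \<noteq> {}" using is_couplingD(3)[OF N] space_nonempty by auto
  have "meas2 m f = N \<bind> cM m (Suc n)"
  proof (rule meas2_eqI)
    show "sets (N \<bind> cM m (Suc n)) = sets (state2 m)"
      using is_couplingD(1)[OF coupling_bind[OF N]] .
    show "f B = emeasure (N \<bind> cM m (Suc n)) B" if "B \<in> sets (state2 m)" for B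
      unfolding f[OF that] by (rule emeasure_bind[symmetric, OF ne _ that]) measurable
  qed
  then show ?thesis using coupling_bind[OF N] by simp
qed

lemma ceta0_coupling: "is_coupling X (ceta0 m) (eta m Fine 0) (eta m Coarse 0)"
  using valid by (simp add: valid_model_def eta_0)

lemma emeasure_cM_measurable [measurable]:
  "B \<in> sets (state2 m) \<Longrightarrow> (\<lambda>z. emeasure (cM m (Suc n) z) B) \<in> borel_measurable (state2 m)"
  by (rule measurable_compose[OF cM_measurable_subprob measurable_emeasure_subprob_algebra])

text \<open>Normalising the product of the two flows by \<open>G \<otimes> G\<close> gives the product of the reweighted laws.\<close>

lemma coupling_I_coupling: "is_coupling X (coupling_I m n) (eta m Fine n) (eta m Coarse n)"
proof (cases n)
  case 0 then show ?thesis using ceta0_coupling by simp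
next
  case (Suc n)
  interpret f: prob_space "eta_bar m Fine n" by (rule prob_eta_bar)
  interpret c: prob_space "eta_bar m Coarse n" by (rule prob_eta_bar)
  interpret f': prob_space "eta m Fine n" by (rule prob_eta)
  interpret c': prob_space "eta m Coarse n" by (rule prob_eta)
  let ?N = "eta_bar m Fine n \<Otimes>\<^sub>M eta_bar m Coarse n"
  let ?P = "eta m Fine n \<Otimes>\<^sub>M eta m Coarse n"
  define zf where "zf = (\<integral>y. G m n y \<partial>eta m Fine n)"
  define zc where "zc = (\<integral>y. G m n y \<partial>eta m Coarse n)"
  have z: "0 < zf" "0 < zc" unfolding zf_def zc_def by (rule G_integral(3))+
  let ?GG = "\<lambda>z. ennreal (G m n (fst z) * G m n (snd z))"
  have N: "is_coupling X ?N (eta_bar m Fine n) (eta_bar m Coarse n)"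
  proof (rule is_couplingI)
    show "sets ?N = sets (X \<Otimes>\<^sub>M X)" by (rule sets_pair_measure_cong) simp_all
    show "emeasure ?N (A \<times> space X) = emeasure (eta_bar m Fine n) A" if "A \<in> sets X" for A
      using that c.emeasure_space_1 by (subst c.emeasure_pair_measure_Times) simp_all
    show "emeasure ?N (space X \<times> A) = emeasure (eta_bar m Coarse n) A" if "A \<in> sets X" for A
      using that f.emeasure_space_1 by (subst c.emeasure_pair_measure_Times) simp_all
  qed (simp_all add: prob_eta_bar)
  have dens: "?N = density ?P (\<lambda>(x, y). ennreal (G m n x / zf) * ennreal (G m n y / zc))"
    unfolding eta_bar_def zf_def[symmetric] zc_def[symmetric]
  proof (rule pair_measure_density)
    have "density (eta m Coarse n) (\<lambda>x. ennreal (G m n x / zc)) = eta_bar m Coarse n"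
      by (simp add: eta_bar_def zc_def)
    then show "sigma_finite_measure (density (eta m Coarse n) (\<lambda>x. ennreal (G m n x / zc)))"
      by (simp add: c.sigma_finite_measure_axioms)
  qed (simp_all add: c'.sigma_finite_measure_axioms)
  have dens': "ennreal (G m n (fst z) / zf) * ennreal (G m n (snd z) / zc) = ?GG z / ennreal (zf * zc)"
    if "z \<in> space (state2 m)" for z
    using that z G_pos by (auto simp: space_pair_measure divide_ennreal ennreal_mult[symmetric] less_imp_le)
  have spP: "space ?P = space (state2 m)" by (simp add: space_pair_measure)
  have formula: "(\<integral>\<^sup>+z. u z \<partial>?N) = (\<integral>\<^sup>+z. ?GG z * u z \<partial>?P) / ennreal (zf * zc)"
    if [measurable]: "u \<in> borel_measurable (state2 m)" for u
  proof -
    have [measurable_cong]: "sets ?P = sets (state2 m)" by (rule sets_pair_measure_cong) simp_all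
    have "(\<integral>\<^sup>+z. u z \<partial>?N) = (\<integral>\<^sup>+z. ?GG z * u z / ennreal (zf * zc) \<partial>?P)"
    proof -
      have "(\<integral>\<^sup>+z. u z \<partial>?N) = (\<integral>\<^sup>+z. (ennreal (G m n (fst z) / zf) * ennreal (G m n (snd z) / zc)) * u z \<partial>?P)"
        unfolding dens by (subst nn_integral_density) (auto simp: split_beta)
      also have "\<dots> = (\<integral>\<^sup>+z. ?GG z * u z / ennreal (zf * zc) \<partial>?P)"
        by (intro nn_integral_cong) (simp only: dens' spP divide_ennreal_def mult_ac)
      finally show ?thesis .
    qed
    also have "\<dots> = (\<integral>\<^sup>+z. ?GG z * u z \<partial>?P) / ennreal (zf * zc)"
      by (rule nn_integral_divide) measurable
    finally show ?thesis .
  qed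
  have one: "(\<integral>\<^sup>+z. ?GG z \<partial>?P) = ennreal (zf * zc)"
  proof -
    interpret N: prob_space ?N using is_couplingD(2)[OF N] .
    have "1 = (\<integral>\<^sup>+z. 1 \<partial>?N)" using N.emeasure_space_1 by simp
    also have "\<dots> = (\<integral>\<^sup>+z. ?GG z \<partial>?P) / ennreal (zf * zc)" using formula[of "\<lambda>_. 1"] by simp
    finally have "ennreal (zf * zc) * 1 = ennreal (zf * zc) * ((\<integral>\<^sup>+z. ?GG z \<partial>?P) / ennreal (zf * zc))"
      by simp
    also have "\<dots> = (\<integral>\<^sup>+z. ?GG z \<partial>?P)"
      using z by (simp add: ennreal_times_divide mult.commute[of "ennreal (zf * zc)"] mult_divide_eq_ennreal)
    finally show ?thesis by simp
  qed
  show ?thesis unfolding Suc coupling_I.simps Let_def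
    by (rule coupling_bind_meas2[OF N]) (simp add: formula one)
qed

lemma emeasure_M_measurable:
  "A \<in> sets X \<Longrightarrow> (\<lambda>x. emeasure (M m s (Suc n) x) A) \<in> borel_measurable X"
  by (rule measurable_compose[OF M_measurable_subprob measurable_emeasure_subprob_algebra])

lemma emeasure_eta_Suc:
  assumes A: "A \<in> sets X"
  shows "(\<integral>\<^sup>+x. ennreal (G m n x / (\<integral>x. G m n x \<partial>eta m s n)) * emeasure (M m s (Suc n) x) A \<partial>eta m s n)
    = emeasure (eta m s (Suc n)) A"
proof -
  note [measurable] = emeasure_M_measurable[OF A]
  have "emeasure (eta m s (Suc n)) A = (\<integral>\<^sup>+x. emeasure (M m s (Suc n) x) A \<partial>eta_bar m s n)"
    unfolding eta_Suc using space_nonempty A by (subst emeasure_bind[where N = X]) auto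
  also have "\<dots> = (\<integral>\<^sup>+x. ennreal (G m n x / (\<integral>x. G m n x \<partial>eta m s n)) * emeasure (M m s (Suc n) x) A \<partial>eta m s n)"
    unfolding eta_bar_def by (subst nn_integral_density) auto
  finally show ?thesis by simp
qed

text \<open>If the mass of the common part is one, the remainders vanish almost everywhere, so the case
  distinction in the definition does not affect the marginals.\<close>

lemma coupling_M_coupling: "is_coupling X (coupling_M m n) (eta m Fine n) (eta m Coarse n)"
proof (induction n)
  case 0 then show ?case using ceta0_coupling by simp
next
  case (Suc n)
  define \<mu> where "\<mu> = coupling_M m n"
  have \<mu>: "is_coupling X \<mu> (eta m Fine n) (eta m Coarse n)" using Suc by (simp add: \<mu>_def)
  note sets\<mu> [measurable_cong] = is_couplingD(1)[OF \<mu>]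
  interpret prob_space \<mu> by (rule is_couplingD(2)[OF \<mu>])
  interpret P: pair_prob_space \<mu> \<mu> ..
  have sp\<mu>: "space \<mu> = space (state2 m)" using is_couplingD(3)[OF \<mu>] by (simp add: space_pair_measure)
  define zf where "zf = (\<integral>z. G m n (fst z) \<partial>\<mu>)"
  define zc where "zc = (\<integral>z. G m n (snd z) \<partial>\<mu>)"
  have intG: "integrable \<mu> (\<lambda>z. G m n (fst z))" "integrable \<mu> (\<lambda>z. G m n (snd z))"
  proof -
    obtain c where c: "\<forall>x\<in>space X. G m n x \<le> c" using G_bounded by blast
    show "integrable \<mu> (\<lambda>z. G m n (fst z))" "integrable \<mu> (\<lambda>z. G m n (snd z))"
      by (rule integrable_const_bound[where B = c];
          use c G_pos in \<open>auto intro!: AE_I2 simp: abs_of_pos sp\<mu> space_pair_measure\<close>)+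
  qed
  have zeq: "zf = (\<integral>x. G m n x \<partial>eta m Fine n)" "zc = (\<integral>x. G m n x \<partial>eta m Coarse n)"
    unfolding zf_def zc_def is_coupling_fst_snd[OF \<mu>, symmetric]
    by (subst integral_distr; simp)+
  have z: "0 < zf" "0 < zc" unfolding zeq by (rule G_integral(3))+
  define Ff where "Ff z = G m n (fst z) / zf" for z :: "'a \<times> 'a"
  define Fc where "Fc z = G m n (snd z) / zc" for z :: "'a \<times> 'a"
  define Fm where "Fm z = min (Ff z) (Fc z)" for z
  define a where "a = (\<integral>z. Fm z \<partial>\<mu>)"
  define Rf where "Rf z = (Ff z - Fm z) / (\<integral>z. Ff z - Fm z \<partial>\<mu>)" for z
  define Rc where "Rc z = (Fc z - Fm z) / (\<integral>z. Fc z - Fm z \<partial>\<mu>)" for z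
  have intF: "integrable \<mu> Ff" "integrable \<mu> Fc" "integrable \<mu> Fm"
    unfolding Ff_def Fc_def Fm_def using intG by auto
  have [measurable]: "Ff \<in> borel_measurable (state2 m)" "Fc \<in> borel_measurable (state2 m)"
    unfolding Ff_def Fc_def by measurable
  then have [measurable]: "Fm \<in> borel_measurable (state2 m)" unfolding Fm_def by measurable
  have [measurable]: "Rf \<in> borel_measurable (state2 m)" "Rc \<in> borel_measurable (state2 m)"
    unfolding Rf_def Rc_def by measurable
  have F1: "(\<integral>z. Ff z \<partial>\<mu>) = 1" "(\<integral>z. Fc z \<partial>\<mu>) = 1"
    unfolding Ff_def Fc_def using z by (simp_all add: zf_def[symmetric] zc_def[symmetric])
  have Fm0: "0 \<le> Fm z" "Fm z \<le> Ff z" "Fm z \<le> Fc z" if "z \<in> space \<mu>" for z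
    using that G_pos z unfolding Fm_def Ff_def Fc_def sp\<mu> space_pair_measure by (auto simp: less_imp_le)
  have R0: "0 \<le> Rf z" "0 \<le> Rc z" if "z \<in> space \<mu>" for z
    unfolding Rf_def Rc_def using Fm0 that
    by (auto intro!: divide_nonneg_nonneg integral_nonneg_AE AE_I2)
  have R1: "(\<integral>\<^sup>+z. ennreal (Rf z) \<partial>\<mu>) = 1" "(\<integral>\<^sup>+z. ennreal (Rc z) \<partial>\<mu>) = 1" if "a \<noteq> 1"
  proof -
    have d: "(\<integral>z. Ff z - Fm z \<partial>\<mu>) = 1 - a" "(\<integral>z. Fc z - Fm z \<partial>\<mu>) = 1 - a"
      using intF F1 by (simp_all add: a_def)
    have eq: "Rf = (\<lambda>z. (Ff z - Fm z) / (1 - a))" "Rc = (\<lambda>z. (Fc z - Fm z) / (1 - a))"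
      by (simp_all add: Rf_def[abs_def] Rc_def[abs_def] d[simplified])
    have i: "integrable \<mu> Rf" "integrable \<mu> Rc" unfolding eq using intF by auto
    have "(\<integral>z. Rf z \<partial>\<mu>) = 1" "(\<integral>z. Rc z \<partial>\<mu>) = 1"
      unfolding eq using d that by simp_all
    then show "(\<integral>\<^sup>+z. ennreal (Rf z) \<partial>\<mu>) = 1" "(\<integral>\<^sup>+z. ennreal (Rc z) \<partial>\<mu>) = 1"
      using R0 by (simp_all add: nn_integral_eq_integral[OF i(1)] nn_integral_eq_integral[OF i(2)] AE_I2)
  qed
  define K where "K = cM m (Suc n)"
  have K [measurable]: "K \<in> state2 m \<rightarrow>\<^sub>M subprob_algebra (state2 m)" unfolding K_def by measurable
  have KB [measurable]: "(\<lambda>z. emeasure (K z) B) \<in> borel_measurable (state2 m)" if "B \<in> sets (state2 m)" for B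
    unfolding K_def using that by measurable
  define f where "f B = (\<integral>\<^sup>+z. ennreal (Fm z) * emeasure (K z) B \<partial>\<mu>) +
       (if a = 1 then 0 else ennreal (1 - a) *
          (\<integral>\<^sup>+((x, y), (u, w)). ennreal (Rf (x, y) * Rc (u, w)) * emeasure (K (x, w)) B \<partial>(\<mu> \<Otimes>\<^sub>M \<mu>)))" for B
  have step: "coupling_M m (Suc n) = meas2 m f"
    by (simp only: coupling_M.simps f_def[abs_def] Let_def K_def a_def Rf_def[abs_def] Rc_def[abs_def] Fm_def[abs_def]
        Ff_def[abs_def] Fc_def[abs_def] zf_def zc_def \<mu>_def)
  define N1 where "N1 = density \<mu> (\<lambda>z. ennreal (Fm z))"
  define N2 where "N2 = distr (density (\<mu> \<Otimes>\<^sub>M \<mu>)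
      (\<lambda>p. if a = 1 then 0 else ennreal (1 - a) * ennreal (Rf (fst p) * Rc (snd p))))
      (state2 m) (\<lambda>p. (fst (fst p), snd (snd p)))"
  have [measurable_cong]: "sets N1 = sets (state2 m)" "sets N2 = sets (state2 m)"
    by (simp_all add: N1_def N2_def sets\<mu>)
  have spN: "space N1 \<noteq> {}" "space N2 \<noteq> {}"
    using not_empty by (simp_all add: N1_def N2_def sp\<mu>)
  have e1: "emeasure (N1 \<bind> K) B = (\<integral>\<^sup>+z. ennreal (Fm z) * emeasure (K z) B \<partial>\<mu>)"
    if B: "B \<in> sets (state2 m)" for B
  proof -
    have "emeasure (N1 \<bind> K) B = (\<integral>\<^sup>+z. emeasure (K z) B \<partial>N1)"
      by (rule emeasure_bind[OF spN(1) _ B]) measurable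
    then show ?thesis using B unfolding N1_def by (simp add: nn_integral_density)
  qed
  have e2: "emeasure (N2 \<bind> K) B = (if a = 1 then 0 else ennreal (1 - a) *
      (\<integral>\<^sup>+p. ennreal (Rf (fst p) * Rc (snd p)) * emeasure (K (fst (fst p), snd (snd p))) B \<partial>(\<mu> \<Otimes>\<^sub>M \<mu>)))"
    if B: "B \<in> sets (state2 m)" for B
  proof -
    have [measurable]: "(\<lambda>p. emeasure (K (fst (fst p), snd (snd p))) B) \<in> borel_measurable (\<mu> \<Otimes>\<^sub>M \<mu>)"
    proof (rule measurable_compose[OF _ KB[OF B]])
      show "(\<lambda>p. (fst (fst p), snd (snd p))) \<in> \<mu> \<Otimes>\<^sub>M \<mu> \<rightarrow>\<^sub>M state2 m" by measurable
    qed
    have "emeasure (N2 \<bind> K) B = (\<integral>\<^sup>+z. emeasure (K z) B \<partial>N2)"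
      by (rule emeasure_bind[OF spN(2) _ B]) measurable
    also have "\<dots> = (\<integral>\<^sup>+p. (if a = 1 then 0 else ennreal (1 - a) * ennreal (Rf (fst p) * Rc (snd p)))
        * emeasure (K (fst (fst p), snd (snd p))) B \<partial>(\<mu> \<Otimes>\<^sub>M \<mu>))"
      unfolding N2_def using KB[OF B]
      by (subst nn_integral_distr; simp add: nn_integral_density)
    also have "\<dots> = (if a = 1 then 0 else ennreal (1 - a) *
      (\<integral>\<^sup>+p. ennreal (Rf (fst p) * Rc (snd p)) * emeasure (K (fst (fst p), snd (snd p))) B \<partial>(\<mu> \<Otimes>\<^sub>M \<mu>)))"
      by (auto simp: mult.assoc nn_integral_cmult)
    finally show ?thesis .
  qed
  have unc: "(\<integral>\<^sup>+((x, y), (u, w)). ennreal (Rf (x, y) * Rc (u, w)) * emeasure (K (x, w)) B \<partial>(\<mu> \<Otimes>\<^sub>M \<mu>)) =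
      (\<integral>\<^sup>+p. ennreal (Rf (fst p) * Rc (snd p)) * emeasure (K (fst (fst p), snd (snd p))) B \<partial>(\<mu> \<Otimes>\<^sub>M \<mu>))" for B
    by (intro nn_integral_cong) (simp split: prod.split)
  define W where "W = add_measure (N1 \<bind> K) (N2 \<bind> K)"
  have sb: "sets (N1 \<bind> K) = sets (state2 m)" "sets (N2 \<bind> K) = sets (state2 m)"
    using spN sets_kernel[OF K] by (auto intro!: sets_bind simp: N1_def N2_def sp\<mu>)
  have setsW: "sets W = sets (state2 m)" by (simp add: W_def sb)
  have fW: "f B = emeasure W B" if "B \<in> sets (state2 m)" for B
    unfolding W_def f_def using that
    by (subst emeasure_add_measure) (simp_all add: sb e1 e2 unc)
  have pairf: "(\<integral>\<^sup>+p. ennreal (Rf (fst p) * Rc (snd p)) * u (fst p) \<partial>(\<mu> \<Otimes>\<^sub>M \<mu>)) =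
      (\<integral>\<^sup>+z. ennreal (Rf z) * u z \<partial>\<mu>)" if "a \<noteq> 1" and [measurable]: "u \<in> borel_measurable (state2 m)" for u
  proof -
    have "(\<integral>\<^sup>+p. ennreal (Rf (fst p) * Rc (snd p)) * u (fst p) \<partial>(\<mu> \<Otimes>\<^sub>M \<mu>)) =
        (\<integral>\<^sup>+z. \<integral>\<^sup>+z'. ennreal (Rf z * Rc z') * u z \<partial>\<mu> \<partial>\<mu>)"
      by (subst nn_integral_fst[symmetric]) simp_all
    also have "\<dots> = (\<integral>\<^sup>+z. \<integral>\<^sup>+z'. (ennreal (Rf z) * u z) * ennreal (Rc z') \<partial>\<mu> \<partial>\<mu>)"
      by (intro nn_integral_cong) (simp add: ennreal_mult R0 mult_ac)
    also have "\<dots> = (\<integral>\<^sup>+z. ennreal (Rf z) * u z \<partial>\<mu>)"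
      by (simp add: nn_integral_cmult R1 that(1))
    finally show ?thesis .
  qed
  have pairc: "(\<integral>\<^sup>+p. ennreal (Rf (fst p) * Rc (snd p)) * u (snd p) \<partial>(\<mu> \<Otimes>\<^sub>M \<mu>)) =
      (\<integral>\<^sup>+z. ennreal (Rc z) * u z \<partial>\<mu>)" if "a \<noteq> 1" and [measurable]: "u \<in> borel_measurable (state2 m)" for u
  proof -
    have "(\<integral>\<^sup>+p. ennreal (Rf (fst p) * Rc (snd p)) * u (snd p) \<partial>(\<mu> \<Otimes>\<^sub>M \<mu>)) =
        (\<integral>\<^sup>+z. \<integral>\<^sup>+z'. ennreal (Rf z * Rc z') * u z' \<partial>\<mu> \<partial>\<mu>)"
      by (subst nn_integral_fst[symmetric]) simp_all
    also have "\<dots> = (\<integral>\<^sup>+z. \<integral>\<^sup>+z'. ennreal (Rf z) * (ennreal (Rc z') * u z') \<partial>\<mu> \<partial>\<mu>)"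
      by (intro nn_integral_cong) (simp add: ennreal_mult R0 mult_ac)
    also have "\<dots> = (\<integral>\<^sup>+z. ennreal (Rf z) * (\<integral>\<^sup>+z'. ennreal (Rc z') * u z' \<partial>\<mu>) \<partial>\<mu>)"
      by (simp add: nn_integral_cmult)
    also have "\<dots> = (\<integral>\<^sup>+z. ennreal (Rc z) * u z \<partial>\<mu>)"
      by (simp add: nn_integral_multc R1 that(1))
    finally show ?thesis .
  qed
  have spp: "fst p \<in> space X \<times> space X \<and> snd p \<in> space X \<times> space X" if "p \<in> space (\<mu> \<Otimes>\<^sub>M \<mu>)" for p
    using that by (simp add: space_pair_measure sp\<mu>) auto
  have marginal: "emeasure W B = (\<integral>\<^sup>+z. ennreal (F z) * u z \<partial>\<mu>)"
    if B: "B \<in> sets (state2 m)" and [measurable]: "u \<in> borel_measurable (state2 m)"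
      and Ku: "\<And>z. z \<in> space X \<times> space X \<Longrightarrow> emeasure (K z) B = u z"
      and pair: "a \<noteq> 1 \<Longrightarrow>
        (\<integral>\<^sup>+p. ennreal (Rf (fst p) * Rc (snd p)) * u (fst (fst p), snd (snd p)) \<partial>(\<mu> \<Otimes>\<^sub>M \<mu>)) =
        (\<integral>\<^sup>+z. ennreal ((F z - Fm z) / (\<integral>z. F z - Fm z \<partial>\<mu>)) * u z \<partial>\<mu>)"
      and F: "integrable \<mu> F" "(\<integral>z. F z \<partial>\<mu>) = 1" "\<And>z. z \<in> space \<mu> \<Longrightarrow> Fm z \<le> F z"
    for B u F
  proof -
    have 1: "(\<integral>\<^sup>+z. ennreal (Fm z) * emeasure (K z) B \<partial>\<mu>) = (\<integral>\<^sup>+z. ennreal (Fm z) * u z \<partial>\<mu>)"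
      by (intro nn_integral_cong) (simp add: Ku sp\<mu> space_pair_measure)
    have 2: "(\<integral>\<^sup>+((x, y), (u, w)). ennreal (Rf (x, y) * Rc (u, w)) * emeasure (K (x, w)) B \<partial>(\<mu> \<Otimes>\<^sub>M \<mu>)) =
        (\<integral>\<^sup>+p. ennreal (Rf (fst p) * Rc (snd p)) * u (fst (fst p), snd (snd p)) \<partial>(\<mu> \<Otimes>\<^sub>M \<mu>))"
      unfolding unc by (intro nn_integral_cong) (auto simp: Ku mem_Times_iff dest!: spp)
    have "emeasure W B = (\<integral>\<^sup>+z. ennreal (Fm z) * u z \<partial>\<mu>) + (if a = 1 then 0 else ennreal (1 - a) *
        (\<integral>\<^sup>+z. ennreal ((F z - Fm z) / (\<integral>z. F z - Fm z \<partial>\<mu>)) * u z \<partial>\<mu>))"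
      unfolding fW[OF B, symmetric] f_def 1 2 by (simp add: pair)
    also have "\<dots> = (\<integral>\<^sup>+z. ennreal (F z) * u z \<partial>\<mu>)"
      by (rule nn_integral_recombine[OF F(1) intF(3) F(2) a_def[symmetric] Fm0(1) F(3)]) simp_all
    finally show ?thesis .
  qed
  have "is_coupling X W (eta m Fine (Suc n)) (eta m Coarse (Suc n))"
  proof (rule is_couplingI)
    fix A assume A [measurable]: "A \<in> sets X"
    define uf where "uf z = emeasure (M m Fine (Suc n) (fst z)) A" for z :: "'a \<times> 'a"
    define uc where "uc z = emeasure (M m Coarse (Suc n) (snd z)) A" for z :: "'a \<times> 'a"
    note [measurable] = emeasure_M_measurable[OF A]
    have u [measurable]: "uf \<in> borel_measurable (state2 m)" "uc \<in> borel_measurable (state2 m)"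
      unfolding uf_def uc_def by measurable
    have "emeasure W (A \<times> space X) = (\<integral>\<^sup>+z. ennreal (Ff z) * uf z \<partial>\<mu>)"
    proof (rule marginal)
      show "emeasure (K z) (A \<times> space X) = uf z" if "z \<in> space X \<times> space X" for z
        using is_couplingD(4)[OF cM_coupling A] that by (simp add: K_def uf_def space_pair_measure)
    qed (use intF F1 Fm0 pairf[OF _ u(1)] in \<open>auto simp: uf_def Rf_def\<close>)
    also have "\<dots> = (\<integral>\<^sup>+x. ennreal (G m n x / zf) * emeasure (M m Fine (Suc n) x) A \<partial>eta m Fine n)"
      unfolding Ff_def uf_def by (rule is_couplingD(6)[OF \<mu>]) measurable
    finally show "emeasure W (A \<times> space X) = emeasure (eta m Fine (Suc n)) A"
      by (simp add: zeq emeasure_eta_Suc)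
    have "emeasure W (space X \<times> A) = (\<integral>\<^sup>+z. ennreal (Fc z) * uc z \<partial>\<mu>)"
    proof (rule marginal)
      show "emeasure (K z) (space X \<times> A) = uc z" if "z \<in> space X \<times> space X" for z
        using is_couplingD(5)[OF cM_coupling A] that by (simp add: K_def uc_def space_pair_measure)
    qed (use intF F1 Fm0 pairc[OF _ u(2)] in \<open>auto simp: uc_def Rc_def\<close>)
    also have "\<dots> = (\<integral>\<^sup>+x. ennreal (G m n x / zc) * emeasure (M m Coarse (Suc n) x) A \<partial>eta m Coarse n)"
      unfolding Fc_def uc_def by (rule is_couplingD(7)[OF \<mu>]) measurable
    finally show "emeasure W (space X \<times> A) = emeasure (eta m Coarse (Suc n)) A"
      by (simp add: zeq emeasure_eta_Suc)
  qed (simp_all add: setsW prob_eta)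
  moreover have "meas2 m f = W" by (rule meas2_eqI[OF setsW fW])
  ultimately show ?case by (simp only: step)
qed

end

context feynman_kac
begin

text \<open>Makes the Radon--Nikodym derivatives in the definition of the maximal coupling densities of the two
  flows.\<close>

lemma eta_absolutely_continuous:
  assumes sch: "scheme_setting m (Sch_C lam)"
  shows "absolutely_continuous lam (eta m s n)"
proof (cases n)
  case 0
  have "\<exists>q \<in> borel_measurable lam. eta0 m s = density lam q" using sch by simp
  then obtain q where q [measurable]: "q \<in> borel_measurable lam" and e: "eta0 m s = density lam q" by blast
  show ?thesis unfolding 0 eta_0 e by (rule absolutely_continuousI_density) (rule q)
next
  case (Suc n)
  have sets: "sets lam = sets X" using sch by simp
  show ?thesis unfolding absolutely_continuous_def Suc
  proof
    fix A assume A: "A \<in> null_sets lam"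
    then have AX: "A \<in> sets X" using sets by auto
    have "emeasure (M m s (Suc n) x) A = 0" if x: "x \<in> space X" for x
    proof -
      have "\<forall>n\<ge>1. \<forall>x \<in> space X. \<exists>q \<in> borel_measurable lam. M m s n x = density lam q" using sch by simp
      then obtain q where q: "q \<in> borel_measurable lam" and e: "M m s (Suc n) x = density lam q"
        using x by (auto dest!: spec[of _ "Suc n"])
      have "A \<in> null_sets (density lam q)"
        using absolutely_continuousI_density[OF q] A by (auto simp: absolutely_continuous_def)
      then show ?thesis by (simp add: e null_sets_def)
    qed
    then have "emeasure (eta m s (Suc n)) A = 0"
      unfolding eta_Suc using AX space_nonempty
      by (subst emeasure_bind[where N = X]) (auto intro!: nn_integral_0_iff_AE[THEN iffD2] AE_I2 simp: nn_integral_0_iff_AE)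
    then show "A \<in> null_sets (eta m s (Suc n))" using AX by (simp add: null_sets_def)
  qed
qed

lemma coupling_C_coupling:
  assumes sch: "scheme_setting m (Sch_C lam)"
  shows "is_coupling X (coupling_C m lam n) (eta m Fine n) (eta m Coarse n)"
proof -
  have sets [measurable_cong]: "sets lam = sets X" using sch by simp
  have sp: "space lam = space X" by (rule sets_eq_imp_space_eq[OF sets])
  interpret L: sigma_finite_measure lam using sch by simp
  interpret P: pair_sigma_finite lam lam ..
  have [measurable_cong]: "sets (lam \<Otimes>\<^sub>M lam) = sets (state2 m)"
    by (rule sets_pair_measure_cong) (simp_all add: sets)
  define f where "f = RN_deriv lam (eta m Fine n)"
  define g where "g = RN_deriv lam (eta m Coarse n)"
  define mn where "mn u = min (f u) (g u)" for u
  define a where "a = (\<integral>\<^sup>+u. mn u \<partial>lam)"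
  have [measurable]: "f \<in> borel_measurable X" "g \<in> borel_measurable X"
    using borel_measurable_RN_deriv[of lam "eta m Fine n"] borel_measurable_RN_deriv[of lam "eta m Coarse n"]
    by (simp_all add: f_def g_def cong: measurable_cong_sets)
  then have [measurable]: "mn \<in> borel_measurable X" unfolding mn_def by measurable
  have dens: "density lam f = eta m Fine n" "density lam g = eta m Coarse n"
    unfolding f_def g_def
    by (simp_all add: L.density_RN_deriv[OF eta_absolutely_continuous[OF sch]] sets)
  have F: "(\<integral>\<^sup>+u. f u * indicator A u \<partial>lam) = emeasure (eta m Fine n) A"
    and Gc: "(\<integral>\<^sup>+u. g u * indicator A u \<partial>lam) = emeasure (eta m Coarse n) A" if "A \<in> sets X" for A
    unfolding dens[symmetric] using that by (simp_all add: emeasure_density)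
  have tot: "(\<integral>\<^sup>+u. f u \<partial>lam) = 1" "(\<integral>\<^sup>+u. g u \<partial>lam) = 1"
  proof -
    have "(\<integral>\<^sup>+u. f u \<partial>lam) = (\<integral>\<^sup>+u. f u * indicator (space X) u \<partial>lam)"
      "(\<integral>\<^sup>+u. g u \<partial>lam) = (\<integral>\<^sup>+u. g u * indicator (space X) u \<partial>lam)"
      by (auto intro!: nn_integral_cong simp: sp)
    then show "(\<integral>\<^sup>+u. f u \<partial>lam) = 1" "(\<integral>\<^sup>+u. g u \<partial>lam) = 1"
      using F[of "space X"] Gc[of "space X"] prob_space.emeasure_space_1[OF prob_eta, of Fine n]
        prob_space.emeasure_space_1[OF prob_eta, of Coarse n] by simp_all
  qed
  have a1: "a \<le> 1" unfolding a_def tot(1)[symmetric] by (rule nn_integral_mono) (simp add: mn_def)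
  then have afin: "a \<noteq> \<infinity>" using ennreal_one_less_top by (auto simp: top_unique)
  have diff: "(\<integral>\<^sup>+u. f u - mn u \<partial>lam) = 1 - a" "(\<integral>\<^sup>+u. g u - mn u \<partial>lam) = 1 - a"
  proof -
    have fin: "(\<integral>\<^sup>+u. mn u \<partial>lam) \<noteq> \<infinity>" using afin by (simp add: a_def)
    have "(\<integral>\<^sup>+u. f u - mn u \<partial>lam) = (\<integral>\<^sup>+u. f u \<partial>lam) - (\<integral>\<^sup>+u. mn u \<partial>lam)"
      by (rule nn_integral_diff[OF _ _ fin]) (simp_all add: mn_def)
    then show "(\<integral>\<^sup>+u. f u - mn u \<partial>lam) = 1 - a" by (simp add: tot a_def)
    have "(\<integral>\<^sup>+u. g u - mn u \<partial>lam) = (\<integral>\<^sup>+u. g u \<partial>lam) - (\<integral>\<^sup>+u. mn u \<partial>lam)"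
      by (rule nn_integral_diff[OF _ _ fin]) (simp_all add: mn_def)
    then show "(\<integral>\<^sup>+u. g u - mn u \<partial>lam) = 1 - a" by (simp add: tot a_def)
  qed
  have split: "mn u + (f u - mn u) = f u" "mn u + (g u - mn u) = g u" for u
    by (simp_all add: mn_def add_diff_inverse_ennreal)
  define F' where "F' B = (\<integral>\<^sup>+u. indicator B (u, u) * mn u \<partial>lam) +
       (if a = 1 then 0
        else (\<integral>\<^sup>+x. (\<integral>\<^sup>+y. indicator B (x, y) * (f x - mn x) * (g y - mn y) \<partial>lam) \<partial>lam) / (1 - a))" for B
  have eq: "coupling_C m lam n = meas2 m F'"
    by (simp only: coupling_C_def Let_def F'_def[abs_def] a_def mn_def[abs_def] f_def g_def)
  define N1 where "N1 = distr (density lam mn) (state2 m) (\<lambda>u. (u, u))"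
  define N2 where "N2 = density (lam \<Otimes>\<^sub>M lam)
      (\<lambda>z. if a = 1 then 0 else (f (fst z) - mn (fst z)) * (g (snd z) - mn (snd z)) / (1 - a))"
  have e1: "emeasure N1 B = (\<integral>\<^sup>+u. indicator B (u, u) * mn u \<partial>lam)" if [measurable]: "B \<in> sets (state2 m)" for B
  proof -
    have *: "(\<lambda>u. (u, u)) -` B \<inter> space lam \<in> sets lam"
      by (rule measurable_sets[OF _ that]) measurable
    show ?thesis unfolding N1_def
      using * by (subst emeasure_distr) (auto simp: emeasure_density indicator_def intro!: nn_integral_cong)
  qed
  have e2: "emeasure N2 B = (if a = 1 then 0
        else (\<integral>\<^sup>+x. (\<integral>\<^sup>+y. indicator B (x, y) * (f x - mn x) * (g y - mn y) \<partial>lam) \<partial>lam) / (1 - a))"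
    if [measurable]: "B \<in> sets (state2 m)" for B
  proof (cases "a = 1")
    case True then show ?thesis by (simp add: N2_def emeasure_density)
  next
    case False
    have "emeasure N2 B = (\<integral>\<^sup>+z. (indicator B z * (f (fst z) - mn (fst z)) * (g (snd z) - mn (snd z))) / (1 - a) \<partial>(lam \<Otimes>\<^sub>M lam))"
      unfolding N2_def using False
      by (subst emeasure_density) (auto intro!: nn_integral_cong simp: divide_ennreal_def mult_ac)
    also have "\<dots> = (\<integral>\<^sup>+z. indicator B z * (f (fst z) - mn (fst z)) * (g (snd z) - mn (snd z)) \<partial>(lam \<Otimes>\<^sub>M lam)) / (1 - a)"
      by (rule nn_integral_divide) measurable
    also have "(\<integral>\<^sup>+z. indicator B z * (f (fst z) - mn (fst z)) * (g (snd z) - mn (snd z)) \<partial>(lam \<Otimes>\<^sub>M lam)) =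
        (\<integral>\<^sup>+x. (\<integral>\<^sup>+y. indicator B (x, y) * (f x - mn x) * (g y - mn y) \<partial>lam) \<partial>lam)"
      using L.nn_integral_fst[of "\<lambda>z. indicator B z * (f (fst z) - mn (fst z)) * (g (snd z) - mn (snd z))" lam]
      by simp
    finally show ?thesis using False by simp
  qed
  define W where "W = add_measure N1 N2"
  have sb: "sets N1 = sets (state2 m)" "sets N2 = sets (state2 m)"
    by (simp_all add: N1_def N2_def sets_pair_measure_cong[OF sets sets])
  have setsW: "sets W = sets (state2 m)" by (simp add: W_def sb)
  have FW: "F' B = emeasure W B" if "B \<in> sets (state2 m)" for B
    unfolding W_def F'_def using that by (subst emeasure_add_measure) (simp_all add: sb e1 e2)
  have ratio: "u * (1 - a) / (1 - a) = u" if "a \<noteq> 1" for u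
  proof -
    have "1 - a \<noteq> 0" using that a1 by (metis antisym diff_eq_0_iff_ennreal)
    moreover have "1 - a \<noteq> \<infinity>" using ennreal_one_less_top by (auto simp: ennreal_minus_eq_top)
    ultimately show ?thesis by (simp add: mult_divide_eq_ennreal)
  qed
  have recombine: "(\<integral>\<^sup>+u. mn u * indicator A u \<partial>lam) + (if a = 1 then 0 else (\<integral>\<^sup>+u. (k u - mn u) * indicator A u \<partial>lam)) =
      (\<integral>\<^sup>+u. k u * indicator A u \<partial>lam)"
    if [measurable]: "A \<in> sets X" "k \<in> borel_measurable X" and k: "\<And>u. mn u + (k u - mn u) = k u"
      and d: "(\<integral>\<^sup>+u. k u - mn u \<partial>lam) = 1 - a" for k A
  proof (cases "a = 1")
    case True
    then have "(\<integral>\<^sup>+u. k u - mn u \<partial>lam) = 0" using d by simp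
    then have "AE u in lam. k u - mn u = 0" by (subst (asm) nn_integral_0_iff_AE) auto
    then have "AE u in lam. mn u = k u" by eventually_elim (metis k add.right_neutral)
    then show ?thesis using True by (auto intro!: nn_integral_cong_AE)
  next
    case False
    then have "?thesis \<longleftrightarrow> (\<integral>\<^sup>+u. mn u * indicator A u + (k u - mn u) * indicator A u \<partial>lam) = (\<integral>\<^sup>+u. k u * indicator A u \<partial>lam)"
      by (subst nn_integral_add) auto
    then show ?thesis by (simp only: distrib_right[symmetric] k)
  qed
  have "is_coupling X W (eta m Fine n) (eta m Coarse n)"
  proof (rule is_couplingI)
    fix A assume A [measurable]: "A \<in> sets X"
    have 1: "(\<integral>\<^sup>+u. indicator (A \<times> space X) (u, u) * mn u \<partial>lam) = (\<integral>\<^sup>+u. mn u * indicator A u \<partial>lam)"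
      by (intro nn_integral_cong) (auto simp: indicator_def sp)
    have "(\<integral>\<^sup>+x. (\<integral>\<^sup>+y. indicator (A \<times> space X) (x, y) * (f x - mn x) * (g y - mn y) \<partial>lam) \<partial>lam)
        = (\<integral>\<^sup>+x. (\<integral>\<^sup>+y. (f x - mn x) * indicator A x * (g y - mn y) \<partial>lam) \<partial>lam)"
      by (intro nn_integral_cong) (auto simp: indicator_def sp)
    also have "\<dots> = (\<integral>\<^sup>+x. (f x - mn x) * indicator A x \<partial>lam) * (1 - a)"
      by (simp add: nn_integral_cmult nn_integral_multc diff)
    finally have 2: "(\<integral>\<^sup>+x. (\<integral>\<^sup>+y. indicator (A \<times> space X) (x, y) * (f x - mn x) * (g y - mn y) \<partial>lam) \<partial>lam)
        = (\<integral>\<^sup>+x. (f x - mn x) * indicator A x \<partial>lam) * (1 - a)" .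
    have "emeasure W (A \<times> space X) = F' (A \<times> space X)" using FW by simp
    also have "\<dots> = (\<integral>\<^sup>+u. mn u * indicator A u \<partial>lam) + (if a = 1 then 0 else (\<integral>\<^sup>+u. (f u - mn u) * indicator A u \<partial>lam))"
      unfolding F'_def 1 2 by (simp add: ratio)
    also have "\<dots> = emeasure (eta m Fine n) A"
      by (subst recombine) (simp_all add: split diff F)
    finally show "emeasure W (A \<times> space X) = emeasure (eta m Fine n) A" .
    have 1: "(\<integral>\<^sup>+u. indicator (space X \<times> A) (u, u) * mn u \<partial>lam) = (\<integral>\<^sup>+u. mn u * indicator A u \<partial>lam)"
      by (intro nn_integral_cong) (auto simp: indicator_def sp)
    have "(\<integral>\<^sup>+x. (\<integral>\<^sup>+y. indicator (space X \<times> A) (x, y) * (f x - mn x) * (g y - mn y) \<partial>lam) \<partial>lam)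
        = (\<integral>\<^sup>+x. (\<integral>\<^sup>+y. (f x - mn x) * ((g y - mn y) * indicator A y) \<partial>lam) \<partial>lam)"
      by (intro nn_integral_cong) (auto simp: indicator_def sp)
    also have "\<dots> = (1 - a) * (\<integral>\<^sup>+x. (g x - mn x) * indicator A x \<partial>lam)"
      by (simp add: nn_integral_cmult nn_integral_multc diff)
    finally have 2: "(\<integral>\<^sup>+x. (\<integral>\<^sup>+y. indicator (space X \<times> A) (x, y) * (f x - mn x) * (g y - mn y) \<partial>lam) \<partial>lam)
        = (\<integral>\<^sup>+x. (g x - mn x) * indicator A x \<partial>lam) * (1 - a)" by (simp only: mult.commute)
    have "emeasure W (space X \<times> A) = F' (space X \<times> A)" using FW by simp
    also have "\<dots> = (\<integral>\<^sup>+u. mn u * indicator A u \<partial>lam) + (if a = 1 then 0 else (\<integral>\<^sup>+u. (g u - mn u) * indicator A u \<partial>lam))"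
      unfolding F'_def 1 2 by (simp add: ratio)
    also have "\<dots> = emeasure (eta m Coarse n) A"
      by (subst recombine) (simp_all add: split diff Gc)
    finally show "emeasure W (space X \<times> A) = emeasure (eta m Coarse n) A" .
  qed (simp_all add: setsW prob_eta)
  moreover have "meas2 m F' = W" by (rule meas2_eqI[OF setsW FW])
  ultimately show ?thesis by (simp only: eq)
qed

end

text \<open>The quantile transform. Since the distribution function takes every value in the open unit
  interval exactly once, \<open>F\<^sup>-\<^sup>1 w \<le> t\<close> and \<open>w \<le> F t\<close> are equivalent.\<close>

lemma quantile_transform:
  fixes \<mu> :: "real measure"
  assumes \<mu>: "real_distribution \<mu>"
    and uniq: "\<And>w. w \<in> {0<..<1} \<Longrightarrow> \<exists>!t. cdf \<mu> t = w"
    and cont: "continuous_on {0<..<1} (\<lambda>w. THE t. cdf \<mu> t = w)"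
  shows "(\<lambda>w. THE t. cdf \<mu> t = w) \<in> restrict_space lborel {0<..<1} \<rightarrow>\<^sub>M borel"
    and "distr (restrict_space lborel {0<..<1}) borel (\<lambda>w. THE t. cdf \<mu> t = w) = \<mu>"
    and "prob_space (restrict_space lborel {0<..<1::real})"
proof -
  interpret \<mu>: real_distribution \<mu> by fact
  define I where "I w = (THE t. cdf \<mu> t = w)" for w
  let ?U = "restrict_space lborel {0<..<1::real}"
  have cdfI: "cdf \<mu> (I w) = w" if "w \<in> {0<..<1}" for w
    unfolding I_def by (rule theI') (rule uniq[OF that])
  have I_le: "I w \<le> t \<longleftrightarrow> w \<le> cdf \<mu> t" if w: "w \<in> {0<..<1}" for w t
  proof
    assume "I w \<le> t"
    from \<mu>.cdf_nondecreasing[OF this] show "w \<le> cdf \<mu> t" by (simp add: cdfI[OF w])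
  next
    assume le: "w \<le> cdf \<mu> t"
    show "I w \<le> t"
    proof (rule ccontr)
      assume "\<not> I w \<le> t"
      then have "cdf \<mu> t \<le> w" using \<mu>.cdf_nondecreasing[of t "I w"] by (simp add: cdfI[OF w])
      then have "cdf \<mu> t = cdf \<mu> (I w)" using le cdfI[OF w] by simp
      then have "t = I w" using uniq[OF w] cdfI[OF w] by metis
      then show False using \<open>\<not> I w \<le> t\<close> by simp
    qed
  qed
  show prob: "prob_space ?U"
    by (rule prob_spaceI) (simp add: emeasure_restrict_space space_restrict_space)
  have "I \<in> borel_measurable (restrict_space borel {0<..<1})"
    by (rule borel_measurable_continuous_on_restrict) (use cont in \<open>simp add: I_def[abs_def]\<close>)
  then have meas: "I \<in> ?U \<rightarrow>\<^sub>M borel"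
    by (subst measurable_cong_sets[OF _ refl]) (auto intro!: sets_restrict_space_cong)
  then show "(\<lambda>w. THE t. cdf \<mu> t = w) \<in> ?U \<rightarrow>\<^sub>M borel" by (simp add: I_def[abs_def])
  interpret U: prob_space ?U by (rule prob)
  interpret D: real_distribution "distr ?U borel I" using meas by (rule U.real_distribution_distr)
  have "distr ?U borel I = \<mu>"
  proof (rule cdf_unique[OF D.real_distribution_axioms \<mu>], rule ext)
    fix t
    define c where "c = cdf \<mu> t"
    have c: "0 \<le> c" "c \<le> 1" unfolding c_def by (rule \<mu>.cdf_nonneg) (rule \<mu>.cdf_bounded_prob)
    have "cdf (distr ?U borel I) t = measure ?U (I -` {..t} \<inter> space ?U)"
      unfolding cdf_def by (rule measure_distr[OF meas]) simp
    also have "I -` {..t} \<inter> space ?U = {0<..<1} \<inter> {..c}"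
      by (auto simp: space_restrict_space I_le c_def)
    also have "measure ?U ({0<..<1} \<inter> {..c}) = measure lborel ({0<..<1} \<inter> {..c})"
      by (rule measure_restrict_space) auto
    also have "\<dots> = c"
    proof (cases "c = 1")
      case True
      then have "{0<..<1} \<inter> {..c} = {0<..<1::real}" by auto
      then show ?thesis using True by simp
    next
      case False
      then have "{0<..<1} \<inter> {..c} = {0<..c}" using c by auto
      then show ?thesis using c by simp
    qed
    finally show "cdf (distr ?U borel I) t = cdf \<mu> t" by (simp add: c_def)
  qed
  then show "distr ?U borel (\<lambda>w. THE t. cdf \<mu> t = w) = \<mu>" by (simp add: I_def[abs_def])
qed

context feynman_kac
begin

lemma coupling_W_coupling:
  assumes sch: "scheme_setting m (Sch_W e)"
  shows "is_coupling X (coupling_W m e n) (eta m Fine n) (eta m Coarse n)"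
proof (cases n)
  case 0 then show ?thesis using ceta0_coupling by simp
next
  case (Suc n)
  define r where "r = the_inv_into (space X) e"
  let ?U = "restrict_space lborel {0<..<1::real}"
  let ?I = "\<lambda>s. real_cdf_inv m e s n"
  have bij: "bij_betw e (space X) UNIV" and e [measurable]: "e \<in> X \<rightarrow>\<^sub>M borel"
    and r [measurable]: "r \<in> borel \<rightarrow>\<^sub>M X" using sch by (auto simp: r_def)
  have re: "r (e x) = x" if "x \<in> space X" for x
    unfolding r_def using bij that by (simp add: bij_betw_def the_inv_into_f_f)
  have law: "?I s \<in> ?U \<rightarrow>\<^sub>M borel" "distr ?U borel (?I s) = distr (eta_bar m s n) borel e"
    "prob_space ?U" for s
  proof -
    interpret prob_space "eta_bar m s n" by (rule prob_eta_bar)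
    have rd: "real_distribution (distr (eta_bar m s n) borel e)"
      by (rule real_distribution_distr) measurable
    have inv: "?I s = (\<lambda>w. THE t. cdf (distr (eta_bar m s n) borel e) t = w)"
      by (simp add: real_cdf_inv_def[abs_def] real_cdf_def)
    have "\<exists>!t. cdf (distr (eta_bar m s n) borel e) t = w" if "w \<in> {0<..<1}" for w
      using sch that by (simp add: real_cdf_def)
    moreover have "continuous_on {0<..<1} (?I s)" using sch by simp
    ultimately show "?I s \<in> ?U \<rightarrow>\<^sub>M borel" "distr ?U borel (?I s) = distr (eta_bar m s n) borel e"
      "prob_space ?U"
      unfolding inv using quantile_transform[OF rd] by blast+
  qed
  note [measurable] = law(1)
  have recover: "distr ?U X (\<lambda>w. r (?I s w)) = eta_bar m s n" for s
  proof -
    have "distr ?U X (\<lambda>w. r (?I s w)) = distr (distr ?U borel (?I s)) X r"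
      by (subst distr_distr) (simp_all add: comp_def)
    also have "\<dots> = distr (eta_bar m s n) X (\<lambda>x. r (e x))"
      unfolding law(2) by (subst distr_distr) (simp_all add: comp_def)
    also have "\<dots> = distr (eta_bar m s n) X (\<lambda>x. x)"
      by (rule distr_cong) (simp_all add: re)
    also have "\<dots> = eta_bar m s n"
      by (rule distr_id2) simp
    finally show ?thesis .
  qed
  define z where "z w = (r (?I Fine w), r (?I Coarse w))" for w
  have z [measurable]: "z \<in> ?U \<rightarrow>\<^sub>M state2 m" unfolding z_def by measurable
  define N where "N = distr ?U (state2 m) z"
  have N: "is_coupling X N (eta_bar m Fine n) (eta_bar m Coarse n)"
    unfolding is_coupling_def
  proof (intro conjI)
    show "N \<in> space (prob_algebra (state2 m))"
      unfolding N_def space_prob_algebra using prob_space.prob_space_distr[OF law(3) z] by simp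
    show "distr N X fst = eta_bar m Fine n" "distr N X snd = eta_bar m Coarse n"
      unfolding N_def by (subst distr_distr; simp add: comp_def z_def recover)+
  qed
  have "coupling_W m e (Suc n) = meas2 m (\<lambda>B. \<integral>\<^sup>+w\<in>{0<..<1}. emeasure (cM m (Suc n) (z w)) B \<partial>lborel)"
    by (simp only: coupling_W.simps Let_def z_def r_def)
  moreover have "(\<integral>\<^sup>+w\<in>{0<..<1}. emeasure (cM m (Suc n) (z w)) B \<partial>lborel) =
      (\<integral>\<^sup>+p. emeasure (cM m (Suc n) p) B \<partial>N)" if "B \<in> sets (state2 m)" for B
    unfolding N_def using that by (subst nn_integral_distr[OF z]) (simp_all add: nn_integral_restrict_space)
  ultimately show ?thesis
    using coupling_bind_meas2[OF N] Suc by simp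
qed

theorem ceta_coupling:
  assumes "scheme_setting m sch"
  shows "is_coupling X (ceta m sch n) (eta m Fine n) (eta m Coarse n)"
proof (cases sch)
  case Sch_I then show ?thesis by (simp add: coupling_I_coupling)
next
  case Sch_M then show ?thesis by (simp add: coupling_M_coupling)
next
  case (Sch_C lam) then show ?thesis using coupling_C_coupling assms by (simp only: ceta.simps)
next
  case (Sch_W e) then show ?thesis using coupling_W_coupling assms by (simp only: ceta.simps)
qed

end

section \<open>The asymptotic variance bounds\<close>

lemma wnorm_le:
  assumes "space X \<noteq> {}" "\<And>x. x \<in> space X \<Longrightarrow> 0 < w x" "\<And>x. x \<in> space X \<Longrightarrow> \<bar>f x\<bar> \<le> c * w x"
  shows "wnorm X w f \<le> c"
  unfolding wnorm_def using assms by (intro cSUP_least) (auto simp: pos_divide_le_eq)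

lemma abs_le_wnorm:
  assumes x: "x \<in> space X" and w: "\<And>x. x \<in> space X \<Longrightarrow> 0 < w x"
    and f: "\<And>x. x \<in> space X \<Longrightarrow> \<bar>f x\<bar> \<le> c * w x"
  shows "\<bar>f x\<bar> \<le> wnorm X w f * w x"
proof -
  have "bdd_above ((\<lambda>x. \<bar>f x\<bar> / w x) ` space X)"
    by (rule bdd_aboveI2[where M = c]) (use f w in \<open>simp add: pos_divide_le_eq\<close>)
  from cSUP_upper[OF x this] show ?thesis
    using w[OF x] by (simp add: wnorm_def pos_divide_le_eq)
qed

lemma wnorm_nonneg:
  assumes "space X \<noteq> {}" "\<And>x. x \<in> space X \<Longrightarrow> 0 < w x" "\<And>x. x \<in> space X \<Longrightarrow> \<bar>f x\<bar> \<le> c * w x"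
  shows "0 \<le> wnorm X w f"
proof -
  obtain x where x: "x \<in> space X" using assms(1) by blast
  have "0 \<le> wnorm X w f * w x"
    using abs_le_wnorm[OF x assms(2,3)] by (rule order_trans[OF abs_ge_zero])
  then show ?thesis using assms(2)[OF x] by (simp add: zero_le_mult_iff)
qed

lemma exp_convex_le:
  fixes a c s t :: real
  assumes "0 \<le> a" "0 \<le> c" "a + c \<le> 1" "0 \<le> s" "0 \<le> t"
  shows "exp (a * s) * exp (c * t) \<le> exp s + exp t"
proof -
  let ?M = "max s t"
  have "a * s + c * t \<le> a * ?M + c * ?M"
    using assms by (intro add_mono mult_left_mono) auto
  also have "\<dots> = (a + c) * ?M" by (simp add: distrib_right)
  also have "\<dots> \<le> 1 * ?M" using assms by (intro mult_right_mono) auto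
  finally have "exp (a * s) * exp (c * t) \<le> exp ?M" by (simp add: exp_add[symmetric])
  also have "\<dots> \<le> exp s + exp t" by (auto simp: max_def)
  finally show ?thesis .
qed

context stable_model
begin

lemma D_refl: "D m s n n \<phi> x = \<phi> x - (\<integral>y. \<phi> y \<partial>eta m s n)"
  using prob_space.prob_space[OF prob_eta, of s n] by (simp add: D_def)

lemma D_bounded:
  assumes "\<phi> \<in> bounded_measurable X" "p \<le> n"
  shows "D m s p n \<phi> \<in> bounded_measurable X"
  using bounded_measurable_cmult[OF Q_semi_bounded[OF bounded_measurable_diff_const[OF assms(1)] assms(2)],
      where a = "1 / (\<integral>z. Q_semi m s p n (\<lambda>_. 1) z \<partial>eta m s p)"]
  by (simp add: D_def[abs_def])

lemma D_step:
  assumes "p < n"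
  shows "D m s p n \<phi> x = Q m s (Suc p) (D m s (Suc p) n \<phi>) x / (\<integral>y. G m p y \<partial>eta m s p)"
proof -
  let ?c = "\<integral>z. Q_semi m s (Suc p) n (\<lambda>_. 1) z \<partial>eta m s (Suc p)"
  let ?\<psi> = "\<lambda>y. \<phi> y - (\<integral>z. \<phi> z \<partial>eta m s n)"
  have "D m s p n \<phi> x = Q m s (Suc p) (Q_semi m s (Suc p) n ?\<psi>) x
      / ((\<integral>y. G m p y \<partial>eta m s p) * ?c)"
    unfolding D_def eta_Q_semi_one_step[OF assms] by (simp only: Q_semi_step[OF assms])
  then show ?thesis
    using Q_cmult[of s p "1 / ?c" "Q_semi m s (Suc p) n ?\<psi>" x]
    by (simp add: D_def[abs_def])
qed

text \<open>By \<open>exp_convex_le\<close> such moments are controlled by the first moments of the two marginals, so nothing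
  about the dependence between the levels enters.\<close>

lemma coupling_moments:
  assumes P: "is_coupling X P (eta m Fine p) (eta m Coarse p)"
    and int: "\<And>s. integrable (eta m s p) (\<lambda>x. exp (V x))"
    and a: "0 \<le> a" "0 \<le> c" "a + c \<le> 1"
  shows "integrable P (\<lambda>z. exp (a * V (fst z)) * exp (c * V (snd z)))"
    and "(\<integral>z. exp (c * V (snd z)) \<partial>P) \<le> (\<integral>x. exp (V x) \<partial>eta m Coarse p)"
proof -
  note [measurable_cong] = is_couplingD(1)[OF P]
  have i: "integrable P (\<lambda>z. exp (V (fst z)))" "integrable P (\<lambda>z. exp (V (snd z)))"
  proof -
    have "integrable (distr P X fst) (\<lambda>x. exp (V x))" "integrable (distr P X snd) (\<lambda>x. exp (V x))"
      using int by (simp_all add: is_coupling_fst_snd[OF P])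
    then show "integrable P (\<lambda>z. exp (V (fst z)))" "integrable P (\<lambda>z. exp (V (snd z)))"
      using integrable_distr[of fst P X "\<lambda>x. exp (V x)"] integrable_distr[of snd P X "\<lambda>x. exp (V x)"]
      by simp_all
  qed
  have pos: "0 \<le> V (fst z)" "0 \<le> V (snd z)" if "z \<in> space P" for z
    using that is_couplingD(3)[OF P] V_ge_1[of "fst z"] V_ge_1[of "snd z"] by (auto simp: mem_Times_iff)
  show "integrable P (\<lambda>z. exp (a * V (fst z)) * exp (c * V (snd z)))"
    by (rule Bochner_Integration.integrable_bound[OF Bochner_Integration.integrable_add[OF i]])
      (use exp_convex_le[OF a pos] in \<open>auto intro!: AE_I2 simp: abs_of_pos add_pos_pos\<close>)
  have le: "exp (c * V (snd z)) \<le> exp (V (snd z))" if "z \<in> space P" for z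
    using mult_right_mono[of c 1 "V (snd z)"] pos[OF that] a by simp
  have "(\<integral>z. exp (c * V (snd z)) \<partial>P) \<le> (\<integral>z. exp (V (snd z)) \<partial>P)"
    by (rule integral_mono'[OF i(2) le]) auto
  also have "\<dots> = (\<integral>x. exp (V x) \<partial>eta m Coarse p)"
    using integral_distr[of snd P X "\<lambda>x. exp (V x)"] by (simp add: is_coupling_fst_snd[OF P])
  finally show "(\<integral>z. exp (c * V (snd z)) \<partial>P) \<le> (\<integral>x. exp (V x) \<partial>eta m Coarse p)" .
qed

text \<open>At a common point the two levels differ through the three quantities summed in \<open>B_term\<close>. One
  factor of the square is estimated by the decay of \<open>D\<close> alone, the other by these quantities; this is why
  they enter linearly.\<close>

lemma D_level_difference:
  assumes \<rho>: "0 < \<rho>" "\<rho> < 1" and A: "1 \<le> A" and \<xi>: "0 < \<xi>"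
    and \<phi>: "\<phi> \<in> bounded_measurable X" and pn: "p \<le> n" and y: "y \<in> space X"
    and Pb: "ratio_forgets m V \<xi> \<rho> A" and Db: "D_decays m V \<xi> \<rho> A" and hb: "h_dominated m V \<xi> A"
  defines "w \<equiv> \<lambda>x. exp (V x) powr \<xi>"
  defines "T \<equiv> wnorm X w (\<lambda>x. h m Fine p n x * S m p n \<phi> x) + \<bar>eta_diff m n \<phi>\<bar>
    + supnorm X \<phi> * wnorm X w (\<lambda>x. h m Fine p n x - h m Coarse p n x) * \<rho> ^ (n - p)"
  shows "0 \<le> T"
    and "(D m Fine p n \<phi> y - D m Coarse p n \<phi> y)\<^sup>2
      \<le> 2 * A\<^sup>2 * \<rho> ^ (n - p) * supnorm X \<phi> * T * exp (3 * \<xi> * V y)"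
proof -
  define L where "L = supnorm X \<phi>"
  define r where "r = \<rho> ^ (n - p)"
  have L: "0 \<le> L" unfolding L_def by (rule supnorm_nonneg[OF \<phi> space_nonempty])
  have r: "0 < r" "r \<le> 1" using \<rho> by (auto simp: r_def power_le_one)
  have w: "w x = exp (\<xi> * V x)" for x by (simp add: w_def exp_powr_real mult.commute)
  define P where "P s x = Q_semi m s p n \<phi> x / Q_semi m s p n (\<lambda>_. 1) x" for s x
  define e where "e s = (\<integral>y. \<phi> y \<partial>eta m s n)" for s
  have S: "S m p n \<phi> x = P Fine x - P Coarse x" for x by (simp add: S_def P_def)
  have wpos: "0 < w x" for x by (simp add: w)
  have w1: "1 \<le> w x" if "x \<in> space X" for x using V_ge_1[OF that] \<xi> by (simp add: w)
  have h0: "0 \<le> h m s p n x" if "x \<in> space X" for s x by (rule h_nonneg[OF pn that])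
  note Pb' = ratio_forgetsD[OF Pb \<phi> pn, folded P_def e_def L_def r_def w]
    and Db' = D_decaysD[OF Db \<phi> pn, folded L_def r_def w]
    and hb' = h_dominatedD[OF hb pn, folded w]
  have hS: "\<bar>h m Fine p n x * S m p n \<phi> x\<bar> \<le> A * (2 * L) * w x" if x: "x \<in> space X" for x
  proof -
    have "\<bar>S m p n \<phi> x\<bar> \<le> 2 * L"
    proof -
      have "\<bar>P t x\<bar> \<le> L" for t unfolding P_def L_def by (rule ratio_le_supnorm[OF \<phi> pn x])
      from this[of Fine] this[of Coarse] show ?thesis unfolding S by linarith
    qed
    then have "\<bar>h m Fine p n x\<bar> * \<bar>S m p n \<phi> x\<bar> \<le> (A * w x) * (2 * L)"
      using hb'[OF x, of Fine] h0[OF x, of Fine] by (intro mult_mono) auto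
    then show ?thesis by (simp add: abs_mult mult_ac)
  qed
  have hd: "\<bar>h m Fine p n x - h m Coarse p n x\<bar> \<le> A * w x" if x: "x \<in> space X" for x
    using hb'[OF x, of Fine] hb'[OF x, of Coarse] h0[OF x, of Fine] h0[OF x, of Coarse] by linarith
  define n1 where "n1 = wnorm X w (\<lambda>x. h m Fine p n x * S m p n \<phi> x)"
  define n2 where "n2 = wnorm X w (\<lambda>x. h m Fine p n x - h m Coarse p n x)"
  have n0: "0 \<le> n1" "0 \<le> n2"
    unfolding n1_def n2_def
    by (rule wnorm_nonneg[OF space_nonempty wpos hS], simp, rule wnorm_nonneg[OF space_nonempty wpos hd], simp)
  have n1: "\<bar>h m Fine p n y * S m p n \<phi> y\<bar> \<le> n1 * w y"
    unfolding n1_def by (rule abs_le_wnorm[OF y wpos hS])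
  have n2: "\<bar>h m Fine p n y - h m Coarse p n y\<bar> \<le> n2 * w y"
    unfolding n2_def by (rule abs_le_wnorm[OF y wpos hd])
  have T: "T = n1 + \<bar>eta_diff m n \<phi>\<bar> + L * n2 * r"
    by (simp add: T_def n1_def n2_def L_def r_def)
  show T0: "0 \<le> T" unfolding T using n0 L r by simp
  let ?d = "D m Fine p n \<phi> y - D m Coarse p n \<phi> y"
  have "?d = h m Fine p n y * S m p n \<phi> y - h m Fine p n y * eta_diff m n \<phi>
      + (h m Fine p n y - h m Coarse p n y) * (P Coarse y - e Coarse)"
    unfolding D_eq[OF \<phi> pn y] by (simp add: S P_def[symmetric] e_def[symmetric] eta_diff_def algebra_simps)
  also have "\<bar>\<dots>\<bar> \<le> \<bar>h m Fine p n y * S m p n \<phi> y\<bar> + \<bar>h m Fine p n y * eta_diff m n \<phi>\<bar>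
      + \<bar>(h m Fine p n y - h m Coarse p n y) * (P Coarse y - e Coarse)\<bar>"
    by linarith
  also have "\<dots> \<le> A * w y * w y * n1 + A * w y * w y * \<bar>eta_diff m n \<phi>\<bar> + A * w y * w y * (L * n2 * r)"
  proof (intro add_mono)
    have Aw: "1 \<le> A * w y" using mult_mono[of 1 A 1 "w y"] A w1[OF y] by simp
    then have "1 * (n1 * w y) \<le> A * w y * (n1 * w y)"
      using n0 wpos[of y] by (intro mult_right_mono) auto
    then show "\<bar>h m Fine p n y * S m p n \<phi> y\<bar> \<le> A * w y * w y * n1"
      using n1 by (simp add: mult_ac)
    have "\<bar>h m Fine p n y\<bar> * \<bar>eta_diff m n \<phi>\<bar> \<le> (A * w y * w y) * \<bar>eta_diff m n \<phi>\<bar>"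
    proof (intro mult_right_mono)
      have "A * w y * 1 \<le> A * w y * w y" using A w1[OF y] wpos[of y] by (intro mult_left_mono) auto
      then show "\<bar>h m Fine p n y\<bar> \<le> A * w y * w y"
        using hb'[OF y, of Fine] h0[OF y, of Fine] by simp
    qed simp
    then show "\<bar>h m Fine p n y * eta_diff m n \<phi>\<bar> \<le> A * w y * w y * \<bar>eta_diff m n \<phi>\<bar>"
      by (simp add: abs_mult)
    have "\<bar>h m Fine p n y - h m Coarse p n y\<bar> * \<bar>P Coarse y - e Coarse\<bar> \<le> (n2 * w y) * (A * r * L * w y)"
      using n2 Pb'[OF y, of Coarse] n0 wpos[of y] by (intro mult_mono) auto
    then show "\<bar>(h m Fine p n y - h m Coarse p n y) * (P Coarse y - e Coarse)\<bar> \<le> A * w y * w y * (L * n2 * r)"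
      by (simp add: abs_mult mult_ac)
  qed
  also have "\<dots> = A * w y * w y * T" by (simp add: T algebra_simps)
  finally have d1: "\<bar>?d\<bar> \<le> A * w y * w y * T" .
  have d2: "\<bar>?d\<bar> \<le> 2 * (A * r * L * w y)"
    using Db'[OF y, of Fine] Db'[OF y, of Coarse] by linarith
  have "?d\<^sup>2 = \<bar>?d\<bar> * \<bar>?d\<bar>" by (simp add: power2_eq_square)
  also have "\<dots> \<le> (2 * (A * r * L * w y)) * (A * w y * w y * T)"
    using d1 d2 A r L wpos[of y] by (intro mult_mono) auto
  also have "\<dots> = 2 * A\<^sup>2 * r * L * T * (w y * w y * w y)"
    by (simp add: power2_eq_square mult_ac)
  also have "w y * w y * w y = exp (3 * \<xi> * V y)" by (simp add: w exp_add[symmetric])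
  finally show "(D m Fine p n \<phi> y - D m Coarse p n \<phi> y)\<^sup>2
      \<le> 2 * A\<^sup>2 * \<rho> ^ (n - p) * supnorm X \<phi> * T * exp (3 * \<xi> * V y)"
    by (simp add: r_def L_def)
qed

end

definition variance_estimate ::
  "'a model \<Rightarrow> ('a \<Rightarrow> real) \<Rightarrow> real \<Rightarrow> real \<Rightarrow> real \<Rightarrow> ('a \<times> 'a \<Rightarrow> real) \<Rightarrow> 'a scheme \<Rightarrow> nat \<Rightarrow>
    ('a \<Rightarrow> real) \<Rightarrow> bool" where
  "variance_estimate m V \<xi> \<rho> Z g sch n \<phi> \<longleftrightarrow>
     sigma2 m sch n \<phi> \<le> (\<integral>(x, y). (\<phi> x - \<phi> y - eta_diff m n \<phi>)\<^sup>2 \<partial>ceta m sch n)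
       + Z * (B_term m (\<lambda>x. exp (V x)) \<rho> n \<phi> \<xi>
         + (supnorm (state m) \<phi>)\<^sup>2 * (\<Sum>p<n. \<rho> ^ (n - p) *
           ((\<integral>z. g z \<partial>ceta m sch p) * (\<rho> ^ (n - p) + 1))))"

context stable_model
begin

text \<open>The reduction common to both parts: it remains to estimate the variation of \<open>D\<close> on the fine
  level between the two coupled points.\<close>

lemma sigma2_bound:
  assumes \<rho>: "0 < \<rho>" "\<rho> < 1" and A: "1 \<le> A" and \<xi>: "0 < \<xi>" "3 * \<xi> \<le> 1"
    and sch: "scheme_setting m sch"
    and mom: "uniform_moments k m V R"
    and \<phi>: "\<phi> \<in> bounded_measurable X"
    and Pb: "ratio_forgets m V \<xi> \<rho> A" and Db: "D_decays m V \<xi> \<rho> A" and hb: "h_dominated m V \<xi> A"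
    and E: "0 \<le> E"
    and g: "\<And>p. p < n \<Longrightarrow> integrable (ceta m sch p) g" "\<And>z. z \<in> space (state2 m) \<Longrightarrow> 0 \<le> g z"
    and vary: "\<And>p x y. p < n \<Longrightarrow> x \<in> space X \<Longrightarrow> y \<in> space X \<Longrightarrow>
      (D m Fine p n \<phi> x - D m Fine p n \<phi> y)\<^sup>2 \<le> E * (supnorm X \<phi>)\<^sup>2 * \<rho> ^ (n - p) * g (x, y)"
  shows "variance_estimate m V \<xi> \<rho> (max (2 * E) (4 * A\<^sup>2 * R)) g sch n \<phi>"
proof -
  define L where "L = supnorm X \<phi>"
  have L: "0 \<le> L" unfolding L_def by (rule supnorm_nonneg[OF \<phi> space_nonempty])
  define w where "w = (\<lambda>x. exp (V x) powr \<xi>)"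
  define T where "T p = wnorm X w (\<lambda>x. h m Fine p n x * S m p n \<phi> x) + \<bar>eta_diff m n \<phi>\<bar>
    + L * wnorm X w (\<lambda>x. h m Fine p n x - h m Coarse p n x) * \<rho> ^ (n - p)" for p
  define Z where "Z = max (2 * E) (4 * A\<^sup>2 * R)"
  define I where "I p = (\<integral>z. g z \<partial>ceta m sch p)" for p
  have B: "B_term m (\<lambda>x. exp (V x)) \<rho> n \<phi> \<xi> = L * (\<Sum>p<n. \<rho> ^ (n - p) * T p)"
    by (simp add: B_term_def Let_def L_def T_def w_def)
  have cpl: "is_coupling X (ceta m sch p) (eta m Fine p) (eta m Coarse p)" for p
    by (rule ceta_coupling[OF sch])
  have spc: "space (ceta m sch p) = space X \<times> space X" for p
    by (rule is_couplingD(3)[OF cpl])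
  have summand: "(\<integral>z. (D m Fine p n \<phi> (fst z) - D m Coarse p n \<phi> (snd z))\<^sup>2 \<partial>ceta m sch p)
      \<le> Z * (L * (\<rho> ^ (n - p) * T p) + L\<^sup>2 * (\<rho> ^ (n - p) * (I p * (\<rho> ^ (n - p) + 1))))"
    if p: "p < n" for p
  proof -
    define r where "r = \<rho> ^ (n - p)"
    have r: "0 < r" using \<rho> by (simp add: r_def)
    have pn: "p \<le> n" using p by simp
    note diff = D_level_difference[OF \<rho> A \<xi>(1) \<phi> pn _ Pb Db hb,
        folded w_def L_def, folded T_def, folded r_def]
    have T0: "0 \<le> T p" using space_nonempty diff(1) by blast
    have I0: "0 \<le> I p" unfolding I_def
      by (intro integral_nonneg_AE AE_I2 g(2)) (simp add: spc space_pair_measure)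
    have intv: "integrable (ceta m sch p) (\<lambda>z. exp (3 * \<xi> * V (snd z)))"
      and intv_le: "(\<integral>z. exp (3 * \<xi> * V (snd z)) \<partial>ceta m sch p) \<le> R"
      using coupling_moments[OF cpl uniform_momentsD(1)[OF mom], of 0 "3 * \<xi>" p] \<xi>
        uniform_momentsD(2)[OF mom, of Coarse p] by auto
    have "(\<integral>z. (D m Fine p n \<phi> (fst z) - D m Coarse p n \<phi> (snd z))\<^sup>2 \<partial>ceta m sch p)
        \<le> (\<integral>z. 2 * (E * L\<^sup>2 * r) * g z + 2 * (2 * A\<^sup>2 * r * L * T p) * exp (3 * \<xi> * V (snd z)) \<partial>ceta m sch p)"
    proof (rule integral_mono')
      show "integrable (ceta m sch p)
          (\<lambda>z. 2 * (E * L\<^sup>2 * r) * g z + 2 * (2 * A\<^sup>2 * r * L * T p) * exp (3 * \<xi> * V (snd z)))"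
        using g(1)[OF p] intv by simp
      fix z assume "z \<in> space (ceta m sch p)"
      then have z: "fst z \<in> space X" "snd z \<in> space X" by (auto simp: spc)
      let ?a = "D m Fine p n \<phi> (fst z)" and ?b = "D m Fine p n \<phi> (snd z)" and ?c = "D m Coarse p n \<phi> (snd z)"
      have "(?a - ?c)\<^sup>2 \<le> 2 * (?a - ?b)\<^sup>2 + 2 * (?b - ?c)\<^sup>2"
        using sum_squares_bound[of "?a - ?b" "?b - ?c"] by (simp add: power2_eq_square algebra_simps)
      also have "\<dots> \<le> 2 * (E * L\<^sup>2 * r * g z) + 2 * (2 * A\<^sup>2 * r * L * T p * exp (3 * \<xi> * V (snd z)))"
        using vary[OF p z, folded L_def r_def] diff(2)[OF z(2)] by (intro add_mono mult_left_mono) auto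
      finally show "(?a - ?c)\<^sup>2 \<le> 2 * (E * L\<^sup>2 * r) * g z + 2 * (2 * A\<^sup>2 * r * L * T p) * exp (3 * \<xi> * V (snd z))"
        by (simp add: mult_ac)
      show "0 \<le> 2 * (E * L\<^sup>2 * r) * g z + 2 * (2 * A\<^sup>2 * r * L * T p) * exp (3 * \<xi> * V (snd z))"
        using E L r T0 g(2)[of z] z by (auto intro!: add_nonneg_nonneg mult_nonneg_nonneg simp: space_pair_measure mem_Times_iff)
    qed
    also have "\<dots> = 2 * E * (L\<^sup>2 * r * I p) + 4 * A\<^sup>2 * (r * L * T p) * (\<integral>z. exp (3 * \<xi> * V (snd z)) \<partial>ceta m sch p)"
      using g(1)[OF p] intv by (simp add: I_def)
    also have "\<dots> \<le> 2 * E * (L\<^sup>2 * r * I p) + 4 * A\<^sup>2 * (r * L * T p) * R"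
      using intv_le r L T0 by (intro add_left_mono mult_left_mono) auto
    also have "\<dots> = 2 * E * (L\<^sup>2 * r * I p) + 4 * A\<^sup>2 * R * (r * L * T p)" by simp
    also have "\<dots> \<le> Z * (L\<^sup>2 * r * I p) + Z * (r * L * T p)"
      using r L T0 I0 by (intro add_mono mult_right_mono) (auto simp: Z_def)
    also have "\<dots> \<le> Z * (L\<^sup>2 * r * I p * (r + 1)) + Z * (r * L * T p)"
    proof (intro add_right_mono mult_left_mono)
      show "L\<^sup>2 * r * I p \<le> L\<^sup>2 * r * I p * (r + 1)"
        using r I0 by (simp add: mult_le_cancel_left1 distrib_left)
      show "0 \<le> Z" using E by (simp add: Z_def)
    qed
    also have "\<dots> = Z * (L * (r * T p) + L\<^sup>2 * (r * (I p * (r + 1))))" by (simp add: algebra_simps)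
    finally show ?thesis by (simp add: r_def)
  qed
  have last: "(\<integral>z. (D m Fine n n \<phi> (fst z) - D m Coarse n n \<phi> (snd z))\<^sup>2 \<partial>ceta m sch n) =
      (\<integral>(x, y). (\<phi> x - \<phi> y - eta_diff m n \<phi>)\<^sup>2 \<partial>ceta m sch n)"
    by (intro Bochner_Integration.integral_cong) (auto simp: D_refl eta_diff_def algebra_simps)
  have unc: "(\<integral>(x, y). (D m Fine p n \<phi> x - D m Coarse p n \<phi> y)\<^sup>2 \<partial>ceta m sch p) =
      (\<integral>z. (D m Fine p n \<phi> (fst z) - D m Coarse p n \<phi> (snd z))\<^sup>2 \<partial>ceta m sch p)" for p
    by (intro Bochner_Integration.integral_cong) auto
  have "sigma2 m sch n \<phi> =
      (\<Sum>p<n. \<integral>z. (D m Fine p n \<phi> (fst z) - D m Coarse p n \<phi> (snd z))\<^sup>2 \<partial>ceta m sch p)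
      + (\<integral>z. (D m Fine n n \<phi> (fst z) - D m Coarse n n \<phi> (snd z))\<^sup>2 \<partial>ceta m sch n)"
    by (simp add: sigma2_def unc lessThan_Suc_atMost[symmetric])
  also have "\<dots> \<le> (\<Sum>p<n. Z * (L * (\<rho> ^ (n - p) * T p) + L\<^sup>2 * (\<rho> ^ (n - p) * (I p * (\<rho> ^ (n - p) + 1)))))
      + (\<integral>(x, y). (\<phi> x - \<phi> y - eta_diff m n \<phi>)\<^sup>2 \<partial>ceta m sch n)"
    unfolding last by (intro add_right_mono sum_mono summand) simp
  also have "(\<Sum>p<n. Z * (L * (\<rho> ^ (n - p) * T p) + L\<^sup>2 * (\<rho> ^ (n - p) * (I p * (\<rho> ^ (n - p) + 1))))) =
      Z * (B_term m (\<lambda>x. exp (V x)) \<rho> n \<phi> \<xi> + L\<^sup>2 * (\<Sum>p<n. \<rho> ^ (n - p) * (I p * (\<rho> ^ (n - p) + 1))))"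
    unfolding B by (simp only: sum.distrib sum_distrib_left[symmetric])
  finally show ?thesis by (simp add: variance_estimate_def L_def Z_def I_def add.commute)
qed

text \<open>Only membership is claimed, with no control of the Lipschitz constant: this suffices to apply the
  Lipschitz condition once more, which then bounds the variation of \<open>D\<^sub>p\<^sub>,\<^sub>n\<close> by the weighted norm of
  \<open>D\<^sub>p\<^sub>+\<^sub>1\<^sub>,\<^sub>n\<close> and forgets the Lipschitz constant of \<open>\<phi>\<close>.\<close>

lemma D_Lipschitz:
  assumes lip: "lipschitz_cond K m V d" and metric: "Metric_space (space X) d"
    and \<xi>: "0 < \<xi>" "\<xi> \<le> 1"
    and \<phi>: "\<phi> \<in> bounded_measurable X" "\<phi> \<in> weighted_Lip X (\<lambda>_. 1) d" and "p \<le> n"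
  shows "D m s p n \<phi> \<in> weighted_L X (\<lambda>x. exp (V x) powr \<xi>) \<inter> weighted_Lip X (\<lambda>x. exp (V x) powr \<xi>) d"
proof -
  define w where "w = (\<lambda>x. exp (V x) powr \<xi>)"
  have w1: "1 \<le> w x" if "x \<in> space X" for x
    using V_ge_1[OF that] \<xi> by (simp add: w_def exp_powr_real)
  interpret d: Metric_space "space X" d by (rule metric)
  have wL: "f \<in> weighted_L X w" if f: "f \<in> bounded_measurable X" for f
  proof -
    obtain c where c: "0 \<le> c" "\<And>x. x \<in> space X \<Longrightarrow> \<bar>f x\<bar> \<le> c" by (rule bounded_measurableE[OF f]) blast
    have "\<bar>f x\<bar> / w x \<le> c" if "x \<in> space X" for x
      using c(2)[OF that] mult_left_mono[OF w1[OF that] c(1)] w1[OF that]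
      by (subst pos_divide_le_eq) auto
    then have "bdd_above ((\<lambda>x. \<bar>f x\<bar> / w x) ` space X)" by (rule bdd_aboveI2)
    then show ?thesis using f by (simp add: weighted_L_def bounded_measurable_def)
  qed
  have "\<exists>C. \<forall>x \<in> space X. \<forall>y \<in> space X. \<bar>D m s p n \<phi> x - D m s p n \<phi> y\<bar> \<le> C * d x y * w x * w y"
    using \<open>p \<le> n\<close>
  proof (induction rule: inc_induct)
    case base
    obtain C where C: "\<forall>x \<in> space X. \<forall>y \<in> space X. \<bar>\<phi> x - \<phi> y\<bar> \<le> C * d x y * 1 * 1"
      using \<phi>(2) unfolding weighted_Lip_def by blast
    have "\<bar>D m s n n \<phi> x - D m s n n \<phi> y\<bar> \<le> \<bar>C\<bar> * d x y * w x * w y"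
      if x: "x \<in> space X" and y: "y \<in> space X" for x y
    proof -
      have "\<bar>D m s n n \<phi> x - D m s n n \<phi> y\<bar> \<le> C * d x y" using C x y by (simp add: D_refl)
      also have "\<dots> \<le> \<bar>C\<bar> * d x y" by (intro mult_right_mono) auto
      also have "\<dots> = \<bar>C\<bar> * d x y * (1 * 1)" by simp
      also have "\<dots> \<le> \<bar>C\<bar> * d x y * (w x * w y)"
        using w1 x y by (intro mult_left_mono mult_mono) (auto intro: order_trans[OF zero_le_one])
      finally show ?thesis by (simp add: mult.assoc)
    qed
    then show ?case by blast
  next
    case (step p)
    let ?f = "D m s (Suc p) n \<phi>" and ?G = "\<integral>y. G m p y \<partial>eta m s p"
    have bm: "?f \<in> bounded_measurable X" using step by (intro D_bounded[OF \<phi>(1)]) simp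
    have "?f \<in> weighted_L X w \<inter> weighted_Lip X w d"
      using wL[OF bm] step.IH by (simp add: weighted_Lip_def)
    moreover have "\<forall>\<phi> \<in> weighted_L X w \<inter> weighted_Lip X w d. \<forall>x \<in> space X. \<forall>y \<in> space X. \<forall>s. \<forall>n\<ge>1.
       \<bar>Q m s n \<phi> x - Q m s n \<phi> y\<bar> \<le> K \<xi> * wnorm X w \<phi> * d x y * (exp (V x) * exp (V y)) powr \<xi>"
      using lip \<xi> unfolding lipschitz_cond_def Let_def w_def by blast
    ultimately have *: "\<bar>Q m s (Suc p) ?f x - Q m s (Suc p) ?f y\<bar>
        \<le> K \<xi> * wnorm X w ?f * d x y * (exp (V x) * exp (V y)) powr \<xi>"
      if "x \<in> space X" "y \<in> space X" for x y
      using that by auto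
    have "\<bar>D m s p n \<phi> x - D m s p n \<phi> y\<bar> \<le> (K \<xi> * wnorm X w ?f / ?G) * d x y * w x * w y"
      if "x \<in> space X" "y \<in> space X" for x y
    proof -
      have "\<bar>D m s p n \<phi> x - D m s p n \<phi> y\<bar> = \<bar>Q m s (Suc p) ?f x - Q m s (Suc p) ?f y\<bar> / ?G"
        using step G_integral(3)[of s p] by (simp add: D_step diff_divide_distrib[symmetric] abs_divide)
      also have "\<dots> \<le> (K \<xi> * wnorm X w ?f * d x y * (exp (V x) * exp (V y)) powr \<xi>) / ?G"
        using * that G_integral(3)[of s p] by (intro divide_right_mono) auto
      also have "\<dots> = (K \<xi> * wnorm X w ?f / ?G) * d x y * w x * w y"
        by (simp add: w_def powr_mult)
      finally show ?thesis .
    qed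
    then show ?case by blast
  qed
  then show ?thesis
    using wL[OF D_bounded[OF \<phi>(1) \<open>p \<le> n\<close>], of s] by (simp add: weighted_Lip_def w_def)
qed

end

text \<open>The variation of \<open>D\<close> vanishes on the diagonal and is elsewhere estimated by the decay of \<open>D\<close> at each
  of the two points, with \<open>v\<^sup>\<xi>(x) + v\<^sup>\<xi>(y) \<le> 2 v\<^sup>\<xi>(x) v\<^sup>\<xi>(y)\<close>.\<close>

lemma off_diagonal_bound:
  assumes \<xi>: "0 < \<xi>" "\<xi> < 1/4" and k: "coherent k"
  obtains \<rho> Z where "0 < \<rho>" "\<rho> < 1"
    "\<And>(m :: 'a model) V \<nu> \<phi> n sch. stable_model k m V \<nu> \<Longrightarrow> off_diagonal m \<in> sets (state2 m) \<Longrightarrow>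
      \<phi> \<in> bounded_measurable (state m) \<Longrightarrow> scheme_setting m sch \<Longrightarrow>
      variance_estimate m V \<xi> \<rho> Z
        (\<lambda>(x, y). indicator (off_diagonal m) (x, y) * (exp (V x) * exp (V y)) powr (2 * \<xi>)) sch n \<phi>"
proof -
  have \<xi>1: "\<xi> \<le> 1" "3 * \<xi> \<le> 1" using \<xi> by auto
  obtain R where R1: "1 \<le> R" and mom: "\<And>(m :: 'a model) V \<nu>. stable_model k m V \<nu> \<Longrightarrow> uniform_moments k m V R"
    by (rule moments[OF k, where ?'a = 'a]) (rule that)
  obtain \<rho> A where \<rho>: "0 < \<rho>" "\<rho> < 1" and A: "1 \<le> A"
    and dec: "\<And>(m :: 'a model) V \<nu>. stable_model k m V \<nu> \<Longrightarrow>
       ratio_forgets m V \<xi> \<rho> A \<and> D_decays m V \<xi> \<rho> A \<and> h_dominated m V \<xi> A"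
    by (rule D_bound[OF k \<xi>(1) \<xi>1(1), where ?'a = 'a]) (rule that)
  show ?thesis
  proof (rule that[OF \<rho>])
    fix m :: "'a model" and V \<nu> \<phi> sch and n :: nat
    assume st: "stable_model k m V \<nu>" and off: "off_diagonal m \<in> sets (state2 m)"
      and \<phi>: "\<phi> \<in> bounded_measurable (state m)" and sch: "scheme_setting m sch"
    interpret stable_model k m V \<nu> by (rule st)
    have Pb: "ratio_forgets m V \<xi> \<rho> A" and Db: "D_decays m V \<xi> \<rho> A" and hb: "h_dominated m V \<xi> A"
      using dec[OF st] by auto
    note [measurable] = off
    define L where "L = supnorm X \<phi>"
    have L: "0 \<le> L" unfolding L_def by (rule supnorm_nonneg[OF \<phi> space_nonempty])
    let ?g = "\<lambda>(x, y). indicator (off_diagonal m) (x, y) * (exp (V x) * exp (V y)) powr (2 * \<xi>)"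
    have g: "?g z = indicator (off_diagonal m) z * (exp (2 * \<xi> * V (fst z)) * exp (2 * \<xi> * V (snd z)))" for z
      by (cases z) (simp add: powr_mult exp_powr_real mult.commute)
    have intg: "integrable (ceta m sch p) ?g" for p
    proof -
      note cpl = ceta_coupling[OF sch, of p]
      note [measurable_cong] = is_couplingD(1)[OF cpl]
      show ?thesis unfolding g
        by (rule Bochner_Integration.integrable_bound[OF coupling_moments(1)[OF cpl uniform_momentsD(1)[OF mom[OF st]], of "2 * \<xi>" "2 * \<xi>"]])
          (use \<xi> in \<open>auto simp: indicator_def\<close>)
    qed
    have vary: "(D m Fine p n \<phi> x - D m Fine p n \<phi> y)\<^sup>2 \<le> (4 * A\<^sup>2) * L\<^sup>2 * \<rho> ^ (n - p) * ?g (x, y)"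
      if p: "p < n" and x: "x \<in> space X" and y: "y \<in> space X" for p x y
    proof (cases "x = y")
      case True then show ?thesis using A L \<rho> by simp
    next
      case False
      define r where "r = \<rho> ^ (n - p)"
      have r: "0 \<le> r" "r \<le> 1" using \<rho> by (auto simp: r_def power_le_one)
      let ?a = "exp (\<xi> * V x)" and ?b = "exp (\<xi> * V y)"
      have ab: "1 \<le> ?a" "1 \<le> ?b" using V_ge_1[OF x] V_ge_1[OF y] \<xi> by auto
      have "?a * 1 \<le> ?a * ?b" "1 * ?b \<le> ?a * ?b" using ab by (intro mult_left_mono mult_right_mono; simp)+
      then have sum: "?a + ?b \<le> 2 * (?a * ?b)" by linarith
      have "\<bar>D m Fine p n \<phi> x - D m Fine p n \<phi> y\<bar> \<le> A * r * L * (?a + ?b)"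
        using D_decaysD[OF Db \<phi> less_imp_le[OF p] x, of Fine] D_decaysD[OF Db \<phi> less_imp_le[OF p] y, of Fine]
        unfolding r_def L_def distrib_left by linarith
      also have "\<dots> \<le> A * r * L * (2 * (?a * ?b))" using sum A r L by (intro mult_left_mono) auto
      finally have "(D m Fine p n \<phi> x - D m Fine p n \<phi> y)\<^sup>2 \<le> (A * r * L * (2 * (?a * ?b)))\<^sup>2"
        by (subst abs_le_square_iff[symmetric]) (use A r L in simp)
      also have "\<dots> = 4 * A\<^sup>2 * L\<^sup>2 * (r * r) * (?a * ?a * (?b * ?b))"
        by (simp add: power2_eq_square mult_ac)
      also have "\<dots> \<le> 4 * A\<^sup>2 * L\<^sup>2 * (r * 1) * (?a * ?a * (?b * ?b))"
        using r by (intro mult_right_mono mult_left_mono) auto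
      also have "?a * ?a * (?b * ?b) = ?g (x, y)"
        using False x y unfolding g by (simp add: off_diagonal_def space_pair_measure exp_add[symmetric])
      finally show ?thesis by (simp add: r_def)
    qed
    show "variance_estimate m V \<xi> \<rho> (max (2 * (4 * A\<^sup>2)) (4 * A\<^sup>2 * R))
        (\<lambda>(x, y). indicator (off_diagonal m) (x, y) * (exp (V x) * exp (V y)) powr (2 * \<xi>)) sch n \<phi>"
      by (rule sigma2_bound[OF \<rho> A \<xi>(1) \<xi>1(2) sch mom[OF st] \<phi> Pb Db hb _ intg])
        (use vary in \<open>auto simp: L_def\<close>)
  qed
qed

text \<open>Writing \<open>D\<^sub>p\<^sub>,\<^sub>n = Q\<^sub>p\<^sub>+\<^sub>1(D\<^sub>p\<^sub>+\<^sub>1\<^sub>,\<^sub>n) / \<eta>\<^sub>p(G\<^sub>p)\<close>, the Lipschitz condition gives the factor \<open>d x y\<close> and the decay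
  of \<open>D\<^sub>p\<^sub>+\<^sub>1\<^sub>,\<^sub>n\<close> the geometric one. The restriction on \<open>\<xi>\<close> makes the weight integrable under every coupling.\<close>

lemma Lipschitz_bound:
  fixes K :: "real \<Rightarrow> real" and K\<^sub>d \<xi>' \<xi> :: real
  assumes \<xi>': "0 < \<xi>'" and \<xi>: "0 < \<xi>" "\<xi> < (1 - 2 * \<xi>') / 12" and k: "coherent k"
  obtains \<rho> Z where "0 < \<rho>" "\<rho> < 1"
    "\<And>(m :: 'a model) V \<nu> \<phi> d n sch. stable_model k m V \<nu> \<Longrightarrow>
      Metric_space (space (state m)) d \<Longrightarrow> lipschitz_cond K m V d \<Longrightarrow>
      (\<lambda>(x, y). (d x y)\<^sup>2) \<in> weighted_L (state2 m) (\<lambda>(x, y). (exp (V x) * exp (V y)) powr \<xi>') \<Longrightarrow>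
      wnorm (state2 m) (\<lambda>(x, y). (exp (V x) * exp (V y)) powr \<xi>') (\<lambda>(x, y). (d x y)\<^sup>2) \<le> K\<^sub>d \<Longrightarrow>
      \<phi> \<in> bounded_measurable (state m) \<inter> weighted_Lip (state m) (\<lambda>_. 1) d \<Longrightarrow> scheme_setting m sch \<Longrightarrow>
      variance_estimate m V \<xi> \<rho> Z
        (\<lambda>(x, y). (d x y)\<^sup>2 * (exp (V x) powr (4 * \<xi>) * exp (V y) powr (8 * \<xi>))) sch n \<phi>"
proof -
  have \<xi>1: "\<xi> \<le> 1" "3 * \<xi> \<le> 1" using \<xi> \<xi>' by auto
  obtain R where R1: "1 \<le> R" and mom: "\<And>(m :: 'a model) V \<nu>. stable_model k m V \<nu> \<Longrightarrow> uniform_moments k m V R"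
    by (rule moments[OF k, where ?'a = 'a]) (rule that)
  obtain \<rho> A where \<rho>: "0 < \<rho>" "\<rho> < 1" and A: "1 \<le> A"
    and dec: "\<And>(m :: 'a model) V \<nu>. stable_model k m V \<nu> \<Longrightarrow>
       ratio_forgets m V \<xi> \<rho> A \<and> D_decays m V \<xi> \<rho> A \<and> h_dominated m V \<xi> A"
    by (rule D_bound[OF k \<xi>(1) \<xi>1(1), where ?'a = 'a]) (rule that)
  define c where "c = mass_const k / R"
  have c: "0 < c" using mass_const_pos[OF k] R1 by (simp add: c_def)
  define H where "H = \<bar>K \<xi>\<bar> * A / (c * \<rho>)"
  have H: "0 \<le> H" using A c \<rho> by (simp add: H_def)
  show ?thesis
  proof (rule that[OF \<rho>])
    fix m :: "'a model" and V \<nu> \<phi> d sch and n :: nat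
    assume st: "stable_model k m V \<nu>" and metric: "Metric_space (space (state m)) d"
      and lip: "lipschitz_cond K m V d"
      and dL: "(\<lambda>(x, y). (d x y)\<^sup>2) \<in> weighted_L (state2 m) (\<lambda>(x, y). (exp (V x) * exp (V y)) powr \<xi>')"
      and dK: "wnorm (state2 m) (\<lambda>(x, y). (exp (V x) * exp (V y)) powr \<xi>') (\<lambda>(x, y). (d x y)\<^sup>2) \<le> K\<^sub>d"
      and \<phi>': "\<phi> \<in> bounded_measurable (state m) \<inter> weighted_Lip (state m) (\<lambda>_. 1) d"
      and sch: "scheme_setting m sch"
    interpret stable_model k m V \<nu> by (rule st)
    have Pb: "ratio_forgets m V \<xi> \<rho> A" and Db: "D_decays m V \<xi> \<rho> A" and hb: "h_dominated m V \<xi> A"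
      using dec[OF st] by auto
    interpret d: Metric_space "space X" d by (rule metric)
    have \<phi>: "\<phi> \<in> bounded_measurable X" and \<phi>L: "\<phi> \<in> weighted_Lip X (\<lambda>_. 1) d" using \<phi>' by auto
    define L where "L = supnorm X \<phi>"
    have L: "0 \<le> L" unfolding L_def by (rule supnorm_nonneg[OF \<phi> space_nonempty])
    have dmeas: "(\<lambda>(x, y). (d x y)\<^sup>2) \<in> borel_measurable (state2 m)"
      using dL by (simp add: weighted_L_def)
    have d2: "(d x y)\<^sup>2 \<le> K\<^sub>d * (exp (\<xi>' * V x) * exp (\<xi>' * V y))"
      if x: "x \<in> space X" and y: "y \<in> space X" for x y
    proof -
      let ?W = "\<lambda>(x, y). (exp (V x) * exp (V y)) powr \<xi>'"
      have "\<bar>(\<lambda>(x, y). (d x y)\<^sup>2) (x, y)\<bar> / ?W (x, y) \<le> wnorm (state2 m) ?W (\<lambda>(x, y). (d x y)\<^sup>2)"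
        unfolding wnorm_def using dL x y
        by (intro cSUP_upper) (auto simp: weighted_L_def space_pair_measure)
      then have "(d x y)\<^sup>2 / (exp (V x) * exp (V y)) powr \<xi>' \<le> K\<^sub>d" using dK by simp
      then show ?thesis by (simp add: pos_divide_le_eq powr_mult exp_powr_real mult.commute)
    qed
    let ?g = "\<lambda>(x, y). (d x y)\<^sup>2 * (exp (V x) powr (4 * \<xi>) * exp (V y) powr (8 * \<xi>))"
    have g: "?g z = (case z of (x, y) \<Rightarrow> (d x y)\<^sup>2) * (exp (4 * \<xi> * V (fst z)) * exp (8 * \<xi> * V (snd z)))" for z
      by (cases z) (simp add: exp_powr_real mult.commute)
    have intg: "integrable (ceta m sch p) ?g" for p
    proof -
      note cpl = ceta_coupling[OF sch, of p]
      note [measurable_cong] = is_couplingD(1)[OF cpl]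
      note [measurable] = dmeas
      have spc: "space (ceta m sch p) = space X \<times> space X" by (rule is_couplingD(3)[OF cpl])
      have i: "integrable (ceta m sch p) (\<lambda>z. K\<^sub>d * (exp ((\<xi>' + 4 * \<xi>) * V (fst z)) * exp ((\<xi>' + 8 * \<xi>) * V (snd z))))"
        by (intro integrable_mult_right coupling_moments(1)[OF cpl uniform_momentsD(1)[OF mom[OF st]]]) (use \<xi> \<xi>' in auto)
      have le: "norm (?g z) \<le> norm (K\<^sub>d * (exp ((\<xi>' + 4 * \<xi>) * V (fst z)) * exp ((\<xi>' + 8 * \<xi>) * V (snd z))))"
        if zs: "z \<in> space (ceta m sch p)" for z
      proof -
        obtain x y where z: "z = (x, y)" "x \<in> space X" "y \<in> space X" using zs by (cases z) (auto simp: spc)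
        have "?g z = (d x y)\<^sup>2 * (exp (4 * \<xi> * V x) * exp (8 * \<xi> * V y))" unfolding g by (simp add: z)
        also have "\<dots> \<le> K\<^sub>d * (exp (\<xi>' * V x) * exp (\<xi>' * V y)) * (exp (4 * \<xi> * V x) * exp (8 * \<xi> * V y))"
          using d2[OF z(2,3)] by (intro mult_right_mono) auto
        also have "\<dots> = K\<^sub>d * (exp ((\<xi>' + 4 * \<xi>) * V (fst z)) * exp ((\<xi>' + 8 * \<xi>) * V (snd z)))"
          unfolding z fst_conv snd_conv distrib_right exp_add by (simp only: mult_ac)
        finally have "?g z \<le> K\<^sub>d * (exp ((\<xi>' + 4 * \<xi>) * V (fst z)) * exp ((\<xi>' + 8 * \<xi>) * V (snd z)))" .
        moreover have "0 \<le> ?g z" by (simp add: z)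
        ultimately show ?thesis by simp
      qed
      show ?thesis
        by (rule Bochner_Integration.integrable_bound[OF i _ AE_I2[OF le]]) (unfold g, measurable)
    qed
    have vary: "(D m Fine p n \<phi> x - D m Fine p n \<phi> y)\<^sup>2 \<le> H\<^sup>2 * L\<^sup>2 * \<rho> ^ (n - p) * ?g (x, y)"
      if p: "p < n" and x: "x \<in> space X" and y: "y \<in> space X" for p x y
    proof -
      define r where "r = \<rho> ^ (n - p)"
      have r: "0 \<le> r" "r \<le> 1" using \<rho> by (auto simp: r_def power_le_one)
      have rS: "\<rho> ^ (n - Suc p) = r / \<rho>"
        unfolding r_def Suc_diff_Suc[OF p, symmetric] using \<rho> by simp
      let ?w = "\<lambda>x. exp (V x) powr \<xi>" and ?f = "D m Fine (Suc p) n \<phi>" and ?G = "\<integral>y. G m p y \<partial>eta m Fine p"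
      let ?a = "exp (\<xi> * V x)" and ?b = "exp (\<xi> * V y)"
      have G: "0 < ?G" "c \<le> ?G" using G_integral(3)[of Fine p] uniform_momentsD(4)[OF mom[OF st], of Fine p] by (simp_all add: c_def)
      have fmem: "?f \<in> weighted_L X ?w \<inter> weighted_Lip X ?w d"
        by (rule D_Lipschitz[OF lip metric \<xi>(1) \<xi>1(1) \<phi> \<phi>L]) (use p in simp)
      have fb: "\<bar>?f z\<bar> \<le> A * (r / \<rho>) * L * ?w z" if "z \<in> space X" for z
        using D_decaysD[OF Db \<phi> _ that, of "Suc p" n Fine] p by (simp add: rS L_def exp_powr_real mult.commute)
      have fn: "0 \<le> wnorm X ?w ?f" "wnorm X ?w ?f \<le> A * (r / \<rho>) * L"
        by (rule wnorm_nonneg[OF space_nonempty _ fb], simp, simp, rule wnorm_le[OF space_nonempty _ fb], simp, simp)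
      have "\<forall>\<phi> \<in> weighted_L X ?w \<inter> weighted_Lip X ?w d. \<forall>x \<in> space X. \<forall>y \<in> space X. \<forall>s. \<forall>n\<ge>1.
         \<bar>Q m s n \<phi> x - Q m s n \<phi> y\<bar> \<le> K \<xi> * wnorm X ?w \<phi> * d x y * (exp (V x) * exp (V y)) powr \<xi>"
        using lip \<xi>(1) \<xi>1(1) unfolding lipschitz_cond_def Let_def by blast
      from this[rule_format, OF fmem x y, of "Suc p" Fine]
      have "\<bar>Q m Fine (Suc p) ?f x - Q m Fine (Suc p) ?f y\<bar>
          \<le> K \<xi> * wnorm X ?w ?f * d x y * (?a * ?b)"
        by (simp add: powr_mult exp_powr_real mult.commute)
      also have "\<dots> \<le> \<bar>K \<xi>\<bar> * (A * (r / \<rho>) * L) * d x y * (?a * ?b)"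
        using fn by (intro mult_right_mono mult_mono) auto
      finally have q: "\<bar>Q m Fine (Suc p) ?f x - Q m Fine (Suc p) ?f y\<bar>
          \<le> \<bar>K \<xi>\<bar> * (A * (r / \<rho>) * L) * d x y * (?a * ?b)" .
      have "\<bar>D m Fine p n \<phi> x - D m Fine p n \<phi> y\<bar> = \<bar>Q m Fine (Suc p) ?f x - Q m Fine (Suc p) ?f y\<bar> / ?G"
        using p G by (simp add: D_step diff_divide_distrib[symmetric] abs_divide)
      also have "\<dots> \<le> (\<bar>K \<xi>\<bar> * (A * (r / \<rho>) * L) * d x y * (?a * ?b)) / c"
        using q G c by (intro frac_le) auto
      also have "\<dots> = H * r * L * (d x y * (?a * ?b))"
        using \<rho> c by (simp add: H_def field_simps)
      finally have "(D m Fine p n \<phi> x - D m Fine p n \<phi> y)\<^sup>2 \<le> (H * r * L * (d x y * (?a * ?b)))\<^sup>2"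
        by (subst abs_le_square_iff[symmetric]) (use H r L in simp)
      also have "\<dots> = H\<^sup>2 * L\<^sup>2 * (r * r) * ((d x y)\<^sup>2 * (?a * ?a * (?b * ?b)))"
        by (simp add: power2_eq_square mult_ac)
      also have "\<dots> \<le> H\<^sup>2 * L\<^sup>2 * (r * 1) * ((d x y)\<^sup>2 * (exp (4 * \<xi> * V x) * exp (8 * \<xi> * V y)))"
        using r V_ge_1[OF x] V_ge_1[OF y] \<xi>(1)
        by (intro mult_mono mult_left_mono) (auto simp: exp_add[symmetric])
      also have "(d x y)\<^sup>2 * (exp (4 * \<xi> * V x) * exp (8 * \<xi> * V y)) = ?g (x, y)" unfolding g by simp
      finally show ?thesis by (simp add: r_def)
    qed
    show "variance_estimate m V \<xi> \<rho> (max (2 * H\<^sup>2) (4 * A\<^sup>2 * R))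
        (\<lambda>(x, y). (d x y)\<^sup>2 * (exp (V x) powr (4 * \<xi>) * exp (V y) powr (8 * \<xi>))) sch n \<phi>"
      by (rule sigma2_bound[OF \<rho> A \<xi>(1) \<xi>1(2) sch mom[OF st] \<phi> Pb Db hb _ intg])
        (use vary in \<open>auto simp: L_def\<close>)
  qed
qed

theorem theorem4p3:
  fixes k :: constants
  shows
    "(\<forall>\<xi>::real. 0 < \<xi> \<and> \<xi> < 1/4 \<longrightarrow>
       (\<exists>\<rho> C::real. 0 < \<rho> \<and> \<rho> < 1 \<and>
         (\<forall>(m :: 'a model) V \<nu> v.
            valid_model m \<and> standing_conds k m V \<nu> \<and> v = (\<lambda>x. exp (V x)) \<and>
            off_diagonal m \<in> sets (state2 m) \<longrightarrow>
            (\<forall>\<phi> \<in> bounded_measurable (state m). \<forall>n\<ge>1. \<forall>s. scheme_setting m s \<longrightarrow>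
               sigma2 m s n \<phi>
               \<le> (\<integral>(x, y). (\<phi> x - \<phi> y - eta_diff m n \<phi>)\<^sup>2 \<partial>ceta m s n)
                 + C * (B_term m v \<rho> n \<phi> \<xi>
                    + (supnorm (state m) \<phi>)\<^sup>2 * (\<Sum>p<n. \<rho> ^ (n - p) *
                        ((\<integral>(x, y). indicator (off_diagonal m) (x, y) * (v x * v y) powr (2 * \<xi>)
                            \<partial>ceta m s p) * (\<rho> ^ (n - p) + 1))))))))
   \<and>
     (\<forall>(K :: real \<Rightarrow> real) (K\<^sub>d :: real) (\<xi>' :: real) (\<xi> :: real).
       0 < \<xi>' \<and> \<xi>' < 1/2 \<and> 0 < \<xi> \<and> \<xi> < (1 - 2 * \<xi>') / 12 \<longrightarrow>
       (\<exists>\<rho> C::real. 0 < \<rho> \<and> \<rho> < 1 \<and>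
         (\<forall>(m :: 'a model) V \<nu> v d.
            valid_model m \<and> standing_conds k m V \<nu> \<and> v = (\<lambda>x. exp (V x)) \<and>
            Metric_space (space (state m)) d \<and> lipschitz_cond K m V d \<and>
            (\<lambda>(x, y). (d x y)\<^sup>2) \<in> weighted_L (state2 m) (\<lambda>(x, y). (v x * v y) powr \<xi>') \<and>
            wnorm (state2 m) (\<lambda>(x, y). (v x * v y) powr \<xi>') (\<lambda>(x, y). (d x y)\<^sup>2) \<le> K\<^sub>d \<longrightarrow>
            (\<forall>\<phi> \<in> bounded_measurable (state m) \<inter> weighted_Lip (state m) (\<lambda>_. 1) d.
             \<forall>n\<ge>1. \<forall>s. scheme_setting m s \<longrightarrow>
               sigma2 m s n \<phi>
               \<le> (\<integral>(x, y). (\<phi> x - \<phi> y - eta_diff m n \<phi>)\<^sup>2 \<partial>ceta m s n)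
                 + C * (B_term m v \<rho> n \<phi> \<xi>
                    + (supnorm (state m) \<phi>)\<^sup>2 * (\<Sum>p<n. \<rho> ^ (n - p) *
                        ((\<integral>(x, y). (d x y)\<^sup>2 * (v x powr (4 * \<xi>) * v y powr (8 * \<xi>))
                            \<partial>ceta m s p) * (\<rho> ^ (n - p) + 1))))))))"
proof (cases "coherent k")
  case False
  then have none: "\<not> (valid_model m \<and> standing_conds k m V \<nu>)" for m :: "'a model" and V \<nu>
    using stable_model.coherent[of k m V \<nu>] by (auto simp: stable_model_def)
  show ?thesis
    by (intro conjI allI impI exI[of _ "1 / 2 :: real"]) ((simp; fail) | (use none in blast))+
next
  case True
  show ?thesis
  proof (intro conjI allI impI, goal_cases)
    case (1 \<xi>)
    then have \<xi>: "0 < \<xi>" "\<xi> < 1/4" by auto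
    obtain \<rho> Z where \<rho>: "0 < \<rho>" "\<rho> < 1"
      and bound: "\<And>(m :: 'a model) V \<nu> \<phi> n sch. stable_model k m V \<nu> \<Longrightarrow>
        off_diagonal m \<in> sets (state2 m) \<Longrightarrow> \<phi> \<in> bounded_measurable (state m) \<Longrightarrow>
        scheme_setting m sch \<Longrightarrow> variance_estimate m V \<xi> \<rho> Z
          (\<lambda>(x, y). indicator (off_diagonal m) (x, y) * (exp (V x) * exp (V y)) powr (2 * \<xi>)) sch n \<phi>"
      by (rule off_diagonal_bound[OF \<xi> True, where ?'a = 'a]) (rule that)
    show ?case
      by (intro exI[of _ \<rho>] exI[of _ Z] conjI allI impI ballI \<rho>)
        (auto intro!: bound[unfolded variance_estimate_def] stable_model.intro)
  next
    case (2 K K\<^sub>d \<xi>' \<xi>)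
    then have \<xi>: "0 < \<xi>'" "0 < \<xi>" "\<xi> < (1 - 2 * \<xi>') / 12" by auto
    obtain \<rho> Z where \<rho>: "0 < \<rho>" "\<rho> < 1"
      and bound: "\<And>(m :: 'a model) V \<nu> \<phi> d n sch. stable_model k m V \<nu> \<Longrightarrow>
        Metric_space (space (state m)) d \<Longrightarrow> lipschitz_cond K m V d \<Longrightarrow>
        (\<lambda>(x, y). (d x y)\<^sup>2) \<in> weighted_L (state2 m) (\<lambda>(x, y). (exp (V x) * exp (V y)) powr \<xi>') \<Longrightarrow>
        wnorm (state2 m) (\<lambda>(x, y). (exp (V x) * exp (V y)) powr \<xi>') (\<lambda>(x, y). (d x y)\<^sup>2) \<le> K\<^sub>d \<Longrightarrow>
        \<phi> \<in> bounded_measurable (state m) \<inter> weighted_Lip (state m) (\<lambda>_. 1) d \<Longrightarrow>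
        scheme_setting m sch \<Longrightarrow> variance_estimate m V \<xi> \<rho> Z
          (\<lambda>(x, y). (d x y)\<^sup>2 * (exp (V x) powr (4 * \<xi>) * exp (V y) powr (8 * \<xi>))) sch n \<phi>"
      by (rule Lipschitz_bound[OF \<xi> True, where ?'a = 'a]) (rule that)
    show ?case
      by (intro exI[of _ \<rho>] exI[of _ Z] conjI allI impI ballI \<rho>)
        (elim conjE, hypsubst, rule bound[unfolded variance_estimate_def], auto intro: stable_model.intro)
  qed
qed

end
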